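(* Assume that $\operatorname{pr}_{V_1}(X)=\mathbb K^{V_1}$, where $\operatorname{pr}_{V_1}\colon\mathbb K^{E_1'\cup V_1}\to\mathbb K^{V_1}$ is the canonical projection, and let $H$ be the operator associated with the form $\tau$. (a) Assume that $X$ is a sublattice of $\mathbb K^{E_1'\cup V_1}$ and that the semigroup $(e^{-tL})_{t\geq0}$ (on $X$) is positivity preserving. Then $(e^{-tH})_{t\geq0}$ is positivity preserving. (b) Assume that $X$ is a Stonean sublattice of $\mathbb K^{E_1'\cup V_1}$ and that the semigroup $(e^{-tL})_{t\geq0}$ (on $X$) is a submarkovian semigroup. Then $(e^{-tH})_{t\geq0}$ is submarkovian.
   Context: **Setting.** $\mathbb K\in\{\mathbb R,\mathbb C\}$; all function spaces consist of $\mathbb K$-valued functions. $\Gamma=(V,E,\gamma)$ is a finite directed graph: $V$ (vertices) and $E$ (edges) are finite disjoint sets and $\gamma=(\gamma_0,\gamma_1)\colon E\to V\times V$ assigns to each edge a starting vertex $\gamma_0(e)$ and an end vertex $\gamma_1(e)$. Each $e\in E$ corresponds to an interval $[a_e,b_e]\subseteq\mathbb R$, $a_e<b_e$, and carries a finite Borel measure $\mu_e$ on $[a_e,b_e]$ such that either $\mu_e=0$, or $a_e,b_e\in\operatorname{spt}\mu_e$ and $\mu_e(\{a_e,b_e\})=0$. Put $E_0:=\{e\in E:\mu_e=0\}$, $E_1:=E\setminus E_0$. Each $v\in V$ has a weight $\mu_v\geq0$; put $V_0:=\{v\in V:\mu_v=0\}$, $V_1:=V\setminus V_0$. **Hilbert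 space.** $\mathcal H_\Gamma:=\mathcal H_E\oplus\mathbb K^{V_1}$ with $\mathcal H_E:=\bigoplus_{e\in E_1}L_2([a_e,b_e],\mu_e)$ and scalar product $(f\mid g)_{\mathcal H_\Gamma}=\sum_{e\in E_1}(f_e\mid g_e)_{L_2([a_e,b_e],\mu_e)}+\sum_{v\in V_1}f_v\overline{g_v}\,\mu_v$ for $f=((f_e)_{e\in E_1},(f_v)_{v\in V_1})$ and $g$ likewise. Thus $\mathcal H_\Gamma$ is the $L_2$-space of the disjoint union of the $([a_e,b_e],\mu_e)$, $e\in E_1$, and the point masses $\mu_v$ at $v\in V_1$; order, modulus and sup-norm are understood accordingly. **The map $\iota$.** For $e\in E_1$ let $C_{\mu_e}[a_e,b_e]$ be the set of $f\in C[a_e,b_e]$ that are affine linear on the components of $[a_e,b_e]\setminus\operatorname{spt}\mu_e$, and $W^1_{2,\mu_e}(a_e,b_e):=W^1_2(a_e,b_e)\cap C_{\mu_e}[a_e,b_e]$. Let $D(\iota_e)$ be the set of $f\in L_2([a_e,b_e],\mu_e)$ for which there is $g\in W^1_2(a_e,b_e)\cap C[a_e,b_e]$ with $g=f$ $\mu_e$-a.e. For $f\in D(\iota_e)$, $\iota_ef$ denotes the unique $g\in W^1_{2,\mu_e}(a_e,b_e)$ with $g=f$ $\mu_e$-a.e. (existence and uniqueness are known). Define $D(\iota):=\{f\in\mathcal H_\Gamma: f_e\in D(\iota_e)\ (e\in E_1)\}$, $(\iota f)_e:=\iota_ef_e$ $(e\in E_1)$, $(\iota f)_v:=f_v$ $(v\in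 V_1)$. **Trace.** With $E_1':=E_1\times\{0,1\}$, define $\operatorname{tr}\colon\prod_{e\in E_1}C[a_e,b_e]\times\mathbb K^{V_1}\to\mathbb K^{E_1'\cup V_1}$ by $\operatorname{tr}f(e,0):=f_e(a_e)$, $\operatorname{tr}f(e,1):=f_e(b_e)$ $(e\in E_1)$, $\operatorname{tr}f(v):=f_v$ $(v\in V_1)$. The space $\mathbb K^{E_1'\cup V_1}$ has the scalar product $(\xi\mid\eta):=\sum_{(e,j)\in E_1'}\xi(e,j)\overline{\eta(e,j)}+\sum_{v\in V_1}\xi(v)\overline{\eta(v)}\,\mu_v$. **Form.** Let $X$ be a subspace of $\mathbb K^{E_1'\cup V_1}$ and $L$ a self-adjoint operator in $X$ (with respect to the scalar product $(\xi\mid\eta)=\sum_{(e,j)\in E_1'}\xi(e,j)\overline{\eta(e,j)}+\sum_{v\in V_1}\xi(v)\overline{\eta(v)}\,\mu_v$ of $\mathbb K^{E_1'\cup V_1}$, restricted to $X$). Define $$D(\tau):=\{f\in D(\iota):\operatorname{tr}(\iota f)\in X\},$$ $$\tau(f,g):=\sum_{e\in E_1}\int_{a_e}^{b_e}(\iota_ef_e)'(x)\overline{(\iota_eg_e)'(x)}\,dx+\bigl(L\operatorname{tr}(\iota f)\mid\operatorname{tr}(\iota g)\bigr)\qquad(f,g\in D(\tau)).$$ If $\operatorname{pr}_{V_1}(X)=\mathbb K^{V_1}$, then $\tau$ is a densely defined, symmetric, bounded below, closed form in $\mathcal H_\Gamma$. The associated operator $H$ (self-adjoint and bounded below) is defined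 by: $f\in D(H)$ and $Hf=h$ if and only if $f\in D(\tau)$, $h\in\mathcal H_\Gamma$ and $\tau(f,g)=(h\mid g)_{\mathcal H_\Gamma}$ for all $g\in D(\tau)$. $(e^{-tH})_{t\geq0}$ is the $C_0$-semigroup on $\mathcal H_\Gamma$ generated by $-H$. **Lattices.** For a finite set $S$, $\mathbb K^S$ is considered as the function space $C(S)$, with $|x|$ and (for real $x,y$) $x\wedge y$ defined pointwise. A sublattice of $\mathbb K^S$ is a subspace $Y$ such that $x\in Y$ implies $|x|\in Y$. A sublattice $Y$ is called Stonean if additionally $x\wedge\mathbf 1\in Y$ for all real $x\in Y$, where $\mathbf 1$ is the constant function $1$. **Semigroups.** A semigroup $(T(t))_{t\geq0}$ on $\mathcal H_\Gamma$ (resp. on a sublattice $Y$ of $\mathbb K^S$) is positivity preserving (positive) if $T(t)f\geq0$ for all $f\geq0$ in the space and all $t\geq0$. It is submarkovian if it is positivity preserving and $\|T(t)f\|_\infty\leq\|f\|_\infty$ for all $t\geq0$ and all bounded $f$ in the space. *)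

theory Defs
  imports "HOL-Analysis.Analysis" "Graph_Theory.Digraph"
begin

text \<open>
  The scalar field is a set \<open>K\<close> of complex numbers, either \<open>\<real>\<close> or \<open>UNIV\<close>; a \<open>K\<close>-valued function
  is a complex function with values in \<open>K\<close>.  All spaces below consist of functions
  \<open>'i \<Rightarrow> complex\<close> on some index type, with pointwise operations.
\<close>

section \<open>Function spaces over finite sets\<close>

text \<open>The space \<open>K\<^sup>S\<close>; functions are extended by 0 outside \<open>S\<close>.\<close>

definition K_fun :: "complex set \<Rightarrow> 'i set \<Rightarrow> ('i \<Rightarrow> complex) set" where
  "K_fun K S = {x. (\<forall>i\<in>S. x i \<in> K) \<and> (\<forall>i. i \<notin> S \<longrightarrow> x i = 0)}"

definition K_subspace :: "complex set \<Rightarrow> 'i set \<Rightarrow> ('i \<Rightarrow> complex) set \<Rightarrow> bool" where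
  "K_subspace K S Y \<longleftrightarrow>
     Y \<subseteq> K_fun K S \<and> (\<lambda>i. 0) \<in> Y \<and>
     (\<forall>x\<in>Y. \<forall>y\<in>Y. (\<lambda>i. x i + y i) \<in> Y) \<and>
     (\<forall>c\<in>K. \<forall>x\<in>Y. (\<lambda>i. c * x i) \<in> Y)"

definition sublattice :: "complex set \<Rightarrow> 'i set \<Rightarrow> ('i \<Rightarrow> complex) set \<Rightarrow> bool" where
  "sublattice K S Y \<longleftrightarrow>
     K_subspace K S Y \<and> (\<forall>x\<in>Y. (\<lambda>i. complex_of_real (cmod (x i))) \<in> Y)"

text \<open>Outside \<open>S\<close> the value of \<open>x \<and> 1\<close> below is \<open>min 0 1 = 0\<close>, as it has to be.\<close>

definition stonean_sublattice :: "complex set \<Rightarrow> 'i set \<Rightarrow> ('i \<Rightarrow> complex) set \<Rightarrow> bool" where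
  "stonean_sublattice K S Y \<longleftrightarrow>
     sublattice K S Y \<and>
     (\<forall>x\<in>Y. (\<forall>i. x i \<in> \<real>) \<longrightarrow> (\<lambda>i. complex_of_real (min (Re (x i)) 1)) \<in> Y)"

text \<open>An everywhere defined self-adjoint operator in a (finite-dimensional) space \<open>Y\<close> with scalar
  product \<open>ip\<close>; the values of \<open>L\<close> outside \<open>Y\<close> are irrelevant.\<close>

definition selfadjoint_in ::
  "complex set \<Rightarrow> ('i \<Rightarrow> complex) set \<Rightarrow> (('i \<Rightarrow> complex) \<Rightarrow> ('i \<Rightarrow> complex) \<Rightarrow> complex) \<Rightarrow>
   (('i \<Rightarrow> complex) \<Rightarrow> 'i \<Rightarrow> complex) \<Rightarrow> bool" where
  "selfadjoint_in K Y ip L \<longleftrightarrow>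
     (\<forall>x\<in>Y. L x \<in> Y) \<and>
     (\<forall>x\<in>Y. \<forall>y\<in>Y. L (\<lambda>i. x i + y i) = (\<lambda>i. L x i + L y i)) \<and>
     (\<forall>c\<in>K. \<forall>x\<in>Y. L (\<lambda>i. c * x i) = (\<lambda>i. c * L x i)) \<and>
     (\<forall>x\<in>Y. \<forall>y\<in>Y. ip (L x) y = ip x (L y))"

definition operator_exp :: "(('i \<Rightarrow> complex) \<Rightarrow> 'i \<Rightarrow> complex) \<Rightarrow> ('i \<Rightarrow> complex) \<Rightarrow> 'i \<Rightarrow> complex" where
  "operator_exp A x = (\<lambda>i. \<Sum>n. (A ^^ n) x i / fact n)"

definition exp_semigroup ::
  "(('i \<Rightarrow> complex) \<Rightarrow> 'i \<Rightarrow> complex) \<Rightarrow> real \<Rightarrow> ('i \<Rightarrow> complex) \<Rightarrow> 'i \<Rightarrow> complex" where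
  "exp_semigroup L t = operator_exp (\<lambda>x i. - complex_of_real t * L x i)"


section \<open>Semigroups\<close>

text \<open>
  Elements of an \<open>L\<^sub>2\<close>-space are represented by functions, and \<open>N\<close> is the corresponding seminorm;
  \<open>f\<close> and \<open>g\<close> represent the same element if and only if \<open>N (f - g) = 0\<close>.  Accordingly all
  identities are required modulo \<open>N\<close>; the bound on \<open>T t\<close> together with linearity makes \<open>T t\<close>
  well defined on equivalence classes.
\<close>

definition C0_semigroup ::
  "complex set \<Rightarrow> ('i \<Rightarrow> complex) set \<Rightarrow> (('i \<Rightarrow> complex) \<Rightarrow> real) \<Rightarrow>
   (real \<Rightarrow> ('i \<Rightarrow> complex) \<Rightarrow> 'i \<Rightarrow> complex) \<Rightarrow> bool" where
  "C0_semigroup K Y N T \<longleftrightarrow>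
     (\<forall>t\<ge>0. \<forall>f\<in>Y. T t f \<in> Y) \<and>
     (\<forall>t\<ge>0. \<forall>f\<in>Y. \<forall>g\<in>Y. N (\<lambda>i. T t (\<lambda>j. f j + g j) i - (T t f i + T t g i)) = 0) \<and>
     (\<forall>t\<ge>0. \<forall>c\<in>K. \<forall>f\<in>Y. N (\<lambda>i. T t (\<lambda>j. c * f j) i - c * T t f i) = 0) \<and>
     (\<forall>t\<ge>0. \<exists>C. \<forall>f\<in>Y. N (T t f) \<le> C * N f) \<and>
     (\<forall>f\<in>Y. N (\<lambda>i. T 0 f i - f i) = 0) \<and>
     (\<forall>s\<ge>0. \<forall>t\<ge>0. \<forall>f\<in>Y. N (\<lambda>i. T (s + t) f i - T s (T t f) i) = 0) \<and>
     (\<forall>f\<in>Y. ((\<lambda>t. N (\<lambda>i. T t f i - f i)) \<longlongrightarrow> 0) (at_right 0))"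

text \<open>The operator \<open>- A\<close> is the generator of \<open>T\<close>; here \<open>A\<close> is given by its graph.\<close>

definition generated_by_minus ::
  "complex set \<Rightarrow> ('i \<Rightarrow> complex) set \<Rightarrow> (('i \<Rightarrow> complex) \<Rightarrow> real) \<Rightarrow>
   (('i \<Rightarrow> complex) \<times> ('i \<Rightarrow> complex)) set \<Rightarrow>
   (real \<Rightarrow> ('i \<Rightarrow> complex) \<Rightarrow> 'i \<Rightarrow> complex) \<Rightarrow> bool" where
  "generated_by_minus K Y N A T \<longleftrightarrow>
     C0_semigroup K Y N T \<and>
     (\<forall>f\<in>Y. \<forall>h\<in>Y. (f, h) \<in> A \<longleftrightarrow>
        ((\<lambda>t. N (\<lambda>i. (T t f i - f i) / complex_of_real t - (- h i))) \<longlongrightarrow> 0) (at_right 0))"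

text \<open>
  In the following, \<open>ae P\<close> says that \<open>P\<close> holds almost everywhere on the index set; for \<open>K\<^sup>S\<close> it
  is instantiated by \<open>Ball S\<close>.  The supremum norm is the essential supremum (possibly \<open>\<infinity>\<close>).
\<close>

definition sup_norm :: "(('i \<Rightarrow> bool) \<Rightarrow> bool) \<Rightarrow> ('i \<Rightarrow> complex) \<Rightarrow> ennreal" where
  "sup_norm ae f = Inf {c. ae (\<lambda>i. ennreal (cmod (f i)) \<le> c)}"

definition positivity_preserving ::
  "(('i \<Rightarrow> bool) \<Rightarrow> bool) \<Rightarrow> ('i \<Rightarrow> complex) set \<Rightarrow>
   (real \<Rightarrow> ('i \<Rightarrow> complex) \<Rightarrow> 'i \<Rightarrow> complex) \<Rightarrow> bool" where
  "positivity_preserving ae Y T \<longleftrightarrow>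
     (\<forall>t\<ge>0. \<forall>f\<in>Y. ae (\<lambda>i. f i \<in> \<real>\<^sub>\<ge>\<^sub>0) \<longrightarrow> ae (\<lambda>i. T t f i \<in> \<real>\<^sub>\<ge>\<^sub>0))"

definition submarkovian ::
  "(('i \<Rightarrow> bool) \<Rightarrow> bool) \<Rightarrow> ('i \<Rightarrow> complex) set \<Rightarrow>
   (real \<Rightarrow> ('i \<Rightarrow> complex) \<Rightarrow> 'i \<Rightarrow> complex) \<Rightarrow> bool" where
  "submarkovian ae Y T \<longleftrightarrow>
     positivity_preserving ae Y T \<and>
     (\<forall>t\<ge>0. \<forall>f\<in>Y. sup_norm ae f < \<infinity> \<longrightarrow> sup_norm ae (T t f) \<le> sup_norm ae f)"


section \<open>Function spaces on intervals\<close>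

definition L2_fun :: "complex set \<Rightarrow> real measure \<Rightarrow> (real \<Rightarrow> complex) set" where
  "L2_fun K M = {f \<in> borel_measurable M.
     (\<forall>x\<in>space M. f x \<in> K) \<and> integrable M (\<lambda>x. (cmod (f x))\<^sup>2)}"

abbreviation lebesgue_Ioo :: "real \<Rightarrow> real \<Rightarrow> real measure" where
  "lebesgue_Ioo a b \<equiv> restrict_space lborel {a<..<b}"

text \<open>Test functions for weak derivatives are taken from \<open>C\<^sub>c\<^sup>1(a,b)\<close> (as in Brezis' book).\<close>

definition test_fun :: "real \<Rightarrow> real \<Rightarrow> (real \<Rightarrow> real) set" where
  "test_fun a b = {\<phi>. \<phi> C1_differentiable_on UNIV \<and>
     (\<exists>C. compact C \<and> C \<subseteq> {a<..<b} \<and> (\<forall>x. x \<notin> C \<longrightarrow> \<phi> x = 0))}"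

definition has_weak_deriv :: "real \<Rightarrow> real \<Rightarrow> (real \<Rightarrow> complex) \<Rightarrow> (real \<Rightarrow> complex) \<Rightarrow> bool" where
  "has_weak_deriv a b f g \<longleftrightarrow>
     (\<forall>\<phi>\<in>test_fun a b.
        (LINT x|lebesgue_Ioo a b. f x * complex_of_real (deriv \<phi> x)) =
        - (LINT x|lebesgue_Ioo a b. g x * complex_of_real (\<phi> x)))"

text \<open>The Sobolev space \<open>W\<^sup>1\<^sub>2(a,b)\<close>.\<close>

definition W12 :: "complex set \<Rightarrow> real \<Rightarrow> real \<Rightarrow> (real \<Rightarrow> complex) set" where
  "W12 K a b = {f \<in> L2_fun K (lebesgue_Ioo a b).
     \<exists>g\<in>L2_fun K (lebesgue_Ioo a b). has_weak_deriv a b f g}"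

text \<open>The weak derivative, unique up to null sets.\<close>

definition weak_deriv :: "complex set \<Rightarrow> real \<Rightarrow> real \<Rightarrow> (real \<Rightarrow> complex) \<Rightarrow> real \<Rightarrow> complex" where
  "weak_deriv K a b f = (SOME g. g \<in> L2_fun K (lebesgue_Ioo a b) \<and> has_weak_deriv a b f g)"

definition C_fun :: "complex set \<Rightarrow> real \<Rightarrow> real \<Rightarrow> (real \<Rightarrow> complex) set" where
  "C_fun K a b = {f. continuous_on {a..b} f \<and> (\<forall>x\<in>{a..b}. f x \<in> K)}"

definition spt :: "real measure \<Rightarrow> real set" where
  "spt M = {x \<in> space M. \<forall>U. open U \<longrightarrow> x \<in> U \<longrightarrow> emeasure M (U \<inter> space M) > 0}"

definition C_mu :: "complex set \<Rightarrow> real \<Rightarrow> real \<Rightarrow> real measure \<Rightarrow> (real \<Rightarrow> complex) set" where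
  "C_mu K a b M = {f \<in> C_fun K a b. \<forall>I\<in>components ({a..b} - spt M).
     \<exists>p q. \<forall>x\<in>I. f x = p + q * complex_of_real x}"

definition W12_mu :: "complex set \<Rightarrow> real \<Rightarrow> real \<Rightarrow> real measure \<Rightarrow> (real \<Rightarrow> complex) set" where
  "W12_mu K a b M = W12 K a b \<inter> C_mu K a b M"

definition D_iota_edge :: "complex set \<Rightarrow> real \<Rightarrow> real \<Rightarrow> real measure \<Rightarrow> (real \<Rightarrow> complex) set" where
  "D_iota_edge K a b M =
     {f \<in> L2_fun K M. \<exists>g \<in> W12 K a b \<inter> C_fun K a b. AE x in M. g x = f x}"

text \<open>Uniqueness holds for functions on \<open>[a,b]\<close>, hence the normalisation outside.\<close>

definition iota_edge ::
  "complex set \<Rightarrow> real \<Rightarrow> real \<Rightarrow> real measure \<Rightarrow> (real \<Rightarrow> complex) \<Rightarrow> real \<Rightarrow> complex" where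
  "iota_edge K a b M f =
     (THE g. g \<in> W12_mu K a b M \<and> (AE x in M. g x = f x) \<and> (\<forall>x. x \<notin> {a..b} \<longrightarrow> g x = 0))"


section \<open>Graphs with measures\<close>

text \<open>Vertices and edges have different types and are therefore disjoint.\<close>

record ('v, 'e) measured_graph =
  mg_digraph :: "('v, 'e) pre_digraph"
  mg_left :: "'e \<Rightarrow> real"
  mg_right :: "'e \<Rightarrow> real"
  mg_edge_measure :: "'e \<Rightarrow> real measure"
  mg_vertex_weight :: "'v \<Rightarrow> real"

definition wf_measured_graph :: "('v, 'e) measured_graph \<Rightarrow> bool" where
  "wf_measured_graph G \<longleftrightarrow>
     fin_digraph (mg_digraph G) \<and>
     (\<forall>e\<in>arcs (mg_digraph G).
        mg_left G e < mg_right G e \<and>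
        sets (mg_edge_measure G e) = sets (restrict_space borel {mg_left G e..mg_right G e}) \<and>
        finite_measure (mg_edge_measure G e) \<and>
        (emeasure (mg_edge_measure G e) (space (mg_edge_measure G e)) = 0 \<or>
         mg_left G e \<in> spt (mg_edge_measure G e) \<and>
         mg_right G e \<in> spt (mg_edge_measure G e) \<and>
         emeasure (mg_edge_measure G e) {mg_left G e, mg_right G e} = 0)) \<and>
     (\<forall>v\<in>verts (mg_digraph G). mg_vertex_weight G v \<ge> 0)"

definition E1 :: "('v, 'e) measured_graph \<Rightarrow> 'e set" where
  "E1 G = {e \<in> arcs (mg_digraph G).
     emeasure (mg_edge_measure G e) (space (mg_edge_measure G e)) \<noteq> 0}"

definition V1 :: "('v, 'e) measured_graph \<Rightarrow> 'v set" where
  "V1 G = {v \<in> verts (mg_digraph G). mg_vertex_weight G v \<noteq> 0}"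

text \<open>
  An element \<open>f = ((f\<^sub>e)\<^sub>e, (f\<^sub>v)\<^sub>v)\<close> of the Hilbert space is represented by a function on the disjoint
  union of the edge intervals and the vertices: \<open>f\<^sub>e x = f (Inl (e, x))\<close> and \<open>f\<^sub>v = f (Inr v)\<close>.
  Values at other edges, at other vertices, and outside the intervals are irrelevant.
\<close>

type_synonym ('v, 'e) gfun = "('e \<times> real) + 'v \<Rightarrow> complex"

abbreviation edge_part :: "('v, 'e) gfun \<Rightarrow> 'e \<Rightarrow> real \<Rightarrow> complex" where
  "edge_part f e \<equiv> \<lambda>x. f (Inl (e, x))"

definition H_space :: "complex set \<Rightarrow> ('v, 'e) measured_graph \<Rightarrow> ('v, 'e) gfun set" where
  "H_space K G = {f. (\<forall>e\<in>E1 G. edge_part f e \<in> L2_fun K (mg_edge_measure G e)) \<and>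
     (\<forall>v\<in>V1 G. f (Inr v) \<in> K)}"

definition H_inner :: "('v, 'e) measured_graph \<Rightarrow> ('v, 'e) gfun \<Rightarrow> ('v, 'e) gfun \<Rightarrow> complex" where
  "H_inner G f g =
     (\<Sum>e\<in>E1 G. LINT x|mg_edge_measure G e. edge_part f e x * cnj (edge_part g e x)) +
     (\<Sum>v\<in>V1 G. f (Inr v) * cnj (g (Inr v)) * complex_of_real (mg_vertex_weight G v))"

definition H_norm :: "('v, 'e) measured_graph \<Rightarrow> ('v, 'e) gfun \<Rightarrow> real" where
  "H_norm G f = sqrt (Re (H_inner G f f))"

definition H_ae :: "('v, 'e) measured_graph \<Rightarrow> (('e \<times> real) + 'v \<Rightarrow> bool) \<Rightarrow> bool" where
  "H_ae G P \<longleftrightarrow> (\<forall>e\<in>E1 G. AE x in mg_edge_measure G e. P (Inl (e, x))) \<and> (\<forall>v\<in>V1 G. P (Inr v))"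

definition D_iota :: "complex set \<Rightarrow> ('v, 'e) measured_graph \<Rightarrow> ('v, 'e) gfun set" where
  "D_iota K G = {f \<in> H_space K G. \<forall>e\<in>E1 G.
     edge_part f e \<in> D_iota_edge K (mg_left G e) (mg_right G e) (mg_edge_measure G e)}"

definition iota :: "complex set \<Rightarrow> ('v, 'e) measured_graph \<Rightarrow> ('v, 'e) gfun \<Rightarrow> ('v, 'e) gfun" where
  "iota K G f = (\<lambda>i. case i of
       Inl (e, x) \<Rightarrow> (if e \<in> E1 G
         then iota_edge K (mg_left G e) (mg_right G e) (mg_edge_measure G e) (edge_part f e) x else 0)
     | Inr v \<Rightarrow> (if v \<in> V1 G then f (Inr v) else 0))"

text \<open>The (disjoint) union of \<open>E1 \<times> {0,1}\<close> and \<open>V1\<close>.\<close>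

definition trace_index :: "('v, 'e) measured_graph \<Rightarrow> (('e \<times> nat) + 'v) set" where
  "trace_index G = (E1 G \<times> {0, 1}) <+> V1 G"

type_synonym ('v, 'e) tfun = "('e \<times> nat) + 'v \<Rightarrow> complex"

definition trace_map :: "('v, 'e) measured_graph \<Rightarrow> ('v, 'e) gfun \<Rightarrow> ('v, 'e) tfun" where
  "trace_map G f = (\<lambda>i. if i \<in> trace_index G then
       (case i of
          Inl (e, j) \<Rightarrow> (if j = 0 then f (Inl (e, mg_left G e)) else f (Inl (e, mg_right G e)))
        | Inr v \<Rightarrow> f (Inr v))
     else 0)"

definition trace_inner :: "('v, 'e) measured_graph \<Rightarrow> ('v, 'e) tfun \<Rightarrow> ('v, 'e) tfun \<Rightarrow> complex" where
  "trace_inner G \<xi> \<eta> =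
     (\<Sum>p\<in>E1 G \<times> {0, 1}. \<xi> (Inl p) * cnj (\<eta> (Inl p))) +
     (\<Sum>v\<in>V1 G. \<xi> (Inr v) * cnj (\<eta> (Inr v)) * complex_of_real (mg_vertex_weight G v))"

definition pr_V1 :: "('v, 'e) tfun \<Rightarrow> 'v \<Rightarrow> complex" where
  "pr_V1 \<xi> = (\<lambda>v. \<xi> (Inr v))"

definition D_tau :: "complex set \<Rightarrow> ('v, 'e) measured_graph \<Rightarrow> ('v, 'e) tfun set \<Rightarrow> ('v, 'e) gfun set" where
  "D_tau K G X = {f \<in> D_iota K G. trace_map G (iota K G f) \<in> X}"

definition tau ::
  "complex set \<Rightarrow> ('v, 'e) measured_graph \<Rightarrow> (('v, 'e) tfun \<Rightarrow> ('v, 'e) tfun) \<Rightarrow>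
   ('v, 'e) gfun \<Rightarrow> ('v, 'e) gfun \<Rightarrow> complex" where
  "tau K G L f g =
     (\<Sum>e\<in>E1 G. LINT x|lebesgue_Ioo (mg_left G e) (mg_right G e).
        weak_deriv K (mg_left G e) (mg_right G e) (edge_part (iota K G f) e) x *
        cnj (weak_deriv K (mg_left G e) (mg_right G e) (edge_part (iota K G g) e) x)) +
     trace_inner G (L (trace_map G (iota K G f))) (trace_map G (iota K G g))"

text \<open>The graph of the operator \<open>H\<close> associated with \<open>tau\<close> (on representatives).\<close>

definition H_op ::
  "complex set \<Rightarrow> ('v, 'e) measured_graph \<Rightarrow> ('v, 'e) tfun set \<Rightarrow>
   (('v, 'e) tfun \<Rightarrow> ('v, 'e) tfun) \<Rightarrow> (('v, 'e) gfun \<times> ('v, 'e) gfun) set" where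
  "H_op K G X L = {(f, h). f \<in> D_tau K G X \<and> h \<in> H_space K G \<and>
     (\<forall>g\<in>D_tau K G X. tau K G L f g = H_inner G h g)}"

end

theory Submission
  imports Defs "HOL-Analysis.Analysis" "HOL-Real_Asymp.Real_Asymp" "HOL-Library.Function_Algebras"
begin

text \<open>
  Positivity and the submarkovian property are both invariance statements. The semigroup is
  positivity preserving if every half-plane \<open>{z. Re (\<theta> z) \<le> 0}\<close> that
  contains the nonnegative reals is invariant, and it is submarkovian if moreover the
  half-planes \<open>{z. Re (\<theta> z) \<le> c}\<close> with \<open>cmod \<theta> = 1\<close>
  and \<open>c \<ge> 0\<close> are invariant, because countably many of them intersect in a
  disc. By linearity the rotation \<open>\<theta>\<close> can be moved to the initial value, so
  that everything reduces to the half-planes \<open>{z. Re z \<le> c}\<close> with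
  \<open>c \<ge> 0\<close> (lemma \<open>half_plane_invariance\<close>).

  Let \<open>w u = (Re u - c)\<^sup>+\<close> be the part of \<open>u\<close> outside the
  half-plane. If \<open>D(\<tau>)\<close> is mapped into itself by \<open>w\<close> and
  \<open>Re \<tau>(u, w u) \<ge> - \<omega> \<parallel>w u\<parallel>\<^sup>2\<close>, then
  \<open>\<parallel>w (T t f)\<parallel>\<close> grows at most like
  \<open>exp (\<omega> t)\<close>, and hence remains \<open>0\<close> if it is \<open>0\<close>
  initially. This is a Gronwall argument along a fine time grid for initial values in the domain
  of the generator (lemma \<open>growth_of_remainder\<close>). It extends to all initial values
  since the domain is dense: means of orbits over short time intervals belong to it. The
  estimates use that the operators \<open>T t\<close> are uniformly bounded for \<open>t\<close>
  in a compact interval, which is a consequence of the uniform boundedness principle.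

  The form splits into the energies of the edges and a trace part. For the energies the key is a
  description of \<open>W\<^sup>1\<^sub>2\<close> by increments: a continuous function
  \<open>g\<close> has a weak derivative \<open>h\<close> in \<open>L\<^sub>2\<close> if and
  only if \<open>(cmod (g y - g x))\<^sup>2 \<le> (y - x) * (e y - e x)\<close> for some real
  function \<open>e\<close>, and then
  \<open>\<integral> (cmod h)\<^sup>2 \<le> e b - e a\<close>. Necessity is the fundamental
  theorem of calculus together with the Cauchy-Schwarz inequality; for sufficiency, the
  difference quotients along dyadic partitions form a martingale that is bounded in
  \<open>L\<^sub>2\<close> and converges to \<open>h\<close> (theorem
  \<open>weak_derivative_exists\<close>). The increment inequality is inherited by compositions
  with contractions and by affine interpolation over the gaps of the support of
  \<open>\<mu>\<close>. As \<open>\<iota> f\<close> is such an interpolation, every contraction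
  \<open>F\<close> with \<open>F 0 = 0\<close> operates on \<open>D(\<iota>)\<close>, is
  compatible with the traces and decreases the energy (theorem
  \<open>contraction_operates\<close>). This applies to \<open>F z = (Re z - c)\<^sup>+\<close>
  and also to the map \<open>z \<mapsto> z - 2 F z\<close>, which reflects the exterior of the
  half-plane at its boundary. Expanding the energy of \<open>u - 2 w u\<close>, which is at most
  that of \<open>u\<close>, yields \<open>E(w u) \<le> Re (u', (w u)')\<close> (theorem
  \<open>energy_of_remainder\<close>).

  For the trace part put \<open>x = tr (\<iota> u)\<close>, so that
  \<open>tr (\<iota> (w u)) = w x\<close>. The lattice hypotheses on \<open>X\<close> guarantee
  \<open>w x \<in> X\<close>. Since \<open>exp (- t L)\<close> leaves the half-plane invariant,
  its derivative at \<open>t = 0\<close>, applied to \<open>x - w x\<close>, points into the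
  half-plane at those coordinates where \<open>x - w x\<close> is on the boundary, which are the
  coordinates where \<open>w x\<close> can be different from \<open>0\<close>. This shows
  \<open>Re (L (x - w x) | w x) \<ge> 0\<close> (theorem
  \<open>form_of_remainder_nonneg\<close>). Together,
  \<open>Re \<tau>(u, w u) \<ge> \<tau>(w u, w u)\<close>, and a trace inequality, which bounds
  boundary values by an arbitrarily small multiple of the energy and a multiple of the
  \<open>L\<^sub>2\<close>-norm, shows that the form is bounded below (theorem
  \<open>form_bounded_below\<close>).
\<close>

section \<open>Semi-Hilbert spaces\<close>

text \<open>
  Functions that represent elements of an \<open>L\<^sub>2\<close>-space form a space with a
  degenerate inner product. Working with the seminorm avoids passing to equivalence classes.
  Only the real part of a complex inner product is kept; the seminorm is the same, and
  inequalities for real parts of forms are all that occurs.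
\<close>

locale semi_inner_product =
  fixes Y :: "'a::real_vector set" and r :: "'a \<Rightarrow> 'a \<Rightarrow> real"
  assumes subsp: "subspace Y"
    and r_add: "\<lbrakk>f \<in> Y; g \<in> Y; h \<in> Y\<rbrakk> \<Longrightarrow> r (f + g) h = r f h + r g h"
    and r_scale: "\<lbrakk>f \<in> Y; h \<in> Y\<rbrakk> \<Longrightarrow> r (c *\<^sub>R f) h = c * r f h"
    and r_sym: "\<lbrakk>f \<in> Y; g \<in> Y\<rbrakk> \<Longrightarrow> r f g = r g f"
    and r_nonneg: "f \<in> Y \<Longrightarrow> 0 \<le> r f f"
begin

definition N :: "'a \<Rightarrow> real" where "N f = sqrt (r f f)"

lemma closed_ops [simp]:
  "0 \<in> Y" "\<lbrakk>f \<in> Y; g \<in> Y\<rbrakk> \<Longrightarrow> f + g \<in> Y" "\<lbrakk>f \<in> Y; g \<in> Y\<rbrakk> \<Longrightarrow> f - g \<in> Y"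
  "f \<in> Y \<Longrightarrow> - f \<in> Y" "f \<in> Y \<Longrightarrow> c *\<^sub>R f \<in> Y"
  using subsp by (auto intro: subspace_0 subspace_add subspace_diff subspace_neg subspace_scale)

lemma r_add2: "\<lbrakk>f \<in> Y; g \<in> Y; h \<in> Y\<rbrakk> \<Longrightarrow> r h (f + g) = r h f + r h g"
  by (metis r_add r_sym closed_ops(2))
lemma r_scale2: "\<lbrakk>f \<in> Y; h \<in> Y\<rbrakk> \<Longrightarrow> r h (c *\<^sub>R f) = c * r h f"
  by (metis r_scale r_sym closed_ops(5))
lemma r_minus: "\<lbrakk>f \<in> Y; h \<in> Y\<rbrakk> \<Longrightarrow> r (- f) h = - r f h"
  using r_scale[of f h "-1"] by simp
lemma r_minus2: "\<lbrakk>f \<in> Y; h \<in> Y\<rbrakk> \<Longrightarrow> r h (- f) = - r h f"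
  using r_scale2[of f h "-1"] by simp
lemma r_diff: "\<lbrakk>f \<in> Y; g \<in> Y; h \<in> Y\<rbrakk> \<Longrightarrow> r (f - g) h = r f h - r g h"
  using r_add[of f "- g" h] r_minus[of g h] by simp
lemma r_diff2: "\<lbrakk>f \<in> Y; g \<in> Y; h \<in> Y\<rbrakk> \<Longrightarrow> r h (f - g) = r h f - r h g"
  using r_add2[of f "- g" h] r_minus2[of g h] by simp
lemma r_zero: "h \<in> Y \<Longrightarrow> r 0 h = 0"
  using r_scale[of h h 0] by simp

lemmas r_bilinear = r_add r_add2 r_scale r_scale2 r_minus r_minus2 r_diff r_diff2 r_zero

lemma N_nonneg [simp]: "f \<in> Y \<Longrightarrow> 0 \<le> N f"
  by (simp add: N_def r_nonneg)
lemma N_sq: "f \<in> Y \<Longrightarrow> (N f)\<^sup>2 = r f f"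
  by (simp add: N_def r_nonneg)

lemma Cauchy_Schwarz: assumes f: "f \<in> Y" and g: "g \<in> Y" shows "\<bar>r f g\<bar> \<le> N f * N g"
proof -
  have q: "0 \<le> r f f - 2 * s * r f g + s\<^sup>2 * r g g" for s
    using r_nonneg[of "f - s *\<^sub>R g"] f g
    by (simp add: r_bilinear r_sym[OF g f] power2_eq_square algebra_simps)
  have "(r f g)\<^sup>2 \<le> r f f * r g g"
  proof (cases "r g g = 0")
    case True
    have "r f g = 0"
    proof (rule ccontr)
      assume n: "r f g \<noteq> 0"
      \<comment> \<open>The quadratic polynomial degenerates to a nonconstant affine function, which takes the
        value \<open>- 1\<close>.\<close>
      show False using q[of "(r f f + 1) / (2 * r f g)"] n by (simp add: True)
    qed
    then show ?thesis using True by simp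
  next
    case False
    then have "r g g > 0" using r_nonneg[OF g] by simp
    then show ?thesis using q[of "r f g / r g g"]
      by (simp add: power2_eq_square field_simps)
  qed
  then have "sqrt ((r f g)\<^sup>2) \<le> sqrt (r f f * r g g)" by (rule real_sqrt_le_mono)
  then show ?thesis by (simp add: N_def real_sqrt_mult)
qed

lemma r_le: "\<lbrakk>f \<in> Y; g \<in> Y\<rbrakk> \<Longrightarrow> r f g \<le> N f * N g"
  using Cauchy_Schwarz[of f g] by simp

lemma N_triangle: assumes f: "f \<in> Y" and g: "g \<in> Y" shows "N (f + g) \<le> N f + N g"
proof (rule power2_le_imp_le)
  show "(N (f + g))\<^sup>2 \<le> (N f + N g)\<^sup>2"
    using f g r_le[OF f g] by (simp add: N_sq power2_sum r_bilinear r_sym[OF g f])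
qed (use f g in simp)

lemma N_scale: "f \<in> Y \<Longrightarrow> N (c *\<^sub>R f) = \<bar>c\<bar> * N f"
  by (simp add: N_def r_bilinear real_sqrt_mult flip: mult.assoc)
lemma N_minus: "f \<in> Y \<Longrightarrow> N (- f) = N f"
  using N_scale[of f "-1"] by simp
lemma N_diff_commute: "\<lbrakk>f \<in> Y; g \<in> Y\<rbrakk> \<Longrightarrow> N (f - g) = N (g - f)"
  using N_minus[of "f - g"] by simp
lemma N_zero [simp]: "N 0 = 0"
  by (simp add: N_def r_zero)
lemma N_triangle_diff: "\<lbrakk>f \<in> Y; g \<in> Y; h \<in> Y\<rbrakk> \<Longrightarrow> N (f - h) \<le> N (f - g) + N (g - h)"
  using N_triangle[of "f - g" "g - h"] by simp
lemma N_reverse: "\<lbrakk>f \<in> Y; g \<in> Y\<rbrakk> \<Longrightarrow> N f \<le> N g + N (f - g)"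
  using N_triangle[of "g" "f - g"] by simp

text \<open>
  An upper bound for \<open>N x\<close> may be tested weakly. Elements defined by weak integrals
  are only accessible in this way.
\<close>

lemma N_le_weak:
  assumes x: "x \<in> Y" and c: "0 \<le> c" and w: "\<And>g. g \<in> Y \<Longrightarrow> r x g \<le> c * N g"
  shows "N x \<le> c"
proof (cases "N x = 0")
  case False
  then have "N x > 0" using N_nonneg[OF x] by simp
  moreover have "N x * N x \<le> c * N x" using w[OF x] N_sq[OF x] by (simp add: power2_eq_square)
  ultimately show ?thesis by simp
qed (use c in simp)

lemma r_cong: "\<lbrakk>f \<in> Y; g \<in> Y; h \<in> Y; N (f - g) = 0\<rbrakk> \<Longrightarrow> r f h = r g h"
  using Cauchy_Schwarz[of "f - g" h] by (simp add: r_diff)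

end

locale semi_hilbert = semi_inner_product +
  assumes complete: "\<lbrakk>\<And>n::nat. F n \<in> Y;
       \<And>e. e > 0 \<Longrightarrow> \<exists>M. \<forall>m\<ge>M. \<forall>n\<ge>M. N (F m - F n) < e\<rbrakk>
     \<Longrightarrow> \<exists>f\<in>Y. (\<lambda>n. N (F n - f)) \<longlonglongrightarrow> 0"
begin

text \<open>
  The gliding hump proof. If the seminorms are not uniformly bounded, choose vectors
  \<open>e k\<close> of norm at most \<open>1\<close> on which the \<open>k\<close>-th of
  suitable seminorms, of size at least \<open>4 ^ k\<close>, is nearly attained, and add
  \<open>\<plusminus> 3 ^ (- k) e k\<close> successively, with the sign chosen such that the
  \<open>k\<close>-th seminorm of the result is at least that of the added term. The series
  converges, and the seminorms are unbounded at its sum.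
\<close>

lemma uniform_boundedness:
  fixes p :: "nat \<Rightarrow> 'a \<Rightarrow> real"
  assumes sub: "\<And>n f g. \<lbrakk>f \<in> Y; g \<in> Y\<rbrakk> \<Longrightarrow> p n (f + g) \<le> p n f + p n g"
    and hom: "\<And>n c f. f \<in> Y \<Longrightarrow> p n (c *\<^sub>R f) = \<bar>c\<bar> * p n f"
    and bdd: "\<And>n. \<exists>C. \<forall>f\<in>Y. p n f \<le> C * N f"
    and ptw: "\<And>f. f \<in> Y \<Longrightarrow> \<exists>B. \<forall>n. p n f \<le> B"
  shows "\<exists>B. \<forall>n. \<forall>f\<in>Y. p n f \<le> B * N f"
proof (rule ccontr)
  assume neg: "\<not> ?thesis"
  define c where "c n = (SUP f \<in> {f\<in>Y. N f \<le> 1}. p n f)" for n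
  have bddc: "bdd_above (p n ` {f\<in>Y. N f \<le> 1})" for n
  proof -
    obtain C where C: "\<forall>f\<in>Y. p n f \<le> C * N f" using bdd by blast
    show ?thesis
    proof (rule bdd_aboveI2)
      fix f assume f: "f \<in> {f\<in>Y. N f \<le> 1}"
      have "p n f \<le> C * N f" using C f by auto
      also have "\<dots> \<le> \<bar>C\<bar> * 1" using f by (intro mult_mono) auto
      finally show "p n f \<le> \<bar>C\<bar>" by simp
    qed
  qed
  have p0: "p n 0 = 0" for n using hom[of 0 n 0] by simp
  have pneg: "f \<in> Y \<Longrightarrow> p n (- f) = p n f" for n f using hom[of f n "-1"] by simp
  have c0: "0 \<le> c n" for n
    unfolding c_def using cSUP_upper[OF _ bddc, of 0 n] p0 by simp
  have pc: "p n f \<le> c n * N f" if f: "f \<in> Y" for n f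
  proof (cases "N f = 0")
    case True
    obtain C where C: "\<forall>f\<in>Y. p n f \<le> C * N f" using bdd by blast
    then show ?thesis using True f by auto
  next
    case False
    then have pos: "N f > 0" using N_nonneg[OF f] by simp
    have "p n ((1 / N f) *\<^sub>R f) \<le> c n"
      unfolding c_def using f pos by (intro cSUP_upper[OF _ bddc]) (auto simp: N_scale)
    then show ?thesis using pos by (simp add: hom[OF f] field_simps)
  qed
  \<comment> \<open>The factor \<open>2/3\<close> must exceed the relative weight \<open>1/2\<close> of the
    remaining steps \<open>3 ^ (- j)\<close>, \<open>j > k\<close>; the rate \<open>4\<close> must
    exceed \<open>3\<close>.\<close>
  have "\<exists>n e. c n \<ge> 4 ^ k \<and> e \<in> Y \<and> N e \<le> 1 \<and> p n e \<ge> 2/3 * c n" for k :: nat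
  proof -
    have "\<exists>n. c n > 4 ^ k"
    proof (rule ccontr)
      assume "\<not> (\<exists>n. c n > 4 ^ k)"
      then have c4: "c n \<le> 4 ^ k" for n by (simp add: not_less)
      have "p n f \<le> 4 ^ k * N f" if "f \<in> Y" for n f
        using pc[OF that, of n] N_nonneg[OF that] c4[of n] by (meson mult_right_mono order_trans)
      then show False using neg by blast
    qed
    then obtain n where n: "c n > 4 ^ k" by blast
    have "c n > 0" using n by (meson less_trans zero_less_numeral zero_less_power)
    then have "2/3 * c n < c n" by simp
    moreover have "p n ` {f\<in>Y. N f \<le> 1} \<noteq> {}" by (auto intro!: exI[of _ 0])
    ultimately have "\<exists>x\<in>p n ` {f\<in>Y. N f \<le> 1}. 2/3 * c n < x"
      using less_cSup_iff[OF _ bddc[of n]] unfolding c_def by blast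
    then show ?thesis using n by (auto intro!: exI[of _ n] less_imp_le)
  qed
  then obtain nn e where ne: "\<And>k::nat. c (nn k) \<ge> 4 ^ k" "\<And>k. e k \<in> Y" "\<And>k. N (e k) \<le> 1"
    "\<And>k. p (nn k) (e k) \<ge> 2/3 * c (nn k)" by metis
  have two: "2 * p n y \<le> p n (a + y) + p n (a - y)" if "a \<in> Y" "y \<in> Y" for n a y
  proof -
    have "p n (2 *\<^sub>R y) \<le> p n (a + y) + p n (y - a)"
      using sub[of "a + y" "y - a" n] that by (simp add: scaleR_2)
    then show ?thesis using hom[of y n 2] pneg[of "a - y" n] that by simp
  qed
  \<comment> \<open>One of \<open>x \<plusminus> y\<close> has at least the seminorm of \<open>y\<close>.\<close>
  define st where "st k x = (if p (nn k) (x + (1/3)^k *\<^sub>R e k) \<ge> (1/3)^k * p (nn k) (e k)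
      then x + (1/3)^k *\<^sub>R e k else x - (1/3)^k *\<^sub>R e k)" for k x
  define x where "x = rec_nat 0 st"
  have x_Suc: "x (Suc k) = st k (x k)" and x_0: "x 0 = 0" for k by (auto simp: x_def)
  have xY: "x k \<in> Y" for k by (induction k) (auto simp: x_Suc x_0 st_def ne(2))
  have big: "p (nn k) (x (Suc k)) \<ge> (1/3)^k * p (nn k) (e k)" for k
  proof -
    let ?y = "(1/3)^k *\<^sub>R e k" and ?p = "p (nn k)"
    have y: "?y \<in> Y" using ne(2) by auto
    have "2 * ?p ?y \<le> ?p (x k + ?y) + ?p (x k - ?y)" by (rule two[OF xY y])
    moreover have "?p ?y = (1/3)^k * ?p (e k)" using ne(2) by (simp add: hom)
    ultimately show ?thesis unfolding x_Suc st_def by auto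
  qed
  have step: "N (x (Suc k) - x k) \<le> (1/3)^k" for k
    using ne(2)[of k] ne(3)[of k] by (auto simp: x_Suc st_def N_scale N_minus mult_le_cancel_left1)
  have far: "N (x (k + j) - x k) \<le> 3/2 * ((1/3)^k - (1/3)^(k+j))" for k j
  proof (induction j)
    case (Suc j)
    have "N (x (k + Suc j) - x k) \<le> N (x (Suc (k + j)) - x (k+j)) + N (x (k + j) - x k)"
      using N_triangle_diff[of "x (Suc (k + j))" "x (k+j)" "x k"] xY by simp
    also have "\<dots> \<le> (1/3)^(k+j) + 3/2 * ((1/3)^k - (1/3)^(k+j))"
      using step[of "k+j"] Suc by linarith
    finally show ?case by (simp add: field_simps)
  qed simp
  have far': "N (x m - x k) \<le> 3/2 * (1/3)^k" if "m \<ge> k" for m k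
  proof -
    have "N (x m - x k) \<le> 3/2 * ((1/3)^k - (1/3)^m)" using far[of k "m - k"] that by simp
    also have "\<dots> \<le> 3/2 * (1/3)^k" by simp
    finally show ?thesis .
  qed
  have "\<exists>M. \<forall>m\<ge>M. \<forall>n\<ge>M. N (x m - x n) < \<epsilon>" if e: "\<epsilon> > 0" for \<epsilon>
  proof -
    obtain M where M: "(1/3::real)^M < \<epsilon> / 3"
      using real_arch_pow_inv[of "\<epsilon> / 3" "1/3"] e by auto
    have "N (x m - x n) < \<epsilon>" if "m \<ge> M" "n \<ge> M" for m n
    proof -
      have "N (x m - x n) \<le> N (x m - x M) + N (x M - x n)"
        using N_triangle_diff xY by blast
      also have "\<dots> \<le> 3/2 * (1/3)^M + 3/2 * (1/3)^M"
        using far'[OF that(1)] far'[OF that(2)] N_diff_commute[OF xY xY, of M n] by linarith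
      also have "\<dots> < \<epsilon>" using M by simp
      finally show ?thesis .
    qed
    then show ?thesis by blast
  qed
  then obtain y where y: "y \<in> Y" "(\<lambda>n. N (x n - y)) \<longlonglongrightarrow> 0"
    using complete[of x] xY by blast
  have near: "N (x k - y) \<le> 3/2 * (1/3)^k" for k
  proof (rule tendsto_lowerbound)
    show "(\<lambda>m. 3/2 * (1/3)^k + N (x m - y)) \<longlonglongrightarrow> 3/2 * (1/3)^k"
      using tendsto_add[OF tendsto_const y(2)] by simp
    show "\<forall>\<^sub>F m in sequentially. N (x k - y) \<le> 3/2 * (1/3)^k + N (x m - y)"
    proof (rule eventually_sequentiallyI)
      fix m assume "k \<le> m"
      then show "N (x k - y) \<le> 3/2 * (1/3)^k + N (x m - y)"
        using N_triangle_diff[OF xY[of k] xY[of m] y(1)] far'[of k m] N_diff_commute[OF xY xY, of k m] by simp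
    qed
  qed simp
  obtain B where B: "\<And>n. p n y \<le> B" using ptw[OF y(1)] by blast
  have "(1/6) * (4/3)^k \<le> B" for k
  proof -
    have "(1/3)^k * p (nn k) (e k) \<le> p (nn k) (x (Suc k))" by (rule big)
    also have "\<dots> \<le> p (nn k) y + p (nn k) (x (Suc k) - y)"
      using sub[of y "x (Suc k) - y" "nn k"] xY y by simp
    also have "\<dots> \<le> B + c (nn k) * (3/2 * (1/3)^Suc k)"
      using B[of "nn k"] pc[OF closed_ops(3)[OF xY[of "Suc k"] y(1)], of "nn k"]
        mult_left_mono[OF near[of "Suc k"] c0[of "nn k"]] by linarith
    finally have *: "(1/3)^k * p (nn k) (e k) - c (nn k) * (1/2 * (1/3)^k) \<le> B" by simp
    have "(1/3)^k * (2/3 * c (nn k)) \<le> (1/3)^k * p (nn k) (e k)"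
      using ne(4)[of k] by (intro mult_left_mono) auto
    then have "(1/6) * ((1/3)^k * c (nn k)) \<le> B" using * by (simp add: field_simps)
    moreover have "(1/3)^k * 4^k \<le> (1/3)^k * c (nn k)"
      using ne(1)[of k] by (intro mult_left_mono) auto
    moreover have "(1/3)^k * 4^k = (4/3::real)^k" by (simp add: power_divide)
    ultimately show ?thesis by linarith
  qed
  moreover obtain k where "(4/3::real)^k > 6 * B" using real_arch_pow[of "4/3" "6*B"] by auto
  ultimately show False using not_less[of "6 * B" "(4/3::real)^k"] by (simp add: field_simps)
qed

end

section \<open>\<open>C\<^sub>0\<close>-semigroups\<close>

lemma Riemann_sum_error:
  fixes q :: "real \<Rightarrow> real"
  assumes d: "0 \<le> d" and q: "continuous_on {0..real m * d} q"
    and osc: "\<And>s t. \<lbrakk>0 \<le> s; s \<le> t; t \<le> s + d; t \<le> real m * d\<rbrakk> \<Longrightarrow> \<bar>q t - q s\<bar> \<le> \<eta>"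
  shows "\<bar>integral {0..real m * d} q - (\<Sum>k<m. d * q (real k * d))\<bar> \<le> real m * d * \<eta>"
  using q osc
proof (induction m)
  case (Suc m)
  let ?a = "real m * d" and ?b = "real (Suc m) * d"
  have ab: "0 \<le> ?a" "?a \<le> ?b" "?b - ?a = d" using d by (auto simp: algebra_simps)
  have IH: "\<bar>integral {0..?a} q - (\<Sum>k<m. d * q (real k * d))\<bar> \<le> ?a * \<eta>"
    using ab(2) by (intro Suc.IH continuous_on_subset[OF Suc.prems(1)] Suc.prems(2)) auto
  have int: "q integrable_on {0..?b}" by (rule integrable_continuous_interval[OF Suc.prems(1)])
  then have int': "q integrable_on {?a..?b}"
    by (rule integrable_on_subinterval) (use ab in simp)
  have split: "integral {0..?b} q = integral {0..?a} q + integral {?a..?b} q"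
    by (rule Henstock_Kurzweil_Integration.integral_combine[symmetric, OF ab(1,2) int])
  have "integral {?a..?b} q - d * q ?a = integral {?a..?b} (\<lambda>t. q t - q ?a)"
    using ab int' by (subst integral_diff) auto
  moreover have "\<bar>integral {?a..?b} (\<lambda>t. q t - q ?a)\<bar> \<le> \<eta> * (?b - ?a)"
  proof (rule integral_bound[of ?a ?b "\<lambda>t. q t - q ?a" \<eta>, unfolded real_norm_def])
    show "continuous_on {?a..?b} (\<lambda>t. q t - q ?a)"
      using ab by (intro continuous_intros continuous_on_subset[OF Suc.prems(1)]) auto
    show "\<bar>q t - q ?a\<bar> \<le> \<eta>" if "t \<in> {?a..?b}" for t
      using that ab by (intro Suc.prems(2)) auto
  qed (use ab in simp)
  ultimately show ?case using IH split ab(3) by (simp add: algebra_simps)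
qed simp


locale c0_semigroup = semi_hilbert +
  fixes T :: "real \<Rightarrow> 'a \<Rightarrow> 'a" and A :: "('a \<times> 'a) set"
  assumes T_closed: "\<lbrakk>0 \<le> t; f \<in> Y\<rbrakk> \<Longrightarrow> T t f \<in> Y"
    and T_add: "\<lbrakk>0 \<le> t; f \<in> Y; g \<in> Y\<rbrakk> \<Longrightarrow> N (T t (f + g) - (T t f + T t g)) = 0"
    and T_scale: "\<lbrakk>0 \<le> t; f \<in> Y\<rbrakk> \<Longrightarrow> N (T t (c *\<^sub>R f) - c *\<^sub>R T t f) = 0"
    and T_bdd: "0 \<le> t \<Longrightarrow> \<exists>C. \<forall>f\<in>Y. N (T t f) \<le> C * N f"
    and T_0: "f \<in> Y \<Longrightarrow> N (T 0 f - f) = 0"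
    and T_plus: "\<lbrakk>0 \<le> s; 0 \<le> t; f \<in> Y\<rbrakk> \<Longrightarrow> N (T (s + t) f - T s (T t f)) = 0"
    and T_cont: "f \<in> Y \<Longrightarrow> ((\<lambda>t. N (T t f - f)) \<longlongrightarrow> 0) (at_right 0)"
    and gen: "\<lbrakk>f \<in> Y; h \<in> Y\<rbrakk> \<Longrightarrow>
      (f, h) \<in> A \<longleftrightarrow> ((\<lambda>t. N ((1 / t) *\<^sub>R (T t f - f) + h)) \<longlongrightarrow> 0) (at_right 0)"
begin

lemma r_T_add: "\<lbrakk>0 \<le> t; f \<in> Y; g \<in> Y; h \<in> Y\<rbrakk> \<Longrightarrow> r (T t (f + g)) h = r (T t f) h + r (T t g) h"
  using r_cong[OF _ _ _ T_add, of t f g h] by (simp add: r_add T_closed)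
lemma r_T_scale: "\<lbrakk>0 \<le> t; f \<in> Y; h \<in> Y\<rbrakk> \<Longrightarrow> r (T t (c *\<^sub>R f)) h = c * r (T t f) h"
  using r_cong[of "T t (c *\<^sub>R f)" "c *\<^sub>R T t f" h] T_scale[of t f c] by (simp add: r_scale T_closed)
lemma r_T_minus: "\<lbrakk>0 \<le> t; f \<in> Y; h \<in> Y\<rbrakk> \<Longrightarrow> r (T t (- f)) h = - r (T t f) h"
  using r_T_scale[of t f h "-1"] by simp
lemma r_T_diff: "\<lbrakk>0 \<le> t; f \<in> Y; g \<in> Y; h \<in> Y\<rbrakk> \<Longrightarrow> r (T t (f - g)) h = r (T t f) h - r (T t g) h"
  using r_T_add[of t f "- g" h] by (simp add: r_T_minus)
lemma r_T_plus: "\<lbrakk>0 \<le> s; 0 \<le> t; f \<in> Y; h \<in> Y\<rbrakk> \<Longrightarrow> r (T s (T t f)) h = r (T (s + t) f) h"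
  using r_cong[OF _ _ _ T_plus, of s t f h] by (simp add: T_closed)
lemma r_T_0: "\<lbrakk>f \<in> Y; h \<in> Y\<rbrakk> \<Longrightarrow> r (T 0 f) h = r f h"
  using r_cong[OF _ _ _ T_0, of f h] by (simp add: T_closed)
lemma r_T_sum: "\<lbrakk>0 \<le> t; \<And>k. k < (n::nat) \<Longrightarrow> F k \<in> Y; h \<in> Y\<rbrakk> \<Longrightarrow>
    r (T t (\<Sum>k<n. F k)) h = (\<Sum>k<n. r (T t (F k)) h)"
proof (induction n)
  case 0
  then show ?case using r_T_scale[of t 0 h 0] by simp
next
  case (Suc n)
  have "(\<Sum>k<n. F k) \<in> Y" using Suc.prems(2) subsp by (intro subspace_sum) auto
  then show ?case using Suc by (simp add: r_T_add)
qed


text \<open>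
  Identities between orbits hold only modulo the seminorm and cannot be used for rewriting;
  paired with a vector they become equations of real numbers.
\<close>

lemma N_weak: "\<lbrakk>u \<in> Y; v \<in> Y; \<And>h. h \<in> Y \<Longrightarrow> r u h = r v h\<rbrakk> \<Longrightarrow> N u = N v"
  using r_sym[of u v] by (simp add: N_def)

text \<open>
  Otherwise there is a sequence \<open>t n \<rightarrow> 0\<close> with \<open>T (t n)\<close>
  unbounded, although the orbits converge. This contradicts the uniform boundedness principle.
\<close>

lemma bounded_near_0: "\<exists>\<delta>>0. \<exists>M. \<forall>t\<in>{0..\<delta>}. \<forall>f\<in>Y. N (T t f) \<le> M * N f"
proof (rule ccontr)
  assume neg: "\<not> ?thesis"
  have "\<exists>t f. 0 \<le> t \<and> t \<le> 1 / real (Suc n) \<and> f \<in> Y \<and> \<not> N (T t f) \<le> real n * N f" for n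
  proof -
    have "1 / real (Suc n) > 0" by simp
    then show ?thesis using neg unfolding atLeastAtMost_iff Ball_def by blast
  qed
  then obtain t f where tf: "\<And>n::nat. 0 \<le> t n" "\<And>n. t n \<le> 1 / real (Suc n)" "\<And>n. f n \<in> Y"
     "\<And>n. \<not> N (T (t n) (f n)) \<le> real n * N (f n)" by metis
  have "\<exists>B. \<forall>n. \<forall>f\<in>Y. N (T (t n) f) \<le> B * N f"
  proof (rule uniform_boundedness)
    fix n g h assume g: "g \<in> Y" "h \<in> Y"
    have "N (T (t n) (g + h)) = N (T (t n) g + T (t n) h)"
      using g tf(1) by (intro N_weak) (auto simp: T_closed r_T_add r_add)
    then show "N (T (t n) (g + h)) \<le> N (T (t n) g) + N (T (t n) h)"
      using N_triangle g tf(1) T_closed by simp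
  next
    fix n c g assume g: "g \<in> Y"
    have "N (T (t n) (c *\<^sub>R g)) = N (c *\<^sub>R T (t n) g)"
      using g tf(1) by (intro N_weak) (auto simp: T_closed r_T_scale r_scale)
    then show "N (T (t n) (c *\<^sub>R g)) = \<bar>c\<bar> * N (T (t n) g)"
      using g tf(1) T_closed by (simp add: N_scale)
  next
    show "\<exists>C. \<forall>f\<in>Y. N (T (t n) f) \<le> C * N f" for n using T_bdd tf(1) by blast
  next
    fix g assume g: "g \<in> Y"
    obtain d where d: "d > 0" "\<And>s. 0 < s \<Longrightarrow> s < d \<Longrightarrow> N (T s g - g) < 1"
      using order_tendstoD(2)[OF T_cont[OF g], of 1] by (auto simp: eventually_at_right[OF zero_less_one])
    obtain n0 where n0: "1 / real (Suc n0) < d" using nat_approx_posE[OF d(1)] by blast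
    have 1: "N (T (t n) g) \<le> N g + 1" if "n \<ge> n0" for n
    proof (cases "t n = 0")
      case True
      then show ?thesis using N_reverse[of "T 0 g" g] T_0[OF g] T_closed[of 0 g] g by simp
    next
      case False
      have "1 / real (Suc n) \<le> 1 / real (Suc n0)" using that by (simp add: frac_le)
      then have "t n < d" using tf(2)[of n] n0 by linarith
      then have "N (T (t n) g - g) < 1" using d(2) False tf(1)[of n] by simp
      then show ?thesis using N_reverse[of "T (t n) g" g] T_closed[OF tf(1) g, of n] g by simp
    qed
    have "N (T (t n) g) \<le> Max ((\<lambda>n. N (T (t n) g)) ` {..n0}) + (N g + 1)" for n
    proof (cases "n \<ge> n0")
      case True
      have "0 \<le> N (T (t n0) g)" using T_closed tf(1) g by simp
      also have "\<dots> \<le> Max ((\<lambda>n. N (T (t n) g)) ` {..n0})" by (intro Max_ge) auto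
      finally show ?thesis using 1[OF True] by simp
    next
      case False
      then have "N (T (t n) g) \<le> Max ((\<lambda>n. N (T (t n) g)) ` {..n0})" by (intro Max_ge) auto
      then show ?thesis using g by (smt (verit) N_nonneg)
    qed
    then show "\<exists>B. \<forall>n. N (T (t n) g) \<le> B" by blast
  qed
  then obtain B where B: "\<And>n f. f \<in> Y \<Longrightarrow> N (T (t n) f) \<le> B * N f" by blast
  obtain n where "B \<le> real n" using real_arch_simple by blast
  then have "N (T (t n) (f n)) \<le> real n * N (f n)"
    using B[OF tf(3), of n n] mult_right_mono[of B "real n" "N (f n)"] tf(3) by force
  then show False using tf(4) by blast
qed

lemma bounded_on_compact: "\<exists>M\<ge>1. \<forall>t\<in>{0..R}. \<forall>f\<in>Y. N (T t f) \<le> M * N f"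
proof -
  obtain \<delta> M0 where d: "\<delta> > 0" and M0: "\<And>t f. \<lbrakk>0 \<le> t; t \<le> \<delta>; f \<in> Y\<rbrakk> \<Longrightarrow> N (T t f) \<le> M0 * N f"
    using bounded_near_0 by (metis atLeastAtMost_iff)
  define M where "M = max 1 M0"
  have M: "M \<ge> 1" "\<And>t f. \<lbrakk>0 \<le> t; t \<le> \<delta>; f \<in> Y\<rbrakk> \<Longrightarrow> N (T t f) \<le> M * N f"
  proof -
    show "1 \<le> M" by (simp add: M_def)
    show "N (T t f) \<le> M * N f" if "0 \<le> t" "t \<le> \<delta>" "f \<in> Y" for t f
      using M0[OF that] mult_right_mono[of M0 M "N f"] that(3) by (simp add: M_def)
  qed
  have step: "N (T t f) \<le> M ^ Suc n * N f" if "0 \<le> t" "t \<le> real (Suc n) * \<delta>" "f \<in> Y" for t f n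
    using that
  proof (induction n arbitrary: t)
    case 0
    then show ?case using M(2) by simp
  next
    case (Suc n)
    show ?case
    proof (cases "t \<le> real (Suc n) * \<delta>")
      case True
      have "N (T t f) \<le> M ^ Suc n * N f" using Suc True by blast
      also have "\<dots> \<le> M ^ Suc (Suc n) * N f"
        using M(1) Suc.prems(3) by (intro mult_right_mono power_increasing) auto
      finally show ?thesis .
    next
      case False
      define s where "s = t - \<delta>"
      have "1 * \<delta> \<le> real (Suc n) * \<delta>" using d by (intro mult_right_mono) auto
      then have "\<delta> \<le> t" using False by linarith
      then have s: "0 \<le> s" "s \<le> real (Suc n) * \<delta>" "t = \<delta> + s"
        using Suc.prems d by (auto simp: s_def algebra_simps)
      have "N (T t f) = N (T \<delta> (T s f))" unfolding s(3)
        using s d Suc.prems by (intro N_weak) (auto simp: r_T_plus T_closed)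
      also have "\<dots> \<le> M * N (T s f)" using M(2) d s Suc.prems T_closed by simp
      also have "\<dots> \<le> M * (M ^ Suc n * N f)" using Suc.IH[OF s(1,2) Suc.prems(3)] M(1) by simp
      finally show ?thesis by simp
    qed
  qed
  obtain n where "R / \<delta> \<le> real n" using real_arch_simple by blast
  then have n: "R \<le> real (Suc n) * \<delta>" using d by (simp add: field_simps)
  have "M ^ Suc n \<ge> 1" using M(1) by (rule one_le_power)
  then show ?thesis using step[of _ n] n by (intro exI[of _ "M ^ Suc n"]) auto
qed


lemma T_bound:
  obtains M where "1 \<le> M" "\<And>t f. \<lbrakk>0 \<le> t; t \<le> R; f \<in> Y\<rbrakk> \<Longrightarrow> N (T t f) \<le> M * N f"
proof -
  obtain M where "M \<ge> 1" "\<forall>t\<in>{0..R}. \<forall>f\<in>Y. N (T t f) \<le> M * N f"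
    using bounded_on_compact by blast
  then show thesis using that[of M] by auto
qed

lemma right_continuous:
  assumes f: "f \<in> Y" and e: "e > 0"
  obtains d where "d > 0" "\<And>s. \<lbrakk>0 \<le> s; s \<le> d\<rbrakk> \<Longrightarrow> N (T s f - f) < e"
proof -
  obtain d where d: "d > 0" "\<And>s. \<lbrakk>0 < s; s < d\<rbrakk> \<Longrightarrow> N (T s f - f) < e"
    using order_tendstoD(2)[OF T_cont[OF f], of e] e by (auto simp: eventually_at_right[OF zero_less_one])
  have "N (T s f - f) < e" if "0 \<le> s" "s \<le> d/2" for s
    using d(2)[of s] T_0[OF f] e that d(1) by (cases "s = 0") auto
  then show ?thesis using that[of "d/2"] d(1) by simp
qed

lemma uniformly_continuous:
  assumes f: "f \<in> Y" and e: "e > 0"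
  obtains d where "d > 0" "\<And>s t. \<lbrakk>0 \<le> s; s \<le> t; t \<le> s + d; t \<le> R\<rbrakk> \<Longrightarrow> N (T t f - T s f) < e"
proof -
  obtain M where M: "1 \<le> M" "\<And>t f. \<lbrakk>0 \<le> t; t \<le> R; f \<in> Y\<rbrakk> \<Longrightarrow> N (T t f) \<le> M * N f"
    using T_bound[of R] by blast
  obtain d where d: "d > 0" "\<And>s. \<lbrakk>0 \<le> s; s \<le> d\<rbrakk> \<Longrightarrow> N (T s f - f) < e / M"
    using right_continuous[OF f, of "e / M"] e M(1) by auto
  have "N (T t f - T s f) < e" if st: "0 \<le> s" "s \<le> t" "t \<le> s + d" "t \<le> R" for s t
  proof -
    have t: "t = s + (t - s)" by simp
    have "N (T t f - T s f) = N (T s (T (t - s) f - f))"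
      by (subst (1) t, intro N_weak)
         (use st f in \<open>auto simp: T_closed r_T_diff r_diff r_T_plus simp del: add_diff_cancel_left' add_diff_cancel_right'\<close>)
    also have "\<dots> \<le> M * N (T (t - s) f - f)" using M(2) st f T_closed by simp
    also have "\<dots> < M * (e / M)" using d(2)[of "t - s"] st M(1) by (intro mult_strict_left_mono) auto
    finally show ?thesis using M(1) by simp
  qed
  then show ?thesis using that d(1) by blast
qed

lemma weakly_continuous:
  assumes f: "f \<in> Y" and g: "g \<in> Y"
  shows "continuous_on {0..R} (\<lambda>s. r (T s f) g)"
  unfolding continuous_on_iff
proof (intro ballI allI impI)
  fix x e :: real assume x: "x \<in> {0..R}" and e: "e > 0"
  have pos: "N g + 1 > 0" using g by (simp add: add_nonneg_pos)
  then obtain d where d: "d > 0"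
    "\<And>s t. \<lbrakk>0 \<le> s; s \<le> t; t \<le> s + d; t \<le> R\<rbrakk> \<Longrightarrow> N (T t f - T s f) < e / (N g + 1)"
    using uniformly_continuous[OF f, of "e / (N g + 1)" R] e by auto
  have le: "\<bar>r (T t f) g - r (T s f) g\<bar> < e" if st: "0 \<le> s" "s \<le> t" "t \<le> s + d" "t \<le> R" for s t
  proof -
    have "\<bar>r (T t f) g - r (T s f) g\<bar> = \<bar>r (T t f - T s f) g\<bar>" using st f g by (simp add: r_diff T_closed)
    also have "\<dots> \<le> N (T t f - T s f) * N g" using st f g by (intro Cauchy_Schwarz) (auto simp: T_closed)
    also have "\<dots> \<le> (e / (N g + 1)) * N g"
      using d(2)[OF st] g by (intro mult_right_mono) auto
    also have "\<dots> < e" using e pos by (simp add: field_simps)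
    finally show ?thesis .
  qed
  show "\<exists>d>0. \<forall>x'\<in>{0..R}. dist x' x < d \<longrightarrow> dist (r (T x' f) g) (r (T x f) g) < e"
  proof (intro exI conjI ballI impI)
    fix x' assume x': "x' \<in> {0..R}" "dist x' x < d"
    show "dist (r (T x' f) g) (r (T x f) g) < e"
      using le[of x x'] le[of x' x] x x' by (cases "x \<le> x'") (auto simp: dist_real_def abs_minus_commute)
  qed (rule d)
qed

text \<open>
  The integral of an orbit over \<open>{0..x}\<close>. It is the limit of Riemann sums, which
  form a Cauchy sequence because orbits are uniformly continuous; this avoids a theory of
  vector-valued integration. The identity for \<open>T t I\<close> is part of the statement
  since it requires the boundedness of \<open>T t\<close>, applied to the Riemann sums.
\<close>

lemma orbit_integral:
  assumes f: "f \<in> Y" and x: "0 \<le> x"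
  shows "\<exists>I\<in>Y. (\<forall>t\<ge>0. \<forall>g\<in>Y. r (T t I) g = integral {0..x} (\<lambda>s. r (T (t + s) f) g)) \<and>
                (\<forall>g\<in>Y. r I g = integral {0..x} (\<lambda>s. r (T s f) g))"
proof -
  define S where "S n = (\<Sum>k<Suc n. (x / Suc n) *\<^sub>R T (real k * (x / Suc n)) f)" for n :: nat
  have TY: "T (real k * (x / Suc n)) f \<in> Y" for k n using f x by (intro T_closed) auto
  have SY: "S n \<in> Y" for n unfolding S_def using TY subsp by (intro subspace_sum) auto
  have approx: "\<exists>n0. \<forall>n\<ge>n0. \<forall>g\<in>Y.
      \<bar>integral {0..x} (\<lambda>s. r (T (t + s) f) g) - r (T t (S n)) g\<bar> \<le> e * N g"
    if t: "0 \<le> t" and e: "e > 0" for t e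
  proof -
    obtain d where d: "d > 0"
      "\<And>s s'. \<lbrakk>0 \<le> s; s \<le> s'; s' \<le> s + d; s' \<le> t + x\<rbrakk> \<Longrightarrow> N (T s' f - T s f) < e / (x + 1)"
      using uniformly_continuous[OF f, of "e / (x + 1)" "t + x"] e x by auto
    obtain n0 where n0: "x / d \<le> real n0" using real_arch_simple by blast
    have "\<bar>integral {0..x} (\<lambda>s. r (T (t + s) f) g) - r (T t (S n)) g\<bar> \<le> e * N g"
      if n: "n \<ge> n0" and g: "g \<in> Y" for n g
    proof -
      let ?d = "x / Suc n"
      have x_eq: "x = real (Suc n) * ?d" by simp
      have dd: "0 \<le> ?d" using x by simp
      have "x \<le> d * real (Suc n)"
      proof -
        have "x \<le> d * real n0" using n0 d by (simp add: field_simps)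
        also have "\<dots> \<le> d * real (Suc n)" using n d by (intro mult_left_mono) auto
        finally show ?thesis .
      qed
      then have "?d \<le> d" by (simp add: field_simps)
      have "\<bar>integral {0..real (Suc n) * ?d} (\<lambda>s. r (T (t + s) f) g)
             - (\<Sum>k<Suc n. ?d * r (T (t + real k * ?d) f) g)\<bar> \<le> real (Suc n) * ?d * (e / (x + 1) * N g)"
      proof (rule Riemann_sum_error[OF dd, where q="\<lambda>s. r (T (t + s) f) g"])
        have "continuous_on {0..x} ((\<lambda>s. r (T s f) g) \<circ> (\<lambda>s. t + s))"
          using t by (intro continuous_on_compose continuous_intros
              continuous_on_subset[OF weakly_continuous[OF f g, of "t + x"]]) auto
        then show "continuous_on {0..real (Suc n) * ?d} (\<lambda>s. r (T (t + s) f) g)"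
          unfolding x_eq[symmetric] comp_def .
        show "\<bar>r (T (t + s') f) g - r (T (t + s) f) g\<bar> \<le> e / (x + 1) * N g"
          if s: "0 \<le> s" "s \<le> s'" "s' \<le> s + ?d" "s' \<le> real (Suc n) * ?d" for s s'
        proof -
          have "s' \<le> x" using s(4) unfolding x_eq[symmetric] .
          then have "N (T (t + s') f - T (t + s) f) \<le> e / (x + 1)"
            using s t \<open>?d \<le> d\<close> d(2)[of "t + s" "t + s'"] by (intro less_imp_le) auto
          then have "N (T (t + s') f - T (t + s) f) * N g \<le> e / (x + 1) * N g"
            using g by (intro mult_right_mono) auto
          moreover have "\<bar>r (T (t + s') f) g - r (T (t + s) f) g\<bar> = \<bar>r (T (t + s') f - T (t + s) f) g\<bar>"
            using s t f g by (simp add: r_diff T_closed)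
          ultimately show ?thesis
            using Cauchy_Schwarz[of "T (t + s') f - T (t + s) f" g] s t f g by (simp add: T_closed)
        qed
      qed
      moreover have "r (T t (S n)) g = (\<Sum>k<Suc n. ?d * r (T (t + real k * ?d) f) g)"
        unfolding S_def using TY t g f x
        by (subst r_T_sum) (auto simp: r_T_scale r_T_plus)
      moreover have "x * (e / (x + 1) * N g) \<le> e * N g"
      proof -
        have "x * (e / (x + 1)) \<le> e" using x e by (simp add: field_simps)
        then show ?thesis using g mult_right_mono[of "x * (e / (x + 1))" e "N g"] by simp
      qed
      ultimately show ?thesis unfolding x_eq[symmetric] by linarith
    qed
    then show ?thesis by blast
  qed
  have "\<exists>M. \<forall>m\<ge>M. \<forall>n\<ge>M. N (S m - S n) < e" if e: "e > 0" for e
  proof -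
    obtain n0 where n0: "\<And>n g. \<lbrakk>n \<ge> n0; g \<in> Y\<rbrakk> \<Longrightarrow>
        \<bar>integral {0..x} (\<lambda>s. r (T (0 + s) f) g) - r (T 0 (S n)) g\<bar> \<le> e/3 * N g"
      using approx[of 0 "e/3"] e by auto
    have "N (S m - S n) \<le> 2/3 * e" if "m \<ge> n0" "n \<ge> n0" for m n
    proof (rule N_le_weak)
      fix g assume g: "g \<in> Y"
      show "r (S m - S n) g \<le> 2/3 * e * N g"
        using n0[OF that(1) g] n0[OF that(2) g] SY g unfolding add_0
        by (simp only: r_diff r_T_0)
    qed (use SY e in auto)
    then show ?thesis using e by (intro exI[of _ n0]) force
  qed
  then obtain I where I: "I \<in> Y" "(\<lambda>n. N (S n - I)) \<longlonglongrightarrow> 0" using complete[of S] SY by blast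
  have *: "r (T t I) g = integral {0..x} (\<lambda>s. r (T (t + s) f) g)" if t: "0 \<le> t" and g: "g \<in> Y" for t g
  proof -
    obtain C where C: "\<And>f. f \<in> Y \<Longrightarrow> N (T t f) \<le> C * N f" using T_bdd[OF t] by blast
    have "(\<lambda>n. r (T t (S n)) g) \<longlonglongrightarrow> r (T t I) g"
    proof (rule LIM_zero_cancel, rule Lim_null_comparison)
      show "\<forall>\<^sub>F n in sequentially. norm (r (T t (S n)) g - r (T t I) g) \<le> C * N (S n - I) * N g"
      proof (intro always_eventually allI)
        fix n
        have "norm (r (T t (S n)) g - r (T t I) g) = \<bar>r (T t (S n - I)) g\<bar>"
          using SY I t g by (simp add: r_T_diff)
        also have "\<dots> \<le> N (T t (S n - I)) * N g" using SY I t g by (intro Cauchy_Schwarz T_closed) auto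
        also have "\<dots> \<le> C * N (S n - I) * N g" using SY I g by (intro mult_right_mono C) auto
        finally show "norm (r (T t (S n)) g - r (T t I) g) \<le> C * N (S n - I) * N g" .
      qed
      show "(\<lambda>n. C * N (S n - I) * N g) \<longlonglongrightarrow> 0"
        using tendsto_mult[OF tendsto_mult[OF tendsto_const I(2)] tendsto_const] by simp
    qed
    moreover have "(\<lambda>n. r (T t (S n)) g) \<longlonglongrightarrow> integral {0..x} (\<lambda>s. r (T (t + s) f) g)"
    proof (rule LIMSEQ_I)
      fix e :: real assume e: "e > 0"
      have pos: "N g + 1 > 0" using g by (simp add: add_nonneg_pos)
      obtain n0 where n0: "\<And>n. n \<ge> n0 \<Longrightarrow>
          \<bar>integral {0..x} (\<lambda>s. r (T (t + s) f) g) - r (T t (S n)) g\<bar> \<le> e / (N g + 1) * N g"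
        using approx[OF t, of "e / (N g + 1)"] e pos g by auto
      have "e / (N g + 1) * N g < e" using e pos by (simp add: field_simps)
      then show "\<exists>no. \<forall>n\<ge>no. norm (r (T t (S n)) g - integral {0..x} (\<lambda>s. r (T (t + s) f) g)) < e"
        using n0 by (intro exI[of _ n0]) (force simp: abs_minus_commute)
    qed
    ultimately show ?thesis by (rule LIMSEQ_unique)
  qed
  have "r I g = integral {0..x} (\<lambda>s. r (T s f) g)" if "g \<in> Y" for g
    using *[of 0 g] that I r_T_0 by simp
  then show ?thesis using * I(1) by blast
qed


lemma A_closed_T:
  assumes fh: "(f, h) \<in> A" "f \<in> Y" "h \<in> Y" and s: "0 \<le> s"
  shows "(T s f, T s h) \<in> A"
proof -
  obtain C where C: "\<And>f. f \<in> Y \<Longrightarrow> N (T s f) \<le> C * N f" using T_bdd[OF s] by blast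
  have lim: "((\<lambda>t. N ((1 / t) *\<^sub>R (T t f - f) + h)) \<longlongrightarrow> 0) (at_right 0)"
    using gen fh by blast
  have "((\<lambda>t. N ((1 / t) *\<^sub>R (T t (T s f) - T s f) + T s h)) \<longlongrightarrow> 0) (at_right 0)"
  proof (rule tendsto_sandwich[OF _ _ tendsto_const])
    show "\<forall>\<^sub>F t in at_right 0. N ((1 / t) *\<^sub>R (T t (T s f) - T s f) + T s h)
        \<le> C * N ((1 / t) *\<^sub>R (T t f - f) + h)"
    proof (rule eventually_at_right_less[THEN eventually_mono])
      fix t :: real assume t: "0 < t"
      have "N ((1 / t) *\<^sub>R (T t (T s f) - T s f) + T s h) = N (T s ((1 / t) *\<^sub>R (T t f - f) + h))"
        using t s fh(2,3) by (intro N_weak)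
          (auto simp: T_closed r_T_plus r_T_scale r_T_diff r_T_add r_bilinear add.commute)
      also have "\<dots> \<le> C * N ((1 / t) *\<^sub>R (T t f - f) + h)" using t fh by (intro C) (auto simp: T_closed)
      finally show "N ((1 / t) *\<^sub>R (T t (T s f) - T s f) + T s h) \<le> C * N ((1 / t) *\<^sub>R (T t f - f) + h)" .
    qed
    show "\<forall>\<^sub>F t in at_right 0. 0 \<le> N ((1 / t) *\<^sub>R (T t (T s f) - T s f) + T s h)"
      using eventually_at_right_less[of 0] by eventually_elim (use s fh in \<open>auto simp: T_closed\<close>)
    show "((\<lambda>t. C * N ((1 / t) *\<^sub>R (T t f - f) + h)) \<longlongrightarrow> 0) (at_right 0)"
      using tendsto_mult[OF tendsto_const lim] by simp
  qed
  then show ?thesis using gen[of "T s f" "T s h"] T_closed[OF s] fh by simp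
qed

lemma integral_diff_bound:
  assumes f: "f \<in> Y" and g: "g \<in> Y" and u: "u \<in> Y" and ab: "0 \<le> a" "a \<le> b"
    and near: "\<And>s. \<lbrakk>a \<le> s; s \<le> b\<rbrakk> \<Longrightarrow> N (T s f - u) \<le> e"
  shows "\<bar>integral {a..b} (\<lambda>s. r (T s f) g) - (b - a) * r u g\<bar> \<le> (b - a) * (e * N g)"
proof -
  have c: "continuous_on {a..b} (\<lambda>s. r (T s f) g)"
    using ab by (intro continuous_on_subset[OF weakly_continuous[OF f g, of b]]) auto
  have "integral {a..b} (\<lambda>s. r (T s f) g) - (b - a) * r u g = integral {a..b} (\<lambda>s. r (T s f) g - r u g)"
    using ab by (subst Henstock_Kurzweil_Integration.integral_diff)
      (auto intro: integrable_continuous_interval c)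
  also have "\<bar>\<dots>\<bar> \<le> (e * N g) * (b - a)"
  proof (rule integral_bound[of a b "\<lambda>s. r (T s f) g - r u g" "e * N g", unfolded real_norm_def])
    fix s assume s: "s \<in> {a..b}"
    have "\<bar>r (T s f) g - r u g\<bar> = \<bar>r (T s f - u) g\<bar>" using s f g u ab by (simp add: r_diff T_closed)
    also have "\<dots> \<le> N (T s f - u) * N g" using s f g u ab by (intro Cauchy_Schwarz) (auto simp: T_closed)
    also have "\<dots> \<le> e * N g" using near[of s] s g by (intro mult_right_mono) auto
    finally show "\<bar>r (T s f) g - r u g\<bar> \<le> e * N g" .
  qed (use ab c in \<open>auto intro!: continuous_intros\<close>)
  finally show ?thesis by (simp add: mult.commute)
qed

text \<open>
  The difference quotient of the orbit of
  \<open>I = \<integral>\<^sub>0\<^sup>x T s f ds\<close> is a difference of means of the orbit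
  of \<open>f\<close> over \<open>{x..x + t}\<close> and \<open>{0..t}\<close>, and therefore
  tends to \<open>T x f - f\<close>.
\<close>

lemma orbit_integral_in_domain:
  assumes f: "f \<in> Y" and x: "0 \<le> x" and I: "I \<in> Y"
    and TI: "\<And>t g. \<lbrakk>0 \<le> t; g \<in> Y\<rbrakk> \<Longrightarrow> r (T t I) g = integral {0..x} (\<lambda>s. r (T (t + s) f) g)"
    and rI: "\<And>g. g \<in> Y \<Longrightarrow> r I g = integral {0..x} (\<lambda>s. r (T s f) g)"
  shows "(I, - (T x f - f)) \<in> A"
proof -
  have TxY: "T x f \<in> Y" using f x T_closed by blast
  have "((\<lambda>t. N ((1 / t) *\<^sub>R (T t I - I) + - (T x f - f))) \<longlongrightarrow> 0) (at_right 0)"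
  proof (rule tendstoI)
    fix e :: real assume e: "e > 0"
    obtain d1 where d1: "d1 > 0" "\<And>s. \<lbrakk>0 \<le> s; s \<le> d1\<rbrakk> \<Longrightarrow> N (T s f - f) < e/3"
      using right_continuous[OF f, of "e/3"] e by auto
    obtain d2 where d2: "d2 > 0" "\<And>s. \<lbrakk>0 \<le> s; s \<le> d2\<rbrakk> \<Longrightarrow> N (T s (T x f) - T x f) < e/3"
      using right_continuous[OF TxY, of "e/3"] e by auto
    have "N ((1 / t) *\<^sub>R (T t I - I) + - (T x f - f)) \<le> 2/3 * e" if t: "0 < t" "t < min d1 d2" for t
    proof (rule N_le_weak)
      show "(1 / t) *\<^sub>R (T t I - I) + - (T x f - f) \<in> Y" using t I f TxY T_closed by simp
      fix g assume g: "g \<in> Y"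
      let ?q = "\<lambda>s. r (T s f) g"
      have int: "?q integrable_on {0..x + t}"
        by (rule integrable_continuous_interval[OF weakly_continuous[OF f g]])
      have shift: "integral {0..x} (\<lambda>s. ?q (t + s)) = integral {t..x + t} ?q"
        using integral_shift_Icc_real[of 0 x ?q t] by (simp add: comp_def)
      have "integral {0..t} ?q + integral {t..x + t} ?q = integral {0..x + t} ?q"
        using t x by (intro Henstock_Kurzweil_Integration.integral_combine int) auto
      moreover have "integral {0..x} ?q + integral {x..x + t} ?q = integral {0..x + t} ?q"
        using t x by (intro Henstock_Kurzweil_Integration.integral_combine int) auto
      ultimately have eq: "r (T t I - I) g = integral {x..x + t} ?q - integral {0..t} ?q"
        using TI[of t g] rI[OF g] shift t g I by (simp add: r_diff T_closed)
      have b1: "\<bar>integral {0..t} ?q - (t - 0) * r f g\<bar> \<le> (t - 0) * (e/3 * N g)"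
        using d1(2) t by (intro integral_diff_bound f g) (auto intro!: less_imp_le)
      have b2: "\<bar>integral {x..x + t} ?q - (x + t - x) * r (T x f) g\<bar> \<le> (x + t - x) * (e/3 * N g)"
      proof (intro integral_diff_bound f g TxY x)
        fix s assume s: "x \<le> s" "s \<le> x + t"
        have "N (T s f - T x f) = N (T (s - x) (T x f) - T x f)"
          using s x f TxY by (intro N_weak) (auto simp: r_diff T_closed r_T_plus)
        then show "N (T s f - T x f) \<le> e/3" using d2(2)[of "s - x"] s t by simp
      qed (use t in simp)
      have "r ((1 / t) *\<^sub>R (T t I - I) + - (T x f - f)) g
         = (1 / t) * (integral {x..x + t} ?q - t * r (T x f) g - (integral {0..t} ?q - t * r f g))"
      proof -
        have "r ((1 / t) *\<^sub>R (T t I - I) + - (T x f - f)) g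
           = (1 / t) * r (T t I - I) g - (r (T x f) g - r f g)"
          using t g I f TxY T_closed by (simp only: r_bilinear closed_ops less_imp_le)
        then show ?thesis unfolding eq using t by (simp add: field_simps)
      qed
      also have "\<dots> \<le> (1 / t) * (2 * (t * (e/3 * N g)))"
        using b1 b2 t unfolding abs_le_iff diff_zero add_diff_cancel_left'
          by (intro mult_left_mono) (linarith, simp)
      also have "\<dots> = 2/3 * e * N g" using t by simp
      finally show "r ((1 / t) *\<^sub>R (T t I - I) + - (T x f - f)) g \<le> 2/3 * e * N g" .
    qed (use e in simp)
    then have "\<forall>t>0. t < min d1 d2 \<longrightarrow> dist (N ((1 / t) *\<^sub>R (T t I - I) + - (T x f - f))) 0 < e"
      using e I f TxY T_closed by (auto simp: dist_real_def) force
    then show "\<forall>\<^sub>F t in at_right 0. dist (N ((1 / t) *\<^sub>R (T t I - I) + - (T x f - f))) 0 < e"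
      unfolding eventually_at_right[OF zero_less_one] using d1(1) d2(1) by (intro exI[of _ "min d1 d2"]) auto
  qed
  then show ?thesis using gen[OF I, of "- (T x f - f)"] f TxY by simp
qed

lemma A_scale:
  assumes "(f, h) \<in> A" "f \<in> Y" "h \<in> Y" shows "(c *\<^sub>R f, c *\<^sub>R h) \<in> A"
proof -
  have lim: "((\<lambda>t. N ((1 / t) *\<^sub>R (T t f - f) + h)) \<longlongrightarrow> 0) (at_right 0)" using gen assms by blast
  have "((\<lambda>t. \<bar>c\<bar> * N ((1 / t) *\<^sub>R (T t f - f) + h)) \<longlongrightarrow> 0) (at_right 0)"
    using tendsto_mult[OF tendsto_const lim] by simp
  moreover have "\<forall>\<^sub>F t in at_right 0. \<bar>c\<bar> * N ((1 / t) *\<^sub>R (T t f - f) + h)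
       = N ((1 / t) *\<^sub>R (T t (c *\<^sub>R f) - c *\<^sub>R f) + c *\<^sub>R h)"
  proof (rule eventually_at_right_less[THEN eventually_mono])
    fix t :: real assume t: "0 < t"
    have "\<bar>c\<bar> * N ((1 / t) *\<^sub>R (T t f - f) + h) = N (c *\<^sub>R ((1 / t) *\<^sub>R (T t f - f) + h))"
      using t assms by (simp add: N_scale T_closed)
    also have "\<dots> = N ((1 / t) *\<^sub>R (T t (c *\<^sub>R f) - c *\<^sub>R f) + c *\<^sub>R h)"
      using t assms by (intro N_weak) (auto simp: T_closed r_T_scale r_bilinear algebra_simps)
    finally show "\<bar>c\<bar> * N ((1 / t) *\<^sub>R (T t f - f) + h) = N ((1 / t) *\<^sub>R (T t (c *\<^sub>R f) - c *\<^sub>R f) + c *\<^sub>R h)" .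
  qed
  ultimately have "((\<lambda>t. N ((1 / t) *\<^sub>R (T t (c *\<^sub>R f) - c *\<^sub>R f) + c *\<^sub>R h)) \<longlongrightarrow> 0) (at_right 0)"
    by (rule Lim_transform_eventually)
  then show ?thesis using gen assms by simp
qed

text \<open>
  Means of an orbit over short time intervals are in the domain and close to the initial value.
\<close>

lemma domain_dense:
  assumes f: "f \<in> Y" and e: "e > 0"
  obtains v h where "(v, h) \<in> A" "v \<in> Y" "h \<in> Y" "N (v - f) \<le> e"
proof -
  obtain d where d: "d > 0" "\<And>s. \<lbrakk>0 \<le> s; s \<le> d\<rbrakk> \<Longrightarrow> N (T s f - f) < e"
    using right_continuous[OF f e] by auto
  obtain I where I: "I \<in> Y"
    "\<And>t g. \<lbrakk>0 \<le> t; g \<in> Y\<rbrakk> \<Longrightarrow> r (T t I) g = integral {0..d} (\<lambda>s. r (T (t + s) f) g)"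
    "\<And>g. g \<in> Y \<Longrightarrow> r I g = integral {0..d} (\<lambda>s. r (T s f) g)"
    using orbit_integral[OF f, of d] d(1) by auto
  have TY: "T d f \<in> Y" using T_closed d(1) f by simp
  have "(I, - (T d f - f)) \<in> A" using d(1) by (intro orbit_integral_in_domain f I) auto
  then have "((1 / d) *\<^sub>R I, (1 / d) *\<^sub>R (- (T d f - f))) \<in> A" using I f TY by (intro A_scale) auto
  moreover have "N ((1 / d) *\<^sub>R I - f) \<le> e"
  proof (rule N_le_weak)
    fix g assume g: "g \<in> Y"
    have "\<bar>integral {0..d} (\<lambda>s. r (T s f) g) - (d - 0) * r f g\<bar> \<le> (d - 0) * (e * N g)"
      using d by (intro integral_diff_bound f g) (auto intro: less_imp_le)
    then have "r I g - d * r f g \<le> d * (e * N g)" using I(3)[OF g] by simp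
    then have "(1 / d) * (r I g - d * r f g) \<le> (1 / d) * (d * (e * N g))"
      using d(1) by (intro mult_left_mono) auto
    then show "r ((1 / d) *\<^sub>R I - f) g \<le> e * N g"
      using d(1) I f g by (simp add: r_bilinear right_diff_distrib)
  qed (use I f e in auto)
  ultimately show thesis using that[of "(1 / d) *\<^sub>R I" "(1 / d) *\<^sub>R (- (T d f - f))"] I(1) f TY by simp
qed


section \<open>Growth of a remainder along a semigroup\<close>

text \<open>
  In the application, \<open>w f\<close> is the difference between \<open>f\<close> and its
  projection onto a closed convex set, and \<open>N (w f)\<close> is the distance to that set;
  the hypothesis \<open>w_add\<close> says that \<open>w (f + g)\<close> is no longer than the
  vector from the projection of \<open>f\<close> to \<open>f + g\<close>. It permits an estimate
  of the squared distance along the orbit: for \<open>f\<close> in the domain, one time step of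
  length \<open>\<delta>\<close> increases it by at most
  \<open>2 \<omega> \<delta> (N (w f))\<^sup>2\<close> up to an error of order
  \<open>o(\<delta>)\<close> that is uniform on compact time intervals. Summing over a grid and
  refining it gives the exponential bound. The case of general \<open>f\<close> follows by
  density.
\<close>

theorem growth_of_remainder:
  fixes w :: "'a \<Rightarrow> 'a"
  assumes wY: "\<And>f. f \<in> Y \<Longrightarrow> w f \<in> Y"
    and w_add: "\<And>f g. \<lbrakk>f \<in> Y; g \<in> Y\<rbrakk> \<Longrightarrow> N (w (f + g)) \<le> N (w f + g)"
    and \<omega>: "0 \<le> \<omega>"
    and acc: "\<And>f h. \<lbrakk>(f, h) \<in> A; f \<in> Y; h \<in> Y\<rbrakk> \<Longrightarrow> - \<omega> * (N (w f))\<^sup>2 \<le> r h (w f)"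
    and t: "0 \<le> t" and f: "f \<in> Y"
  shows "N (w (T t f)) \<le> exp (\<omega> * t) * N (w f)"
proof -
  have w_lip: "N (w f) \<le> N (w g) + N (f - g)" if "f \<in> Y" "g \<in> Y" for f g
    using w_add[of g "f - g"] N_triangle[of "w g" "f - g"] that wY by simp
  obtain M where M: "1 \<le> M" "\<And>s f. \<lbrakk>0 \<le> s; s \<le> t; f \<in> Y\<rbrakk> \<Longrightarrow> N (T s f) \<le> M * N f"
    using T_bound[of t] by blast
  have dom: "(N (w (T t f)))\<^sup>2 \<le> exp (2 * \<omega> * t) * (N (w f))\<^sup>2"
    if A: "(f, h) \<in> A" and f: "f \<in> Y" and h: "h \<in> Y" for f h
  proof (cases "t = 0")
    case True
    then show ?thesis using w_lip[of "T 0 f" f] T_0[OF f] f wY T_closed[of 0 f]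
      by (auto intro!: power_mono)
  next
    case False
    then have t: "0 < t" using \<open>0 \<le> t\<close> by simp
    define \<rho> where "\<rho> \<delta> = N ((1 / \<delta>) *\<^sub>R (T \<delta> f - f) + h)" for \<delta>
    define W where "W = N (w 0) + M * N f"
    \<comment> \<open>Apart from the growth by the factor \<open>exp (2 * \<omega> * \<delta>)\<close>, a time
      step of length \<open>\<delta>\<close> increases the squared distance by at most
      \<open>\<delta> * \<eta> \<delta>\<close>; the bound \<open>W\<close> on the distances and
      the bound \<open>M\<close> on the operators make it independent of the time.\<close>
    define \<eta> where "\<eta> \<delta> = 2 * W * (M * \<rho> \<delta>) + \<delta> * (M * N h + M * \<rho> \<delta>)\<^sup>2" for \<delta>
    have \<rho>lim: "(\<rho> \<longlongrightarrow> 0) (at_right 0)" using gen A f h unfolding \<rho>_def by blast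
    have \<eta>lim: "(\<eta> \<longlongrightarrow> 0) (at_right 0)"
    proof -
      have "(\<eta> \<longlongrightarrow> 2 * W * (M * 0) + 0 * (M * N h + M * 0)\<^sup>2) (at_right 0)"
        unfolding \<eta>_def by (intro tendsto_intros \<rho>lim)
      then show ?thesis by simp
    qed
    define \<phi> where "\<phi> s = (N (w (T s f)))\<^sup>2" for s
    have step: "\<phi> (s + \<delta>) \<le> exp (2 * \<omega> * \<delta>) * \<phi> s + \<delta> * \<eta> \<delta>"
      if s: "0 \<le> s" "s \<le> t" and d: "0 < \<delta>" for s \<delta>
    proof -
      define a where "a = T s f"
      define b where "b = T (s + \<delta>) f - a"
      \<comment> \<open>\<open>z\<close> is the deviation of the increment \<open>b\<close> of the orbit from its
        linearisation.\<close>
      define z where "z = b + \<delta> *\<^sub>R T s h"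
      have Y: "a \<in> Y" "b \<in> Y" "z \<in> Y" "w a \<in> Y" "T s h \<in> Y" "T (s + \<delta>) f \<in> Y"
        using s d f h wY by (auto simp: a_def b_def z_def T_closed)
      have \<rho>0: "0 \<le> \<rho> \<delta>" using f h d by (simp add: \<rho>_def T_closed)
      have "N z = N (\<delta> *\<^sub>R T s ((1 / \<delta>) *\<^sub>R (T \<delta> f - f) + h))"
        using s d f h Y unfolding z_def b_def a_def
        by (intro N_weak) (auto simp: T_closed r_bilinear r_T_add r_T_diff r_T_scale r_T_plus algebra_simps)
      also have "\<dots> \<le> \<delta> * (M * \<rho> \<delta>)" unfolding \<rho>_def
        using M(2)[OF s] s d f h by (simp add: N_scale T_closed)
      finally have Nz: "N z \<le> \<delta> * (M * \<rho> \<delta>)" .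
      have "b = z + (- \<delta>) *\<^sub>R T s h" by (simp add: z_def)
      then have "N b \<le> N z + \<delta> * N (T s h)"
        using N_triangle[of z "(- \<delta>) *\<^sub>R T s h"] Y d by (simp add: N_scale N_minus)
      also have "\<dots> \<le> \<delta> * (M * \<rho> \<delta>) + \<delta> * (M * N h)"
        using Nz M(2)[OF s h] d by (intro add_mono mult_left_mono) auto
      finally have Nb: "N b \<le> \<delta> * (M * N h + M * \<rho> \<delta>)" by (simp add: algebra_simps)
      have NW: "N (w a) \<le> W"
        using w_lip[of a 0] M(2)[OF s f] Y by (simp add: W_def a_def)
      have "(a, T s h) \<in> A" unfolding a_def using A_closed_T[OF A f h s(1)] .
      then have acc': "- \<omega> * (N (w a))\<^sup>2 \<le> r (T s h) (w a)" using acc Y by blast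
      have "r (w a) b = r (w a) z - \<delta> * r (T s h) (w a)"
        using \<open>b = z + (- \<delta>) *\<^sub>R T s h\<close> Y by (simp add: r_bilinear r_sym[of "w a" "T s h"])
      also have "\<dots> \<le> W * (\<delta> * (M * \<rho> \<delta>)) - \<delta> * (- \<omega> * (N (w a))\<^sup>2)"
      proof (rule diff_mono)
        have "r (w a) z \<le> N (w a) * N z" using Y by (intro r_le)
        also have "\<dots> \<le> W * (\<delta> * (M * \<rho> \<delta>))" using NW Nz Y order_trans[OF N_nonneg NW]
          by (intro mult_mono) auto
        finally show "r (w a) z \<le> W * (\<delta> * (M * \<rho> \<delta>))" .
        show "\<delta> * (- \<omega> * (N (w a))\<^sup>2) \<le> \<delta> * r (T s h) (w a)" using acc' d by (intro mult_left_mono) auto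
      qed
      finally have rb: "r (w a) b \<le> W * (\<delta> * (M * \<rho> \<delta>)) + \<omega> * \<delta> * (N (w a))\<^sup>2" by (simp add: algebra_simps)
      have "\<phi> (s + \<delta>) \<le> (N (w a + b))\<^sup>2" unfolding \<phi>_def
        using w_add[of a b] Y by (intro power_mono) (auto simp: b_def wY)
      also have "\<dots> = (N (w a))\<^sup>2 + 2 * r (w a) b + (N b)\<^sup>2"
        using Y by (simp add: N_sq r_bilinear r_sym[of b "w a"])
      also have "\<dots> \<le> (N (w a))\<^sup>2 + 2 * (W * (\<delta> * (M * \<rho> \<delta>)) + \<omega> * \<delta> * (N (w a))\<^sup>2)
           + (\<delta> * (M * N h + M * \<rho> \<delta>))\<^sup>2"
        using rb Nb Y by (intro add_mono mult_left_mono power_mono) auto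
      also have "\<dots> = (1 + 2 * \<omega> * \<delta>) * \<phi> s + \<delta> * \<eta> \<delta>"
        unfolding \<phi>_def \<eta>_def a_def by (simp add: power2_eq_square algebra_simps)
      also have "\<dots> \<le> exp (2 * \<omega> * \<delta>) * \<phi> s + \<delta> * \<eta> \<delta>"
        using exp_ge_add_one_self[of "2 * \<omega> * \<delta>"] by (intro add_right_mono mult_right_mono) (auto simp: \<phi>_def)
      finally show ?thesis .
    qed
    have iter: "\<phi> t \<le> exp (2 * \<omega> * t) * (\<phi> 0 + t * \<eta> (t / Suc n))" if \<eta>n: "0 \<le> \<eta> (t / Suc n)" for n
    proof -
      let ?d = "t / Suc n"
      have d: "0 < ?d" using t by simp
      have "\<phi> (real k * ?d) \<le> exp (2 * \<omega> * (real k * ?d)) * (\<phi> 0 + real k * (?d * \<eta> ?d))" if "k \<le> Suc n" for k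
        using that
      proof (induction k)
        case (Suc k)
        have kd: "0 \<le> real k * ?d" "real k * ?d \<le> t"
        proof -
          show "0 \<le> real k * ?d" using d by (intro mult_nonneg_nonneg) auto
          have "real k * ?d \<le> real (Suc n) * ?d" using Suc.prems d by (intro mult_right_mono) auto
          then show "real k * ?d \<le> t" by simp
        qed
        have "\<phi> (real (Suc k) * ?d) = \<phi> (real k * ?d + ?d)" by (simp add: algebra_simps add_divide_distrib)
        also have "\<dots> \<le> exp (2 * \<omega> * ?d) * \<phi> (real k * ?d) + ?d * \<eta> ?d" using step[OF kd d] .
        also have "\<dots> \<le> exp (2 * \<omega> * ?d) * (exp (2 * \<omega> * (real k * ?d)) * (\<phi> 0 + real k * (?d * \<eta> ?d)))
             + exp (2 * \<omega> * (real k * ?d) + 2 * \<omega> * ?d) * (?d * \<eta> ?d)"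
        proof (intro add_mono mult_left_mono)
          have "1 \<le> exp (2 * \<omega> * (real k * ?d) + 2 * \<omega> * ?d)" using \<omega> d kd by simp
          then show "?d * \<eta> ?d \<le> exp (2 * \<omega> * (real k * ?d) + 2 * \<omega> * ?d) * (?d * \<eta> ?d)"
            using mult_right_mono[of 1 "exp (2 * \<omega> * (real k * ?d) + 2 * \<omega> * ?d)" "?d * \<eta> ?d"]
              mult_nonneg_nonneg[OF less_imp_le[OF d] \<eta>n] by linarith
        qed (use Suc in auto)
        also have "\<dots> = exp (2 * \<omega> * (real k * ?d) + 2 * \<omega> * ?d) * (\<phi> 0 + real (Suc k) * (?d * \<eta> ?d))"
          by (simp add: exp_add algebra_simps del: times_divide_eq_right times_divide_eq_left)
        also have "2 * \<omega> * (real k * ?d) + 2 * \<omega> * ?d = 2 * \<omega> * (real (Suc k) * ?d)"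
          by (simp add: algebra_simps add_divide_distrib)
        finally show ?case .
      qed simp
      from this[of "Suc n"] show ?thesis by simp
    qed
    have "(\<lambda>n. t / Suc n) \<longlonglongrightarrow> 0" by (rule LIMSEQ_Suc) real_asymp
    then have "filterlim (\<lambda>n. t / Suc n) (at_right 0) sequentially"
      using t by (auto simp: filterlim_at eventually_sequentially)
    then have lim\<eta>: "(\<lambda>n. \<eta> (t / Suc n)) \<longlonglongrightarrow> 0" using \<eta>lim filterlim_compose by blast
    have \<eta>0: "0 \<le> \<eta> (t / Suc n)" for n
      using f h t M(1) wY by (auto simp: \<eta>_def W_def \<rho>_def T_closed)
    have "\<phi> t \<le> exp (2 * \<omega> * t) * (\<phi> 0 + t * 0)"
    proof (rule tendsto_lowerbound)
      show "(\<lambda>n. exp (2 * \<omega> * t) * (\<phi> 0 + t * \<eta> (t / Suc n))) \<longlonglongrightarrow> exp (2 * \<omega> * t) * (\<phi> 0 + t * 0)"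
        by (intro tendsto_intros lim\<eta>)
    qed (use iter[OF \<eta>0] in auto)
    moreover have "\<phi> 0 \<le> (N (w f))\<^sup>2" unfolding \<phi>_def
      using w_lip[of "T 0 f" f] T_0[OF f] f wY T_closed[of 0 f] by (intro power_mono) auto
    ultimately show ?thesis unfolding \<phi>_def by (auto intro: order_trans)
  qed
  show ?thesis
  proof (rule field_le_epsilon)
    fix e :: real assume e: "e > 0"
    define E where "E = exp (\<omega> * t)"
    have E: "E \<ge> 1" unfolding E_def using \<omega> t by simp
    define e' where "e' = e / (E + M)"
    have EM: "E + M > 0" using E M(1) by simp
    have e': "e' > 0" using e EM by (simp add: e'_def)
    obtain v h where v: "(v, h) \<in> A" "v \<in> Y" "h \<in> Y" "N (v - f) \<le> e'"
      using domain_dense[OF f e'] by blast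
    have "(N (w (T t v)))\<^sup>2 \<le> (E * N (w v))\<^sup>2"
      using dom[OF v(1-3)] by (simp add: E_def power_mult_distrib mult.assoc flip: exp_double)
    then have 1: "N (w (T t v)) \<le> E * N (w v)"
      by (rule power2_le_imp_le) (use E v wY in simp)
    have "N (w (T t f)) \<le> N (w (T t v)) + N (T t f - T t v)"
      using f v t by (intro w_lip) (auto simp: T_closed)
    also have "N (T t f - T t v) = N (T t (f - v))"
      using f v t by (intro N_weak) (auto simp: T_closed r_diff r_T_diff)
    also have "\<dots> \<le> M * N (f - v)" using f v t M(2) by simp
    finally have "N (w (T t f)) \<le> E * N (w v) + M * e'"
      using 1 v(4) N_diff_commute[OF f v(2)] M(1) mult_left_mono[of "N (f - v)" e' M] by linarith
    also have "E * N (w v) \<le> E * (N (w f) + e')"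
      using w_lip[OF v(2) f] v(4) E by (intro mult_left_mono) auto
    finally have "N (w (T t f)) \<le> E * N (w f) + (E + M) * e'" by (simp add: algebra_simps)
    also have "(E + M) * e' = e" using EM by (simp add: e'_def)
    finally show "N (w (T t f)) \<le> exp (\<omega> * t) * N (w f) + e" by (simp add: E_def)
  qed
qed

end


section \<open>The spaces \<open>L\<^sub>2\<close>\<close>

text \<open>
  With the pointwise scalar multiplication, spaces of representatives are real vector spaces,
  and the abstract results on semi-Hilbert spaces apply to them.
\<close>

instantiation "fun" :: (type, real_vector) real_vector
begin
definition scaleR_fun :: "real \<Rightarrow> ('a \<Rightarrow> 'b) \<Rightarrow> 'a \<Rightarrow> 'b" where
  "scaleR_fun c f = (\<lambda>x. c *\<^sub>R f x)"
instance
  by standard (auto simp: scaleR_fun_def plus_fun_def algebra_simps)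
end

lemma K_closed_ops:
  assumes "K = \<real> \<or> K = UNIV"
  shows "0 \<in> K" "1 \<in> K" "x \<in> K \<Longrightarrow> y \<in> K \<Longrightarrow> x + y \<in> K" "x \<in> K \<Longrightarrow> y \<in> K \<Longrightarrow> x - y \<in> K"
    "x \<in> K \<Longrightarrow> y \<in> K \<Longrightarrow> x * y \<in> K" "x \<in> K \<Longrightarrow> y \<in> K \<Longrightarrow> x / y \<in> K"
    "x \<in> K \<Longrightarrow> - x \<in> K" "complex_of_real c \<in> K" "x \<in> K \<Longrightarrow> c *\<^sub>R x \<in> K" "x \<in> K \<Longrightarrow> cnj x \<in> K"
    "closed K"
  using assms by (auto simp: closed_complex_Reals scaleR_conv_of_real Reals_cnj_iff)

lemma cnj_measurable [measurable]: "cnj \<in> borel_measurable borel"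
  by (intro borel_measurable_continuous_onI continuous_intros)

lemma L2_mult_integrable:
  assumes "f \<in> L2_fun K M" "g \<in> L2_fun K M"
  shows "integrable M (\<lambda>x. f x * cnj (g x))"
proof (rule Bochner_Integration.integrable_bound)
  show "integrable M (\<lambda>x. (cmod (f x))\<^sup>2 + (cmod (g x))\<^sup>2)"
    using assms by (auto simp: L2_fun_def)
  have [measurable]: "f \<in> borel_measurable M" "g \<in> borel_measurable M" using assms by (auto simp: L2_fun_def)
  show "(\<lambda>x. f x * cnj (g x)) \<in> borel_measurable M" by measurable
  have "a * b \<le> a\<^sup>2 + b\<^sup>2" if "0 \<le> a" "0 \<le> b" for a b :: real
    using sum_squares_bound[of a b] mult_nonneg_nonneg[OF that] by linarith
  then show "AE x in M. norm (f x * cnj (g x)) \<le> norm ((cmod (f x))\<^sup>2 + (cmod (g x))\<^sup>2)"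
    by (auto simp: norm_mult)
qed

lemma L2_subspace:
  assumes K: "K = \<real> \<or> K = UNIV" shows "subspace (L2_fun K M)"
  unfolding subspace_def
proof (intro conjI ballI allI)
  show "0 \<in> L2_fun K M" using K_closed_ops(1)[OF K] by (auto simp: L2_fun_def zero_fun_def)
next
  fix f g assume fg: "f \<in> L2_fun K M" "g \<in> L2_fun K M"
  then have [measurable]: "f \<in> borel_measurable M" "g \<in> borel_measurable M" by (auto simp: L2_fun_def)
  have "integrable M (\<lambda>x. (cmod (f x + g x))\<^sup>2)"
  proof (rule Bochner_Integration.integrable_bound)
    show "integrable M (\<lambda>x. 2 * (cmod (f x))\<^sup>2 + 2 * (cmod (g x))\<^sup>2)" using fg by (auto simp: L2_fun_def)
    have "(cmod (a + b))\<^sup>2 \<le> 2 * (cmod a)\<^sup>2 + 2 * (cmod b)\<^sup>2" for a b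
    proof -
      have "(cmod (a + b))\<^sup>2 \<le> (cmod a + cmod b)\<^sup>2" by (intro power_mono norm_triangle_ineq) auto
      also have "\<dots> \<le> 2 * (cmod a)\<^sup>2 + 2 * (cmod b)\<^sup>2"
        using sum_squares_bound[of "cmod a" "cmod b"] by (simp add: power2_sum)
      finally show ?thesis .
    qed
    then show "AE x in M. norm ((cmod (f x + g x))\<^sup>2) \<le> norm (2 * (cmod (f x))\<^sup>2 + 2 * (cmod (g x))\<^sup>2)" by auto
  qed measurable
  then show "f + g \<in> L2_fun K M" using fg K_closed_ops(3)[OF K] by (auto simp: L2_fun_def plus_fun_def)
next
  fix c :: real and f assume f: "f \<in> L2_fun K M"
  then have [measurable]: "f \<in> borel_measurable M" by (auto simp: L2_fun_def)
  show "c *\<^sub>R f \<in> L2_fun K M" using f K_closed_ops(9)[OF K]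
    by (auto simp: L2_fun_def scaleR_fun_def power_mult_distrib)
qed

definition L2_ip :: "real measure \<Rightarrow> (real \<Rightarrow> complex) \<Rightarrow> (real \<Rightarrow> complex) \<Rightarrow> real" where
  "L2_ip M f g = Re (LINT x|M. f x * cnj (g x))"

lemma L2_ip_self: "L2_ip M f f = (LINT x|M. (cmod (f x))\<^sup>2)"
proof -
  have "(\<lambda>x. f x * cnj (f x)) = (\<lambda>x. complex_of_real ((cmod (f x))\<^sup>2))"
    by (simp only: complex_norm_square)
  then show ?thesis unfolding L2_ip_def by (simp only: integral_complex_of_real Re_complex_of_real)
qed

lemma L2_semi_inner_product:
  assumes K: "K = \<real> \<or> K = UNIV" shows "semi_inner_product (L2_fun K M) (L2_ip M)"
proof
  note int = L2_mult_integrable[where K=K and M=M]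
  fix f g h assume "f \<in> L2_fun K M" "g \<in> L2_fun K M" "h \<in> L2_fun K M"
  then show "L2_ip M (f + g) h = L2_ip M f h + L2_ip M g h"
    by (simp add: L2_ip_def plus_fun_def distrib_right int)
next
  note int = L2_mult_integrable[where K=K and M=M]
  fix f h c assume "f \<in> L2_fun K M" "h \<in> L2_fun K M"
  then show "L2_ip M (c *\<^sub>R f) h = c * L2_ip M f h"
    by (simp add: L2_ip_def scaleR_fun_def int)
next
  fix f g assume "f \<in> L2_fun K M" "g \<in> L2_fun K M"
  have "(LINT x|M. f x * cnj (g x)) = (LINT x|M. cnj (g x * cnj (f x)))" by (simp add: mult.commute)
  also have "\<dots> = cnj (LINT x|M. g x * cnj (f x))" by (rule Bochner_Integration.integral_cnj)
  finally show "L2_ip M f g = L2_ip M g f" by (simp add: L2_ip_def)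
qed (auto simp: L2_ip_self L2_subspace[OF K])

text \<open>The Cauchy-Schwarz inequality with the constant function \<open>1\<close>.\<close>

lemma L2_L1_bound:
  assumes "finite_measure M" "f \<in> L2_fun K M"
  shows "integrable M f" "(LINT x|M. cmod (f x)) \<le> sqrt (measure M (space M)) * sqrt (LINT x|M. (cmod (f x))\<^sup>2)"
proof -
  interpret finite_measure M by fact
  interpret L: semi_inner_product "L2_fun UNIV M" "L2_ip M" by (rule L2_semi_inner_product) simp
  have [measurable]: "f \<in> borel_measurable M" using assms by (auto simp: L2_fun_def)
  define g where "g x = complex_of_real (cmod (f x))" for x
  have g: "g \<in> L2_fun UNIV M" "(\<lambda>x. 1) \<in> L2_fun UNIV M"
    unfolding g_def[abs_def] using assms by (auto simp: L2_fun_def)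
  have "integrable M (\<lambda>x. g x * cnj 1)" using L2_mult_integrable[OF g] by simp
  then have "integrable M g" by simp
  then show f: "integrable M f" by (rule Bochner_Integration.integrable_bound) (auto simp: g_def)
  have "L2_ip M g (\<lambda>x. 1) = (LINT x|M. cmod (f x))" by (simp add: L2_ip_def g_def)
  then show "(LINT x|M. cmod (f x)) \<le> sqrt (measure M (space M)) * sqrt (LINT x|M. (cmod (f x))\<^sup>2)"
    using L.r_le[OF g] by (simp add: L.N_def L2_ip_self g_def mult.commute)
qed

text \<open>
  The theorem of Riesz and Fischer. On a finite measure space an \<open>L\<^sub>2\<close>-Cauchy
  sequence is \<open>L\<^sub>1\<close>-Cauchy, and so a subsequence converges almost everywhere;
  the limit has the required distances by Fatou's lemma.
\<close>

lemma L2_semi_hilbert: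
  assumes K: "K = \<real> \<or> K = UNIV" and M: "finite_measure M"
  shows "semi_hilbert (L2_fun K M) (L2_ip M)"
proof -
  interpret finite_measure M by fact
  interpret L: semi_inner_product "L2_fun K M" "L2_ip M" by (rule L2_semi_inner_product[OF K])
  show ?thesis
  proof unfold_locales
    fix F :: "nat \<Rightarrow> real \<Rightarrow> complex"
    assume F: "\<And>n. F n \<in> L2_fun K M"
      and Cau: "\<And>e. e > 0 \<Longrightarrow> \<exists>k. \<forall>m\<ge>k. \<forall>n\<ge>k. L.N (F m - F n) < e"
    have [measurable]: "F n \<in> borel_measurable M" for n using F[of n] by (auto simp: L2_fun_def)
    have Fd: "F m - F n \<in> L2_fun K M" for m n using F by auto
    have N_eq: "L.N (F m - F n) = sqrt (LINT x|M. (cmod (F m x - F n x))\<^sup>2)" for m n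
      by (simp add: L.N_def L2_ip_self)
    have "\<exists>k. \<forall>i\<ge>k. \<forall>j\<ge>k. (LINT x|M. norm (F i x - F j x)) < e" if e: "e > 0" for e
    proof -
      let ?c = "sqrt (measure M (space M))"
      have c: "?c + 1 > 0" by (simp add: add_nonneg_pos)
      then obtain k where k: "\<And>m n. m \<ge> k \<Longrightarrow> n \<ge> k \<Longrightarrow> L.N (F m - F n) < e / (?c + 1)"
        using Cau[of "e / (?c + 1)"] e by auto
      have "(LINT x|M. norm (F i x - F j x)) < e" if "i \<ge> k" "j \<ge> k" for i j
      proof -
        have "(LINT x|M. norm (F i x - F j x)) \<le> ?c * L.N (F i - F j)"
          using L2_L1_bound(2)[OF M Fd, of i j] by (simp add: N_eq)
        also have "\<dots> \<le> ?c * (e / (?c + 1))" using k[OF that] by (intro mult_left_mono) auto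
        also have "\<dots> < e" using c e by (simp add: field_simps)
        finally show ?thesis .
      qed
      then show ?thesis by blast
    qed
    then obtain \<sigma> where \<sigma>: "strict_mono \<sigma>" "AE x in M. Cauchy (\<lambda>i. F (\<sigma> i) x)"
      using cauchy_L1_AE_cauchy_subseq[of M F] L2_L1_bound(1)[OF M F] by blast
    \<comment> \<open>The value \<open>0\<close> on the exceptional null set keeps \<open>f\<close> measurable and
      \<open>K\<close>-valued.\<close>
    define f where "f x = (if Cauchy (\<lambda>i. F (\<sigma> i) x) then lim (\<lambda>i. F (\<sigma> i) x) else 0)" for x
    have [measurable]: "f \<in> borel_measurable M" unfolding f_def by measurable
    have conv: "AE x in M. (\<lambda>i. F (\<sigma> i) x) \<longlonglongrightarrow> f x"
      using \<sigma>(2) by eventually_elim (simp add: f_def Cauchy_convergent_iff convergent_LIMSEQ_iff)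
    have fK: "f x \<in> K" if "x \<in> space M" for x
    proof (cases "Cauchy (\<lambda>i. F (\<sigma> i) x)")
      case True
      then have "(\<lambda>i. F (\<sigma> i) x) \<longlonglongrightarrow> f x" by (simp add: f_def Cauchy_convergent_iff convergent_LIMSEQ_iff)
      moreover have "F (\<sigma> i) x \<in> K" for i using F[of "\<sigma> i"] that by (auto simp: L2_fun_def)
      ultimately show ?thesis using closed_sequentially[OF K_closed_ops(11)[OF K], of "\<lambda>i. F (\<sigma> i) x"] by simp
    qed (use K_closed_ops(1)[OF K] in \<open>simp add: f_def\<close>)
    have fatou: "(\<integral>\<^sup>+x. ennreal ((cmod (F n x - f x))\<^sup>2) \<partial>M) \<le> ennreal (e\<^sup>2)"
      if k: "\<forall>m\<ge>k. \<forall>n\<ge>k. L.N (F m - F n) < e" and n: "n \<ge> k" for n k e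
    proof -
      have e0: "0 < e" using k L.N_nonneg[OF Fd, of k k] by (meson le_less_trans order_refl)
      have "(\<integral>\<^sup>+x. ennreal ((cmod (F n x - f x))\<^sup>2) \<partial>M)
          = (\<integral>\<^sup>+x. liminf (\<lambda>i. ennreal ((cmod (F n x - F (\<sigma> i) x))\<^sup>2)) \<partial>M)"
      proof (rule nn_integral_cong_AE, use conv in eventually_elim)
        fix x assume "(\<lambda>i. F (\<sigma> i) x) \<longlonglongrightarrow> f x"
        then have "(\<lambda>i. ennreal ((cmod (F n x - F (\<sigma> i) x))\<^sup>2)) \<longlonglongrightarrow> ennreal ((cmod (F n x - f x))\<^sup>2)"
          by (intro tendsto_intros)
        then show "ennreal ((cmod (F n x - f x))\<^sup>2) = liminf (\<lambda>i. ennreal ((cmod (F n x - F (\<sigma> i) x))\<^sup>2))"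
          by (rule lim_imp_Liminf[OF sequentially_bot, symmetric])
      qed
      also have "\<dots> \<le> liminf (\<lambda>i. \<integral>\<^sup>+x. ennreal ((cmod (F n x - F (\<sigma> i) x))\<^sup>2) \<partial>M)"
        by (rule nn_integral_liminf) measurable
      also have "\<dots> \<le> ennreal (e\<^sup>2)"
      proof (rule Liminf_le)
        have "(\<integral>\<^sup>+x. ennreal ((cmod (F n x - F (\<sigma> i) x))\<^sup>2) \<partial>M) \<le> ennreal (e\<^sup>2)" if i: "i \<ge> k" for i
        proof -
          have "\<sigma> i \<ge> k" using seq_suble[OF \<sigma>(1), of i] i by simp
          then have "L.N (F n - F (\<sigma> i)) < e" using k n by blast
          then have "(L.N (F n - F (\<sigma> i)))\<^sup>2 \<le> e\<^sup>2" using Fd by (intro power_mono) auto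
          moreover have "integrable M (\<lambda>x. (cmod (F n x - F (\<sigma> i) x))\<^sup>2)"
            using Fd[of n "\<sigma> i"] by (simp add: L2_fun_def)
          ultimately show ?thesis
            by (subst nn_integral_eq_integral) (auto simp: N_eq intro!: ennreal_leI)
        qed
        then show "\<forall>\<^sub>F i in sequentially. (\<integral>\<^sup>+x. ennreal ((cmod (F n x - F (\<sigma> i) x))\<^sup>2) \<partial>M) \<le> ennreal (e\<^sup>2)"
          by (auto simp: eventually_sequentially)
      qed simp
      finally show ?thesis .
    qed
    have sq: "F n - f \<in> L2_fun K M \<and> L.N (F n - f) \<le> e"
      if k: "\<forall>m\<ge>k. \<forall>n\<ge>k. L.N (F m - F n) < e" and n: "n \<ge> k" for n k e
    proof -
      have e0: "0 < e" using k L.N_nonneg[OF Fd, of k k] by (meson le_less_trans order_refl)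
      have fat: "(\<integral>\<^sup>+x. ennreal ((cmod (F n x - f x))\<^sup>2) \<partial>M) \<le> ennreal (e\<^sup>2)"
        by (rule fatou[OF k n])
      have int: "integrable M (\<lambda>x. (cmod (F n x - f x))\<^sup>2)"
      proof (rule integrableI_bounded)
        show "(\<integral>\<^sup>+x. ennreal (norm ((cmod (F n x - f x))\<^sup>2)) \<partial>M) < \<infinity>"
          using le_less_trans[OF fat, of \<infinity>] by simp
      qed measurable
      have "ennreal (LINT x|M. (cmod (F n x - f x))\<^sup>2) \<le> ennreal (e\<^sup>2)"
        using fat by (subst (asm) nn_integral_eq_integral[OF int]) auto
      then have "(LINT x|M. (cmod (F n x - f x))\<^sup>2) \<le> e\<^sup>2" by simp
      then have "sqrt (LINT x|M. (cmod (F n x - f x))\<^sup>2) \<le> e" using e0 by (intro real_le_lsqrt) auto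
      moreover have "F n - f \<in> L2_fun K M"
        unfolding L2_fun_def mem_Collect_eq
      proof (intro conjI ballI)
        show "F n - f \<in> borel_measurable M" unfolding fun_diff_def by measurable
        show "(F n - f) x \<in> K" if "x \<in> space M" for x
          using K_closed_ops(4)[OF K, of "F n x" "f x"] fK[OF that] F[of n] that by (simp add: L2_fun_def)
        show "integrable M (\<lambda>x. (cmod ((F n - f) x))\<^sup>2)" unfolding minus_apply by (rule int)
      qed
      moreover have "L.N (F n - f) = sqrt (LINT x|M. (cmod (F n x - f x))\<^sup>2)"
        unfolding L.N_def L2_ip_self fun_diff_def ..
      ultimately show ?thesis by metis
    qed
    obtain k where k: "\<forall>m\<ge>k. \<forall>n\<ge>k. L.N (F m - F n) < 1" by (rule exE[OF Cau[OF zero_less_one]])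
    have fL: "f \<in> L2_fun K M"
    proof -
      have "F k - f \<in> L2_fun K M" by (rule conjunct1[OF sq[OF k order_refl]])
      then have "F k - (F k - f) \<in> L2_fun K M" by (rule L.closed_ops(3)[OF F])
      moreover have "F k - (F k - f) = f" by (rule ext) (simp only: minus_apply diff_diff_eq2 add_diff_cancel_left')
      ultimately show ?thesis by (rule back_subst)
    qed
    show "\<exists>f\<in>L2_fun K M. (\<lambda>n. L.N (F n - f)) \<longlonglongrightarrow> 0"
    proof (rule bexI[OF _ fL], rule LIMSEQ_I)
      fix e :: real assume e: "e > 0"
      obtain k where k: "\<forall>m\<ge>k. \<forall>n\<ge>k. L.N (F m - F n) < e/2" by (rule exE[OF Cau[OF half_gt_zero[OF e]]])
      show "\<exists>no. \<forall>n\<ge>no. norm (L.N (F n - f) - 0) < e"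
      proof (intro exI[of _ k] allI impI)
        fix n assume "k \<le> n"
        then have "L.N (F n - f) \<le> e/2" by (rule conjunct2[OF sq[OF k]])
        moreover have "0 \<le> L.N (F n - f)" by (rule L.N_nonneg[OF L.closed_ops(3)[OF F fL]])
        moreover have "norm (a - 0) < e" if "a \<le> e/2" "0 \<le> a" for a :: real using that e by simp
        ultimately show "norm (L.N (F n - f) - 0) < e" by blast
      qed
    qed
  qed
qed


section \<open>Weak derivatives of continuous functions\<close>

lemma finite_measure_Ioo: "finite_measure (lebesgue_Ioo a b)"
proof
  have "emeasure lborel {a<..<b} \<le> emeasure lborel {a..b}" by (rule emeasure_mono) auto
  also have "\<dots> < \<infinity>" by (cases "a \<le> b") auto
  finally show "emeasure (lebesgue_Ioo a b) (space (lebesgue_Ioo a b)) \<noteq> \<infinity>"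
    by (simp add: emeasure_restrict_space space_restrict_space)
qed

lemma Ioo_integral:
  fixes f :: "real \<Rightarrow> 'c::{banach, second_countable_topology}"
  shows "(LINT x|lebesgue_Ioo a b. f x) = (LINT x|lborel. indicator {a<..<b} x *\<^sub>R f x)"
  by (rule integral_restrict_space) auto

lemma Ioo_measurable: "f \<in> borel_measurable borel \<Longrightarrow> f \<in> borel_measurable (lebesgue_Ioo a b)"
  by (rule measurable_restrict_space1) simp

text \<open>Half-open intervals make this integral exactly additive over adjacent intervals.\<close>

definition J :: "real \<Rightarrow> real \<Rightarrow> (real \<Rightarrow> 'c::{banach, second_countable_topology}) \<Rightarrow> real \<Rightarrow> real \<Rightarrow> 'c" where
  "J a b h x y = (LINT t|lebesgue_Ioo a b. indicator {x..<y} t *\<^sub>R h t)"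

lemma J_integrable:
  fixes h :: "real \<Rightarrow> 'c::{banach, second_countable_topology}"
  assumes "integrable (lebesgue_Ioo a b) h"
  shows "integrable (lebesgue_Ioo a b) (\<lambda>t. indicator {x..<y} t *\<^sub>R h t)"
proof (rule Bochner_Integration.integrable_bound[OF assms])
  show "(\<lambda>t. indicator {x..<y} t *\<^sub>R h t) \<in> borel_measurable (lebesgue_Ioo a b)"
    by (rule borel_measurable_scaleR[OF Ioo_measurable borel_measurable_integrable[OF assms]]) simp
qed (auto simp: indicator_def)

lemma J_add:
  assumes h: "integrable (lebesgue_Ioo a b) h" and "x \<le> y" "y \<le> z"
  shows "J a b h x y + J a b h y z = J a b h x z"
proof -
  have "J a b h x y + J a b h y z
      = (LINT t|lebesgue_Ioo a b. indicator {x..<y} t *\<^sub>R h t + indicator {y..<z} t *\<^sub>R h t)"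
    unfolding J_def by (rule Bochner_Integration.integral_add[symmetric]) (intro J_integrable h)+
  also have "(\<lambda>t. indicator {x..<y} t *\<^sub>R h t + indicator {y..<z} t *\<^sub>R h t) = (\<lambda>t. indicator {x..<z} t *\<^sub>R h t)"
    using assms by (auto simp: indicator_def)
  finally show ?thesis by (simp add: J_def)
qed

lemma J_continuous:
  fixes F :: "real \<Rightarrow> 'c::euclidean_space"
  assumes pq: "a \<le> p" "p \<le> q" "q \<le> b" and F: "continuous_on {p..q} F"
  shows "J a b F p q = integral {p..q} F"
proof -
  have s: "set_integrable lborel {p..q} F" by (rule borel_integrable_atLeastAtMost'[OF F])
  then have [measurable]: "(\<lambda>t. indicator {p..q} t *\<^sub>R F t) \<in> borel_measurable lborel"
    by (auto simp: set_integrable_def)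
  have "J a b F p q = (LINT t|lborel. indicator {a<..<b} t *\<^sub>R (indicator {p..<q} t *\<^sub>R (indicator {p..q} t *\<^sub>R F t)))"
    unfolding J_def Ioo_integral by (rule Bochner_Integration.integral_cong) (auto simp: indicator_def)
  also have "\<dots> = (LINT t|lborel. indicator {p..q} t *\<^sub>R F t)"
  proof (rule integral_cong_AE)
    show "AE t in lborel. indicator {a<..<b} t *\<^sub>R (indicator {p..<q} t *\<^sub>R (indicator {p..q} t *\<^sub>R F t)) = indicator {p..q} t *\<^sub>R F t"
      using AE_lborel_singleton[of p] AE_lborel_singleton[of q]
      by eventually_elim (use pq in \<open>auto simp: indicator_def\<close>)
  qed measurable
  also have "\<dots> = integral {p..q} F"
    using set_borel_integral_eq_integral(2)[OF s] by (simp add: set_lebesgue_integral_def)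
  finally show ?thesis .
qed

text \<open>
  The test functions of class \<open>C\<^sup>1\<close> used below are assembled from this
  truncated square. Its halved second difference \<open>smooth_step\<close> rises from
  \<open>0\<close> to \<open>1\<close> on \<open>{0..2}\<close>, and the derivative is the
  piecewise linear function \<open>hat\<close>.
\<close>

definition pp :: "real \<Rightarrow> real" where "pp u = (max 0 u)\<^sup>2"

lemma pp_deriv: "(pp has_real_derivative 2 * max 0 u) (at u)"
proof (cases "u = 0")
  case True
  have "((\<lambda>y. pp y / y) \<longlongrightarrow> 0) (at 0)"
  proof (rule Lim_null_comparison)
    show "\<forall>\<^sub>F y in at 0. norm (pp y / y) \<le> \<bar>y\<bar>"
      by (auto simp: pp_def max_def power2_eq_square intro!: always_eventually)
    show "((\<lambda>y::real. \<bar>y\<bar>) \<longlongrightarrow> 0) (at 0)" by (rule tendsto_eq_intros | simp)+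
  qed
  then show ?thesis using True by (simp add: has_field_derivative_iff pp_def)
next
  case False
  show ?thesis
  proof (cases "u > 0")
    case True
    have "((\<lambda>u. u\<^sup>2) has_real_derivative 2 * u) (at u)" by (auto intro!: derivative_eq_intros)
    then have "(pp has_real_derivative 2 * u) (at u)"
      by (rule DERIV_cong_ev[THEN iffD1, OF refl _ refl, rotated])
         (use True in \<open>auto simp: pp_def eventually_nhds intro!: exI[of _ "{0<..}"]\<close>)
    then show ?thesis using True by simp
  next
    case f2: False
    have "((\<lambda>u. 0) has_real_derivative 0) (at u)" by (auto intro!: derivative_eq_intros)
    then have "(pp has_real_derivative 0) (at u)"
      by (rule DERIV_cong_ev[THEN iffD1, OF refl _ refl, rotated])
         (use False f2 in \<open>auto simp: pp_def eventually_nhds intro!: exI[of _ "{..<0}"]\<close>)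
    then show ?thesis using False f2 by (simp add: max_def)
  qed
qed

definition smooth_step :: "real \<Rightarrow> real" where "smooth_step u = (pp u - 2 * pp (u - 1) + pp (u - 2)) / 2"
definition hat :: "real \<Rightarrow> real" where "hat u = max 0 u - 2 * max 0 (u - 1) + max 0 (u - 2)"

lemma smooth_step_deriv: "(smooth_step has_real_derivative hat u) (at u)"
proof -
  have sh: "((\<lambda>u. pp (u - c)) has_real_derivative 2 * max 0 (u - c)) (at u)" for c
  proof -
    have "((\<lambda>u. u - c) has_real_derivative 1) (at u)" by (auto intro!: derivative_eq_intros)
    from DERIV_chain2[where f=pp and g="\<lambda>u. u - c", OF pp_deriv this] show ?thesis by simp
  qed
  show ?thesis
    unfolding smooth_step_def[abs_def] hat_def
    by (rule derivative_eq_intros sh pp_deriv sh[of 0, simplified] | simp)+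
qed

lemma hat_bounds: "0 \<le> hat u" "u \<le> 0 \<Longrightarrow> hat u = 0" "2 \<le> u \<Longrightarrow> hat u = 0"
  by (auto simp: hat_def max_def)

lemma smooth_step_eq: "u \<le> 0 \<Longrightarrow> smooth_step u = 0" "2 \<le> u \<Longrightarrow> smooth_step u = 1"
  by (auto simp: smooth_step_def pp_def max_def power2_eq_square algebra_simps)

lemma smooth_step_bounds: "0 \<le> smooth_step u" "smooth_step u \<le> 1"
proof -
  have mono: "smooth_step u \<le> smooth_step v" if "u \<le> v" for u v
    using DERIV_nonneg_imp_nondecreasing[OF that] smooth_step_deriv hat_bounds(1) by blast
  show "0 \<le> smooth_step u" using mono[of "min 0 u" u] smooth_step_eq(1)[of "min 0 u"] by simp
  show "smooth_step u \<le> 1" using mono[of u "max 2 u"] smooth_step_eq(2)[of "max 2 u"] by simp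
qed

lemma hat_continuous [continuous_intros]: "continuous_on S f \<Longrightarrow> continuous_on S (\<lambda>x. hat (f x))"
  unfolding hat_def by (intro continuous_intros)

text \<open>
  The rescaled hat has integral \<open>1\<close>, and so integrating against it is taking a
  mean.
\<close>

lemma hat_average:
  assumes p: "a \<le> p" "p + 2 * d \<le> b" and d: "0 < d" and g: "continuous_on {a..b} g"
    and near: "\<And>t. t \<in> {p..p + 2 * d} \<Longrightarrow> cmod (g t - c) \<le> \<eta>"
  shows "cmod ((LINT t|lebesgue_Ioo a b. g t * complex_of_real (hat ((t - p) / d) / d)) - c) \<le> \<eta>"
    and "integrable (lebesgue_Ioo a b) (\<lambda>t. g t * complex_of_real (hat ((t - p) / d) / d))"
proof -
  let ?k = "\<lambda>t. hat ((t - p) / d) / d"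
  let ?q = "p + 2 * d"
  have k0: "0 \<le> ?k t" for t using hat_bounds(1) d by simp
  have kz: "?k t = 0" if "t \<notin> {p..<?q}" for t
    using that d hat_bounds(2,3)[of "(t - p) / d"] by (auto simp: field_simps)
  have kc: "continuous_on S ?k" for S using d by (intro continuous_intros) auto
  have gk: "continuous_on {p..?q} (\<lambda>t. g t * complex_of_real (?k t))"
    using p by (intro continuous_intros kc continuous_on_subset[OF g]) auto
  have eq: "(\<lambda>t. g t * complex_of_real (?k t)) = (\<lambda>t. indicator {p..<?q} t *\<^sub>R (g t * complex_of_real (?k t)))"
    using kz by (auto simp: indicator_def fun_eq_iff)
  have "(LINT t|lebesgue_Ioo a b. g t * complex_of_real (?k t)) = J a b (\<lambda>t. g t * complex_of_real (?k t)) p ?q"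
    unfolding J_def by (rule arg_cong[OF eq])
  also have "\<dots> = integral {p..?q} (\<lambda>t. g t * complex_of_real (?k t))"
    using p d by (intro J_continuous gk) auto
  finally have 1: "(LINT t|lebesgue_Ioo a b. g t * complex_of_real (?k t)) = integral {p..?q} (\<lambda>t. g t * complex_of_real (?k t))" .
  have "((\<lambda>t. smooth_step ((t - p) / d)) has_vector_derivative ?k t) (at t within {p..?q})" for t
  proof -
    have "((\<lambda>t. smooth_step ((t - p) / d)) has_real_derivative hat ((t - p) / d) * (1 / d)) (at t within {p..?q})"
      by (rule DERIV_chain2[where f=smooth_step and g="\<lambda>t. (t - p) / d", OF smooth_step_deriv])
         (use d in \<open>auto intro!: derivative_eq_intros\<close>)
    then show ?thesis by (simp add: has_real_derivative_iff_has_vector_derivative)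
  qed
  then have "(?k has_integral smooth_step ((?q - p) / d) - smooth_step ((p - p) / d)) {p..?q}"
    using d by (intro fundamental_theorem_of_calculus) auto
  then have k1: "(?k has_integral 1) {p..?q}" using d by (simp add: smooth_step_eq)
  have kint: "integral {p..?q} (\<lambda>t. c * complex_of_real (?k t)) = c"
    by (rule integral_unique)
       (use has_integral_mult_right[OF has_integral_of_real[OF k1], of c] in \<open>simp only: of_real_1 mult_1_right\<close>)
  have "integral {p..?q} (\<lambda>t. g t * complex_of_real (?k t)) - c
      = integral {p..?q} (\<lambda>t. g t * complex_of_real (?k t)) - integral {p..?q} (\<lambda>t. c * complex_of_real (?k t))"
    by (simp only: kint)
  also have "\<dots> = integral {p..?q} (\<lambda>t. (g t - c) * complex_of_real (?k t))"
    unfolding left_diff_distrib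
    by (rule Henstock_Kurzweil_Integration.integral_diff[symmetric])
       (intro integrable_continuous_interval gk continuous_intros kc)+
  also have "cmod \<dots> \<le> integral {p..?q} (\<lambda>t. \<eta> * ?k t)"
  proof (rule integral_norm_bound_integral)
    show "(\<lambda>t. (g t - c) * complex_of_real (?k t)) integrable_on {p..?q}"
      using p by (intro integrable_continuous_interval continuous_intros kc continuous_on_subset[OF g]) auto
    show "(\<lambda>t. \<eta> * ?k t) integrable_on {p..?q}"
      by (intro integrable_continuous_interval continuous_intros kc)
    show "cmod ((g t - c) * complex_of_real (?k t)) \<le> \<eta> * ?k t" if "t \<in> {p..?q}" for t
      using mult_right_mono[OF near[OF that] k0[of t]] by (simp only: norm_mult norm_of_real abs_of_nonneg[OF k0])
  qed
  also have "\<dots> = \<eta>"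
    by (rule integral_unique) (use has_integral_mult_right[OF k1, of \<eta>] in \<open>simp only: mult_1_right\<close>)
  finally show "cmod ((LINT t|lebesgue_Ioo a b. g t * complex_of_real (?k t)) - c) \<le> \<eta>" by (simp only: 1)
  have "set_integrable lborel {p..?q} (\<lambda>t. g t * complex_of_real (?k t))"
    by (rule borel_integrable_atLeastAtMost'[OF gk])
  moreover have "indicator {p..?q} t *\<^sub>R (g t * complex_of_real (?k t)) = g t * complex_of_real (?k t)" for t
    using kz[of t] by (cases "t \<in> {p..<?q}") auto
  ultimately have "integrable lborel (\<lambda>t. g t * complex_of_real (?k t))" by (simp add: set_integrable_def)
  then show "integrable (lebesgue_Ioo a b) (\<lambda>t. g t * complex_of_real (?k t))"
    by (intro integrable_restrict_space[THEN iffD2]) (auto intro: integrable_mult_indicator)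
qed


lemma hat_average_tendsto:
  fixes g :: "real \<Rightarrow> complex"
  assumes g: "continuous_on {a..b} g" and c: "c \<in> {a..b}"
    and d: "\<And>n::nat. 0 < d n" "d \<longlonglongrightarrow> 0"
    and p: "\<And>n. a \<le> p n" "\<And>n. p n + 2 * d n \<le> b" "\<And>n. c - 3 * d n \<le> p n" "\<And>n. p n \<le> c + d n"
  shows "(\<lambda>n. LINT t|lebesgue_Ioo a b. g t * complex_of_real (hat ((t - p n) / d n) / d n)) \<longlonglongrightarrow> g c"
proof (rule LIMSEQ_I)
  fix e :: real assume e: "0 < e"
  obtain \<delta> where \<delta>: "\<delta> > 0" "\<And>t. \<lbrakk>t \<in> {a..b}; dist t c < \<delta>\<rbrakk> \<Longrightarrow> dist (g t) (g c) < e/2"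
    using g c half_gt_zero[OF e] unfolding continuous_on_iff by metis
  obtain n0 where n0: "\<And>n. n \<ge> n0 \<Longrightarrow> norm (d n - 0) < \<delta> / 3"
    using LIMSEQ_D[OF d(2), of "\<delta>/3"] \<delta>(1) by auto
  have "norm ((LINT t|lebesgue_Ioo a b. g t * complex_of_real (hat ((t - p n) / d n) / d n)) - g c) < e" if n: "n \<ge> n0" for n
  proof -
    have dn: "d n < \<delta> / 3" using n0[OF n] by simp
    have "cmod ((LINT t|lebesgue_Ioo a b. g t * complex_of_real (hat ((t - p n) / d n) / d n)) - g c) \<le> e/2"
    proof (rule hat_average(1)[OF p(1,2) d(1) g])
      fix t assume t: "t \<in> {p n..p n + 2 * d n}"
      have "dist t c < \<delta>" using t p(3,4)[of n] dn unfolding dist_real_def by auto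
      moreover have "t \<in> {a..b}" using t p(1,2)[of n] by auto
      ultimately show "cmod (g t - g c) \<le> e/2" using \<delta>(2)[of t] by (simp add: dist_norm)
    qed
    then show ?thesis using e by simp
  qed
  then show "\<exists>no. \<forall>n\<ge>no. norm ((LINT t|lebesgue_Ioo a b. g t * complex_of_real (hat ((t - p n) / d n) / d n)) - g c) < e"
    by blast
qed

text \<open>
  A \<open>C\<^sup>1\<close> function that rises from \<open>0\<close> to \<open>1\<close> on
  \<open>{x + d..x + 3 d}\<close> and descends again on \<open>{y - 3 d..y - d}\<close>. As
  \<open>d \<rightarrow> 0\<close> it approximates the indicator function of
  \<open>{x<..<y}\<close>; keeping the distance \<open>d\<close> from \<open>x\<close> and
  \<open>y\<close> makes its support compact even if these are the ends of the interval.
\<close>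

lemma trapezoid_test_fun:
  assumes x: "a \<le> x" "y \<le> b" and d: "0 < d" "6 * d \<le> y - x"
  defines "\<phi> \<equiv> \<lambda>t. smooth_step ((t - (x + d)) / d) - smooth_step ((t - (y - 3 * d)) / d)"
  shows "\<phi> \<in> test_fun a b"
    and "deriv \<phi> t = hat ((t - (x + d)) / d) / d - hat ((t - (y - 3 * d)) / d) / d"
proof -
  have D: "((\<lambda>t. smooth_step ((t - c) / d)) has_real_derivative hat ((t - c) / d) / d) (at t)" for c t
  proof -
    have "((\<lambda>t. (t - c) / d) has_real_derivative 1 / d) (at t)"
      using d by (auto intro!: derivative_eq_intros)
    from DERIV_chain2[where f=smooth_step and g="\<lambda>t. (t - c) / d", OF smooth_step_deriv this]
    show ?thesis by simp
  qed
  have D\<phi>: "(\<phi> has_real_derivative (hat ((t - (x + d)) / d) / d - hat ((t - (y - 3 * d)) / d) / d)) (at t)" for t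
    unfolding \<phi>_def by (intro DERIV_diff D)
  then show "deriv \<phi> t = hat ((t - (x + d)) / d) / d - hat ((t - (y - 3 * d)) / d) / d"
    by (rule DERIV_imp_deriv)
  have "\<phi> C1_differentiable_on UNIV"
    unfolding C1_differentiable_on_def
  proof (intro exI conjI ballI)
    show "(\<phi> has_vector_derivative (hat ((t - (x + d)) / d) / d - hat ((t - (y - 3 * d)) / d) / d)) (at t)" for t
      using D\<phi> by (simp add: has_real_derivative_iff_has_vector_derivative)
    show "continuous_on UNIV (\<lambda>t. hat ((t - (x + d)) / d) / d - hat ((t - (y - 3 * d)) / d) / d)"
      using d by (intro continuous_intros) auto
  qed
  moreover have "\<phi> t = 0" if "t \<notin> {x + d..y - d}" for t
  proof (cases "t < x + d")
    case True
    then have "(t - (x + d)) / d \<le> 0" "(t - (y - 3 * d)) / d \<le> 0"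
      using d by (auto intro!: divide_nonpos_pos)
    then show ?thesis by (simp add: \<phi>_def smooth_step_eq)
  next
    case False
    then have "2 \<le> (t - (x + d)) / d" "2 \<le> (t - (y - 3 * d)) / d"
      using d that by (auto simp: field_simps)
    then show ?thesis by (simp add: \<phi>_def smooth_step_eq)
  qed
  moreover have "{x + d..y - d} \<subseteq> {a<..<b}" using x d by auto
  ultimately show "\<phi> \<in> test_fun a b" unfolding test_fun_def by (auto intro!: exI[of _ "{x + d..y - d}"])
qed

text \<open>
  Testing with the trapezoids of slope width \<open>d n \<rightarrow> 0\<close>: the left-hand
  side of the definition of the weak derivative converges to \<open>g x - g y\<close> by
  continuity, the right-hand side by dominated convergence.
\<close>

theorem weak_derivative_FTC:
  assumes g: "continuous_on {a..b} g" and h: "integrable (lebesgue_Ioo a b) h"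
    and wd: "has_weak_deriv a b g h" and xy: "a \<le> x" "x \<le> y" "y \<le> b"
  shows "J a b h x y = g y - g x"
proof (cases "x = y")
  case True
  then show ?thesis by (simp add: J_def)
next
  case False
  then have lt: "x < y" using xy by simp
  define d where "d n = (y - x) / (6 * real (Suc n))" for n
  have d0: "0 < d n" for n using lt by (simp add: d_def)
  have d6: "6 * d n \<le> y - x" for n
  proof -
    have "(y - x) / real (Suc n) \<le> (y - x) / 1" using lt by (intro divide_left_mono) auto
    moreover have "6 * d n = (y - x) / real (Suc n)" unfolding d_def by (simp add: field_simps)
    ultimately show ?thesis by simp
  qed
  have dlim: "d \<longlonglongrightarrow> 0" unfolding d_def by real_asymp
  define \<phi> where "\<phi> n t = smooth_step ((t - (x + d n)) / d n) - smooth_step ((t - (y - 3 * d n)) / d n)" for n t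
  have test: "\<phi> n \<in> test_fun a b" for n
    using trapezoid_test_fun(1)[OF xy(1,3) d0 d6] unfolding \<phi>_def[abs_def] .
  have der: "deriv (\<phi> n) t = hat ((t - (x + d n)) / d n) / d n - hat ((t - (y - 3 * d n)) / d n) / d n" for n t
    using trapezoid_test_fun(2)[OF xy(1,3) d0 d6] unfolding \<phi>_def[abs_def] .
  define A where "A n = (LINT t|lebesgue_Ioo a b. g t * complex_of_real (hat ((t - (x + d n)) / d n) / d n))" for n
  define B where "B n = (LINT t|lebesgue_Ioo a b. g t * complex_of_real (hat ((t - (y - 3 * d n)) / d n) / d n))" for n
  have rng: "a \<le> x + d n" "x + d n + 2 * d n \<le> b" "a \<le> y - 3 * d n" "y - 3 * d n + 2 * d n \<le> b" for n
    using xy d0[of n] d6[of n] by auto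
  have Alim: "A \<longlonglongrightarrow> g x" unfolding A_def
  proof (rule hat_average_tendsto[OF g _ d0 dlim rng(1,2)])
    show "x - 3 * d n \<le> x + d n" for n using d0[of n] by simp
  qed (use xy in auto)
  have Blim: "B \<longlonglongrightarrow> g y" unfolding B_def
  proof (rule hat_average_tendsto[OF g _ d0 dlim rng(3,4)])
    show "y - 3 * d n \<le> y + d n" for n using d0[of n] by simp
  qed (use xy in auto)
  have "bounded (g ` {a..b})" by (intro compact_imp_bounded compact_continuous_image g compact_Icc)
  then obtain Gm where "\<forall>z\<in>g ` {a..b}. norm z \<le> Gm" unfolding bounded_iff by blast
  then have Gb: "cmod (g t - 0) \<le> Gm" if "t \<in> {a..b}" for t using that by simp
  have "(LINT t|lebesgue_Ioo a b. g t * complex_of_real (deriv (\<phi> n) t)) = A n - B n" for n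
    unfolding der of_real_diff right_diff_distrib A_def B_def
    by (intro Bochner_Integration.integral_diff hat_average(2)[OF rng(1,2) d0 g, where c=0 and \<eta>=Gm]
        hat_average(2)[OF rng(3,4) d0 g, where c=0 and \<eta>=Gm] Gb)
       (use rng[of n] in auto)
  then have eq: "A n - B n = - (LINT t|lebesgue_Ioo a b. h t * complex_of_real (\<phi> n t))" for n
    using wd test unfolding has_weak_deriv_def by metis
  have bd: "\<bar>\<phi> n t\<bar> \<le> 1" for n t
    using smooth_step_bounds[of "(t - (x + d n)) / d n"] smooth_step_bounds[of "(t - (y - 3 * d n)) / d n"]
    unfolding \<phi>_def by linarith
  have \<phi>lim: "(\<lambda>n. \<phi> n t) \<longlonglongrightarrow> indicator {x<..<y} t" for t
  proof -
    consider "t \<le> x" | "t \<ge> y" | "x < t" "t < y" by linarith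
    then have "\<forall>\<^sub>F n in sequentially. \<phi> n t = indicator {x<..<y} t"
    proof cases
      case 1
      have "\<phi> n t = 0" for n
      proof -
        have "(t - (x + d n)) / d n \<le> 0" "(t - (y - 3 * d n)) / d n \<le> 0"
          using 1 d0[of n] d6[of n] by (auto intro!: divide_nonpos_pos)
        then show ?thesis by (simp add: \<phi>_def smooth_step_eq)
      qed
      then show ?thesis using 1 by simp
    next
      case 2
      have "\<phi> n t = 0" for n
      proof -
        have "2 \<le> (t - (x + d n)) / d n" "2 \<le> (t - (y - 3 * d n)) / d n"
          using 2 d0[of n] d6[of n] by (auto simp: field_simps)
        then show ?thesis by (simp add: \<phi>_def smooth_step_eq)
      qed
      then show ?thesis using 2 by simp
    next
      case 3
      define m where "m = min (t - x) (y - t) / 3"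
      have "m > 0" using 3 by (simp add: m_def)
      then have "\<forall>\<^sub>F n in sequentially. d n < m" using order_tendstoD(2)[OF dlim] by blast
      then show ?thesis
      proof eventually_elim
        case (elim n)
        have "3 * d n < t - x" "3 * d n < y - t" using elim by (auto simp: m_def)
        then have "2 \<le> (t - (x + d n)) / d n" "(t - (y - 3 * d n)) / d n \<le> 0"
          using d0[of n] by (auto simp: field_simps)
        then show ?case using 3 by (simp add: \<phi>_def smooth_step_eq)
      qed
    qed
    then show ?thesis by (rule tendsto_eventually)
  qed
  have hm: "h \<in> borel_measurable (lebesgue_Ioo a b)" using h by auto
  have lim: "(\<lambda>n. LINT t|lebesgue_Ioo a b. h t * complex_of_real (\<phi> n t))
     \<longlonglongrightarrow> (LINT t|lebesgue_Ioo a b. h t * complex_of_real (indicator {x<..<y} t))"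
  proof (rule integral_dominated_convergence[where w="\<lambda>t. cmod (h t)"])
    show "(\<lambda>t. h t * complex_of_real (indicator {x<..<y} t)) \<in> borel_measurable (lebesgue_Ioo a b)"
      by (intro borel_measurable_times hm Ioo_measurable) simp
    show "(\<lambda>t. h t * complex_of_real (\<phi> n t)) \<in> borel_measurable (lebesgue_Ioo a b)" for n
    proof (intro borel_measurable_times hm Ioo_measurable)
      have "\<phi> n C1_differentiable_on UNIV" using test[of n] by (simp add: test_fun_def)
      then have "continuous_on UNIV (\<phi> n)" by (rule C1_differentiable_imp_continuous_on)
      then have "\<phi> n \<in> borel_measurable borel" by (rule borel_measurable_continuous_onI)
      then show "(\<lambda>t. complex_of_real (\<phi> n t)) \<in> borel_measurable borel" by simp
    qed
    show "AE t in lebesgue_Ioo a b. (\<lambda>n. h t * complex_of_real (\<phi> n t)) \<longlonglongrightarrow> h t * complex_of_real (indicator {x<..<y} t)"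
      by (intro always_eventually allI tendsto_intros \<phi>lim)
    show "AE t in lebesgue_Ioo a b. cmod (h t * complex_of_real (\<phi> n t)) \<le> cmod (h t)" for n
      using bd by (auto simp: norm_mult mult_left_le)
  qed (use h in auto)
  have "(\<lambda>n. - (LINT t|lebesgue_Ioo a b. h t * complex_of_real (\<phi> n t))) \<longlonglongrightarrow> g x - g y"
    using tendsto_diff[OF Alim Blim] unfolding eq .
  then have "g x - g y = - (LINT t|lebesgue_Ioo a b. h t * complex_of_real (indicator {x<..<y} t))"
    using tendsto_minus[OF lim] LIMSEQ_unique by blast
  moreover have "J a b h x y = (LINT t|lebesgue_Ioo a b. h t * complex_of_real (indicator {x<..<y} t))"
    unfolding J_def
  proof (rule integral_cong_AE)
    have "AE t in lebesgue_Ioo a b. t \<noteq> x"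
      using AE_lborel_singleton[of x] by (subst AE_restrict_space_iff) auto
    then show "AE t in lebesgue_Ioo a b. indicator {x..<y} t *\<^sub>R h t = h t * complex_of_real (indicator {x<..<y} t)"
      by eventually_elim (auto simp: indicator_def)
    show "(\<lambda>t. indicator {x..<y} t *\<^sub>R h t) \<in> borel_measurable (lebesgue_Ioo a b)"
      using J_integrable[OF h] by auto
    show "(\<lambda>t. h t * complex_of_real (indicator {x<..<y} t)) \<in> borel_measurable (lebesgue_Ioo a b)"
      by (intro borel_measurable_times hm Ioo_measurable) simp
  qed
  ultimately show ?thesis by (simp add: algebra_simps)
qed

text \<open>
  The sets over which the integral vanishes form a Dynkin system that contains the half-lines,
  which generate the Borel sets.
\<close>

lemma J_zero_imp_AE_zero:
  assumes ab: "a \<le> b" and h: "integrable (lebesgue_Ioo a b) h"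
    and z: "\<And>y. \<lbrakk>a \<le> y; y \<le> b\<rbrakk> \<Longrightarrow> J a b h a y = 0"
  shows "AE t in lebesgue_Ioo a b. h t = 0"
proof -
  define k where "k t = indicator {a<..<b} t *\<^sub>R h t" for t
  have k: "integrable lborel k"
    using h unfolding k_def by (subst (asm) integrable_restrict_space) (auto simp: set_integrable_def)
  have "set_lebesgue_integral lborel A k = 0" if "A \<in> sets lborel" for A
  proof -
    have int: "set_integrable lborel A k" if "A \<in> sets borel" for A
      unfolding set_integrable_def using that k by (intro integrable_mult_indicator) auto
    have UN: "set_lebesgue_integral lborel UNIV k = 0"
    proof -
      have "set_lebesgue_integral lborel UNIV k = J a b h a b"
        unfolding set_lebesgue_integral_def J_def Ioo_integral k_def
        by (rule Bochner_Integration.integral_cong) (auto simp: indicator_def)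
      then show ?thesis using z[of b] ab by simp
    qed
    have "A \<in> sigma_sets UNIV (range (atMost :: real \<Rightarrow> real set))"
      using that by (simp add: borel_eq_atMost)
    have stable: "Int_stable (range (atMost :: real \<Rightarrow> real set))" by (auto simp: Int_stable_def)
    have "range (atMost :: real \<Rightarrow> real set) \<subseteq> Pow UNIV" by simp
    from stable this \<open>A \<in> sigma_sets UNIV (range atMost)\<close> show ?thesis
    proof (induction rule: sigma_sets_induct_disjoint)
      case (basic B)
      then obtain u where B: "B = {..u}" by auto
      define v where "v = max a (min u b)"
      have "set_lebesgue_integral lborel B k = J a b h a v"
        unfolding set_lebesgue_integral_def J_def Ioo_integral k_def B
      proof (rule integral_cong_AE)
        show "AE t in lborel. indicator {..u} t *\<^sub>R indicator {a<..<b} t *\<^sub>R h t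
            = indicator {a<..<b} t *\<^sub>R indicator {a..<v} t *\<^sub>R h t"
          using AE_lborel_singleton[of u] by eventually_elim (auto simp: indicator_def v_def)
        show "(\<lambda>t. indicator {..u} t *\<^sub>R indicator {a<..<b} t *\<^sub>R h t) \<in> borel_measurable lborel"
          using int[of "{..u}"] unfolding set_integrable_def k_def by auto
        have "(\<lambda>t. indicator {a..<v} t *\<^sub>R indicator {a<..<b} t *\<^sub>R h t) \<in> borel_measurable lborel"
          using int[of "{a..<v}"] unfolding set_integrable_def k_def by auto
        then show "(\<lambda>t. indicator {a<..<b} t *\<^sub>R indicator {a..<v} t *\<^sub>R h t) \<in> borel_measurable lborel"
          by (simp add: mult.commute)
      qed
      then show ?case using z[of v] ab by (simp add: v_def)
    next
      case empty
      show ?case by (simp add: set_lebesgue_integral_def)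
    next
      case (compl B)
      have Bm: "B \<in> sets borel" using compl(1) by (simp add: borel_eq_atMost)
      have "set_lebesgue_integral lborel (B \<union> (UNIV - B)) k
          = set_lebesgue_integral lborel B k + set_lebesgue_integral lborel (UNIV - B) k"
        using Bm by (intro set_integral_Un int) auto
      then show ?case using compl UN by simp
    next
      case (union B)
      have Bm: "B i \<in> sets borel" for i using union(2) by (auto simp: borel_eq_atMost)
      have "set_lebesgue_integral lborel (\<Union>i. B i) k = (\<Sum>i. set_lebesgue_integral lborel (B i) k)"
        using Bm union(1) by (intro lebesgue_integral_countable_add int) (auto simp: disjoint_family_on_def)
      then show ?case using union by simp
    qed
  qed
  then have "AE t in lborel. k t = 0" by (intro sigma_finite_measure.density_zero[OF sigma_finite_lborel] k)
  then show ?thesis by (subst AE_restrict_space_iff) (auto simp: k_def elim!: eventually_mono)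
qed


lemma J_cong:
  assumes "\<And>t. t \<in> {x..<y} \<Longrightarrow> f t = h t"
  shows "J a b f x y = J a b h x y"
  unfolding J_def using assms by (intro Bochner_Integration.integral_cong) (auto simp: indicator_def)

lemma J_full: "J a b f a b = (LINT t|lebesgue_Ioo a b. f t)"
  unfolding J_def by (rule Bochner_Integration.integral_cong) (auto simp: space_restrict_space)

lemma Ioo_integrable_continuous:
  assumes "continuous_on {a..b} (f :: real \<Rightarrow> complex)"
  shows "integrable (lebesgue_Ioo a b) f"
proof -
  have "set_integrable lborel {a..b} f" by (rule borel_integrable_atLeastAtMost'[OF assms])
  then have "set_integrable lborel {a<..<b} f" by (rule set_integrable_subset) auto
  then show ?thesis by (subst integrable_restrict_space) (auto simp: set_integrable_def)
qed

lemma test_fun_props: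
  assumes "\<phi> \<in> test_fun a b"
  obtains B where "0 \<le> B" "\<And>t. (\<phi> has_real_derivative deriv \<phi> t) (at t)" "continuous_on UNIV (deriv \<phi>)"
    "\<And>t. t \<in> {a..b} \<Longrightarrow> \<bar>deriv \<phi> t\<bar> \<le> B" "\<phi> a = 0" "\<phi> b = 0"
proof -
  obtain D where D: "\<And>t. (\<phi> has_vector_derivative D t) (at t)" "continuous_on UNIV D"
    using assms by (auto simp: test_fun_def C1_differentiable_on_def)
  have eq: "deriv \<phi> = D"
    using D(1) by (auto simp: fun_eq_iff has_real_derivative_iff_has_vector_derivative[symmetric] intro: DERIV_imp_deriv)
  have "bounded (D ` {a..b})"
    by (intro compact_imp_bounded compact_continuous_image continuous_on_subset[OF D(2)]) auto
  then obtain B where B: "\<forall>z\<in>D ` {a..b}. norm z \<le> B" unfolding bounded_iff by blast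
  obtain C where "C \<subseteq> {a<..<b}" "\<And>x. x \<notin> C \<Longrightarrow> \<phi> x = 0"
    using assms by (auto simp: test_fun_def)
  then have "\<phi> a = 0" "\<phi> b = 0" by (meson greaterThanLessThan_iff less_irrefl subsetD)+
  moreover have "\<bar>D t\<bar> \<le> \<bar>B\<bar>" if "t \<in> {a..b}" for t using B that by force
  ultimately show thesis
    using D that[of "\<bar>B\<bar>"] by (simp add: eq has_real_derivative_iff_has_vector_derivative)
qed

section \<open>Functions of finite energy\<close>

text \<open>
  For a weakly differentiable \<open>g\<close> the increment inequality holds with
  \<open>e x = \<integral>\<^sub>a\<^sup>x (cmod g')\<^sup>2\<close>, by the Cauchy-Schwarz
  inequality. The converse is proved here. In contrast to weak derivatives, the inequality is
  obviously inherited by compositions with contractions.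
\<close>

locale finite_energy =
  fixes K :: "complex set" and a b :: real and g :: "real \<Rightarrow> complex" and e :: "real \<Rightarrow> real"
  assumes K: "K = \<real> \<or> K = UNIV" and ab: "a < b"
    and gK: "x \<in> {a..b} \<Longrightarrow> g x \<in> K"
    and energy: "\<lbrakk>a \<le> x; x \<le> y; y \<le> b\<rbrakk> \<Longrightarrow> (cmod (g y - g x))\<^sup>2 \<le> (y - x) * (e y - e x)"
begin

abbreviation "M \<equiv> lebesgue_Ioo a b"

sublocale L: semi_hilbert "L2_fun K M" "L2_ip M"
  by (rule L2_semi_hilbert[OF K finite_measure_Ioo])

lemma e_mono: "\<lbrakk>a \<le> x; x \<le> y; y \<le> b\<rbrakk> \<Longrightarrow> e x \<le> e y"
proof (cases "x = y")
  case False
  assume *: "a \<le> x" "x \<le> y" "y \<le> b"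
  have "0 \<le> (y - x) * (e y - e x)" using energy[OF *] zero_le_power2 order_trans by blast
  then show ?thesis using False * by (simp add: zero_le_mult_iff)
qed simp

lemma total_nonneg: "0 \<le> e b - e a"
  using e_mono[of a b] ab by simp

lemma energy_total:
  assumes "a \<le> x" "x \<le> y" "y \<le> b" "y - x \<le> d" shows "cmod (g y - g x) \<le> sqrt (d * (e b - e a))"
proof (rule real_le_rsqrt)
  have "(y - x) * (e y - e x) \<le> d * (e b - e a)"
    using assms e_mono[of a x] e_mono[of y b] e_mono[of x y] by (intro mult_mono) auto
  then show "(cmod (g y - g x))\<^sup>2 \<le> d * (e b - e a)" using energy[OF assms(1-3)] by simp
qed

lemma g_continuous: "continuous_on {a..b} g"
  unfolding continuous_on_iff
proof (intro ballI allI impI)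
  fix x \<epsilon> :: real assume x: "x \<in> {a..b}" and \<epsilon>: "0 < \<epsilon>"
  define d where "d = (\<epsilon>/2)\<^sup>2 / (e b - e a + 1)"
  have pos: "0 < e b - e a + 1" using total_nonneg by simp
  have d: "d > 0" unfolding d_def using \<epsilon> pos by simp
  have "d * (e b - e a) \<le> d * (e b - e a + 1)" using d by (intro mult_left_mono) auto
  also have "\<dots> = (\<epsilon>/2)\<^sup>2" using pos by (simp add: d_def)
  finally have "sqrt (d * (e b - e a)) \<le> \<epsilon>/2" using \<epsilon> by (intro real_le_lsqrt) auto
  then have small: "sqrt (d * (e b - e a)) < \<epsilon>" using \<epsilon> by simp
  show "\<exists>d>0. \<forall>x'\<in>{a..b}. dist x' x < d \<longrightarrow> dist (g x') (g x) < \<epsilon>"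
  proof (intro exI conjI ballI impI)
    fix y assume y: "y \<in> {a..b}" "dist y x < d"
    have "cmod (g y - g x) \<le> sqrt (d * (e b - e a))"
    proof (cases "x \<le> y")
      case True
      then show ?thesis using x y by (intro energy_total) (auto simp: dist_real_def)
    next
      case False
      then show ?thesis using x y energy_total[of y x d] by (auto simp: dist_real_def norm_minus_commute)
    qed
    then show "dist (g y) (g x) < \<epsilon>" using small by (simp add: dist_norm)
  qed (rule d)
qed

text \<open>
  The points \<open>P n k\<close> divide the interval into \<open>2 ^ n\<close> cells of length
  \<open>\<delta> n\<close>. The step function \<open>dd n\<close> of the difference quotients
  of \<open>g\<close> is the conditional expectation of \<open>dd (n + 1)\<close> with respect
  to these cells.
\<close>

definition \<delta> :: "nat \<Rightarrow> real" where "\<delta> n = (b - a) / 2 ^ n"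
definition P :: "nat \<Rightarrow> nat \<Rightarrow> real" where "P n k = a + real k * \<delta> n"
definition \<Delta> :: "nat \<Rightarrow> nat \<Rightarrow> complex" where "\<Delta> n k = g (P n (Suc k)) - g (P n k)"
definition dd :: "nat \<Rightarrow> real \<Rightarrow> complex" where
  "dd n t = (\<Sum>k<2^n. indicator {P n k..<P n (Suc k)} t *\<^sub>R (\<Delta> n k /\<^sub>R \<delta> n))"

lemma \<delta>_pos: "0 < \<delta> n" using ab by (simp add: \<delta>_def)
lemma P_0: "P n 0 = a" by (simp add: P_def)
lemma P_end: "P n (2^n) = b" by (simp add: P_def \<delta>_def)
lemma P_Suc: "P n (Suc k) = P n k + \<delta> n" by (simp add: P_def algebra_simps)
lemma P_mono: "k \<le> k' \<Longrightarrow> P n k \<le> P n k'" using \<delta>_pos[of n] by (simp add: P_def)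
lemma P_ge: "a \<le> P n k" using P_mono[of 0 k n] by (simp add: P_0)
lemma P_le: "k \<le> 2^n \<Longrightarrow> P n k \<le> b" using P_mono[of k "2^n" n] by (simp add: P_end)
lemma P_refine: "P (n + j) (k * 2^j) = P n k"
  by (simp add: P_def \<delta>_def power_add)
lemma P_mem: "k \<le> 2^n \<Longrightarrow> P n k \<in> {a..b}" using P_ge P_le by simp

lemma cells_disjoint:
  assumes "t \<in> {P n j..<P n (Suc j)}" "t \<in> {P n k..<P n (Suc k)}" shows "j = k"
proof (rule ccontr)
  assume "j \<noteq> k"
  then have "Suc j \<le> k \<or> Suc k \<le> j" by arith
  then have "P n (Suc j) \<le> P n k \<or> P n (Suc k) \<le> P n j" using P_mono by blast
  then show False using assms unfolding atLeastLessThan_iff by linarith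
qed

lemma dd_cell:
  assumes k: "k < 2^n" and t: "t \<in> {P n k..<P n (Suc k)}" shows "dd n t = \<Delta> n k /\<^sub>R \<delta> n"
proof -
  have "dd n t = (\<Sum>j<2^n. if j = k then \<Delta> n k /\<^sub>R \<delta> n else 0)"
    unfolding dd_def
  proof (rule sum.cong[OF refl])
    fix j :: nat
    show "indicator {P n j..<P n (Suc j)} t *\<^sub>R (\<Delta> n j /\<^sub>R \<delta> n) = (if j = k then \<Delta> n k /\<^sub>R \<delta> n else 0)"
    proof (cases "j = k")
      case True
      then show ?thesis using t by simp
    next
      case False
      then have "t \<notin> {P n j..<P n (Suc j)}" using cells_disjoint[OF _ t] by blast
      then show ?thesis using False by simp
    qed
  qed
  then show ?thesis using k by simp
qed

lemma \<Delta>_K: "k < 2^n \<Longrightarrow> \<Delta> n k \<in> K"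
  unfolding \<Delta>_def by (intro K_closed_ops(4)[OF K] gK P_mem) auto

lemma dd_K: "dd n t \<in> K"
proof -
  have "(\<Sum>k\<in>I. indicator {P n k..<P n (Suc k)} t *\<^sub>R (\<Delta> n k /\<^sub>R \<delta> n)) \<in> K"
    if "finite I" "I \<subseteq> {..<2^n}" for I
    using that
  proof (induction I)
    case (insert i I)
    have "indicator {P n i..<P n (Suc i)} t *\<^sub>R (\<Delta> n i /\<^sub>R \<delta> n) \<in> K"
      using insert by (intro K_closed_ops(9)[OF K] \<Delta>_K) simp
    then show ?case using insert by (simp add: K_closed_ops(3)[OF K])
  qed (simp add: K_closed_ops(1)[OF K])
  then show ?thesis unfolding dd_def by simp
qed

lemma dd_measurable: "dd n \<in> borel_measurable M"
proof -
  have "dd n \<in> borel_measurable borel" unfolding dd_def[abs_def] by simp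
  then show ?thesis by (rule Ioo_measurable)
qed

lemma dd_L2: "dd n \<in> L2_fun K M"
  unfolding L2_fun_def mem_Collect_eq
proof (intro conjI ballI)
  interpret finite_measure M by (rule finite_measure_Ioo)
  let ?C = "\<Sum>k<2^n. cmod (\<Delta> n k /\<^sub>R \<delta> n)"
  have "cmod (dd n t) \<le> ?C" for t
    unfolding dd_def by (rule order_trans[OF norm_sum sum_mono]) (auto simp: indicator_def)
  then have "(cmod (dd n t))\<^sup>2 \<le> ?C\<^sup>2" for t by (intro power_mono) auto
  then show "integrable M (\<lambda>x. (cmod (dd n x))\<^sup>2)"
    by (intro integrable_const_bound[of _ "?C\<^sup>2"] borel_measurable_power measurable_compose[OF dd_measurable borel_measurable_norm]) auto
qed (auto simp: dd_K dd_measurable)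

lemma dd_integrable: "integrable M (dd n)"
  by (rule L2_L1_bound(1)[OF finite_measure_Ioo dd_L2])

lemma J_dd_cell: assumes k: "k < 2^n" shows "J a b (dd n) (P n k) (P n (Suc k)) = \<Delta> n k"
proof -
  have "J a b (dd n) (P n k) (P n (Suc k)) = J a b (\<lambda>t. \<Delta> n k /\<^sub>R \<delta> n) (P n k) (P n (Suc k))"
    using dd_cell[OF k] by (intro J_cong)
  also have "\<dots> = integral {P n k..P n (Suc k)} (\<lambda>t. \<Delta> n k /\<^sub>R \<delta> n)"
    using k by (intro J_continuous P_ge P_mono P_le continuous_intros) auto
  also have "\<dots> = \<Delta> n k" using \<delta>_pos[of n] by (simp add: P_Suc)
  finally show ?thesis .
qed

lemma J_dd: "\<lbrakk>k \<le> k'; k' \<le> 2^n\<rbrakk> \<Longrightarrow> J a b (dd n) (P n k) (P n k') = g (P n k') - g (P n k)"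
proof (induction k' rule: dec_induct)
  case base
  then show ?case by (simp add: J_def)
next
  case (step i)
  have "J a b (dd n) (P n k) (P n i) + J a b (dd n) (P n i) (P n (Suc i)) = J a b (dd n) (P n k) (P n (Suc i))"
    using step by (intro J_add dd_integrable P_mono) auto
  then show ?case using step J_dd_cell[of i n] by (simp add: \<Delta>_def)
qed

definition Q :: "nat \<Rightarrow> real" where "Q n = (\<Sum>k<2^n. (cmod (\<Delta> n k))\<^sup>2 / \<delta> n)"

text \<open>
  The martingale property: since \<open>dd m\<close> has the same integral as
  \<open>dd n\<close> over every cell of the coarser partition, the increments of the sequence
  are orthogonal to its earlier members.
\<close>

lemma ip_dd: assumes "n \<le> m" shows "L2_ip M (dd n) (dd m) = Q n"
proof -
  obtain j where m: "m = n + j" using assms le_Suc_ex by blast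
  have int: "integrable M (\<lambda>x. indicator {P n k..<P n (Suc k)} x *\<^sub>R dd m x)" for k
    by (rule J_integrable[OF dd_integrable])
  then have int': "integrable M (\<lambda>x. cnj (indicator {P n k..<P n (Suc k)} x *\<^sub>R dd m x))" for k
    by (rule integrable_cnj)
  have "(LINT x|M. dd n x * cnj (dd m x))
     = (LINT x|M. (\<Sum>k<2^n. (\<Delta> n k /\<^sub>R \<delta> n) * cnj (indicator {P n k..<P n (Suc k)} x *\<^sub>R dd m x)))"
    unfolding dd_def[of n] sum_distrib_right
    by (intro Bochner_Integration.integral_cong sum.cong) (auto simp: indicator_def)
  also have "\<dots> = (\<Sum>k<2^n. (\<Delta> n k /\<^sub>R \<delta> n) * cnj (J a b (dd m) (P n k) (P n (Suc k))))"
    unfolding J_def Bochner_Integration.integral_cnj[symmetric]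
    by (subst Bochner_Integration.integral_sum) (auto intro!: integrable_mult_right int' simp del: complex_cnj_scaleR)
  also have "\<dots> = (\<Sum>k<2^n. (\<Delta> n k /\<^sub>R \<delta> n) * cnj (\<Delta> n k))"
  proof (intro sum.cong refl)
    fix k :: nat assume "k \<in> {..<2^n}"
    then have "Suc k * 2^j \<le> 2^n * 2^j" by (intro mult_right_mono) auto
    then have "J a b (dd m) (P m (k * 2^j)) (P m (Suc k * 2^j)) = g (P m (Suc k * 2^j)) - g (P m (k * 2^j))"
      by (intro J_dd) (auto simp: m power_add)
    then have "J a b (dd m) (P n k) (P n (Suc k)) = \<Delta> n k"
      unfolding m P_refine \<Delta>_def .
    then show "(\<Delta> n k /\<^sub>R \<delta> n) * cnj (J a b (dd m) (P n k) (P n (Suc k))) = (\<Delta> n k /\<^sub>R \<delta> n) * cnj (\<Delta> n k)" by simp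
  qed
  also have "\<dots> = complex_of_real (Q n)"
    unfolding Q_def of_real_sum
    by (intro sum.cong refl) (simp add: scaleR_conv_of_real divide_inverse mult.commute flip: complex_norm_square)
  finally show ?thesis by (simp add: L2_ip_def)
qed

text \<open>This is where the increment inequality enters: the upper bound telescopes.\<close>

lemma Q_le: "Q n \<le> e b - e a"
proof -
  have "Q n \<le> (\<Sum>k<2^n. e (P n (Suc k)) - e (P n k))"
    unfolding Q_def
  proof (rule sum_mono)
    fix k :: nat assume k: "k \<in> {..<2^n}"
    have "(cmod (\<Delta> n k))\<^sup>2 \<le> (P n (Suc k) - P n k) * (e (P n (Suc k)) - e (P n k))"
      unfolding \<Delta>_def using k by (intro energy P_ge P_mono P_le) auto
    then show "(cmod (\<Delta> n k))\<^sup>2 / \<delta> n \<le> e (P n (Suc k)) - e (P n k)"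
      using \<delta>_pos[of n] by (simp add: P_Suc field_simps)
  qed
  also have "\<dots> = e b - e a" using sum_lessThan_telescope[of "\<lambda>k. e (P n k)" "2^n"] by (simp add: P_0 P_end)
  finally show ?thesis .
qed

text \<open>
  The theorem of Pythagoras; as \<open>Q\<close> is bounded, the sequence \<open>dd\<close> is
  Cauchy.
\<close>

lemma N_dd_diff: assumes "n \<le> m" shows "(L.N (dd m - dd n))\<^sup>2 = Q m - Q n"
  using dd_L2[of n] dd_L2[of m] ip_dd[OF assms] ip_dd[of n n] ip_dd[of m m]
  by (simp add: L.N_sq L.r_bilinear L.r_sym[OF dd_L2 dd_L2, of m n])

lemma dd_converges: "\<exists>h\<in>L2_fun K M. (\<lambda>n. L.N (dd n - h)) \<longlonglongrightarrow> 0"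
proof (rule L.complete)
  fix \<epsilon> :: real assume \<epsilon>: "0 < \<epsilon>"
  have mono: "Q n \<le> Q m" if "n \<le> m" for n m
    using N_dd_diff[OF that] zero_le_power2[of "L.N (dd m - dd n)"] by linarith
  have abs_le: "norm (Q n) \<le> e b - e a" for n
  proof -
    have "0 \<le> Q n" unfolding Q_def using \<delta>_pos[of n] by (intro sum_nonneg) simp
    then show ?thesis using Q_le[of n] by simp
  qed
  have "convergent Q"
    by (rule Bseq_mono_convergent[OF BseqI'[of _ "e b - e a"]])
       (use abs_le mono in auto)
  then have "Cauchy Q" by (rule convergent_Cauchy)
  then obtain k where k: "\<And>m n. m \<ge> k \<Longrightarrow> n \<ge> k \<Longrightarrow> norm (Q m - Q n) < \<epsilon>\<^sup>2"
    using CauchyD[OF _ zero_less_power[OF \<epsilon>]] by metis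
  have less: "L.N (dd m - dd n) < \<epsilon>" if "m \<ge> k" "n \<ge> k" "n \<le> m" for m n
  proof (rule power2_less_imp_less)
    show "(L.N (dd m - dd n))\<^sup>2 < \<epsilon>\<^sup>2" using k[OF that(1,2)] N_dd_diff[OF that(3)] by simp
  qed (use \<epsilon> in simp)
  have "L.N (dd m - dd n) < \<epsilon>" if "m \<ge> k" "n \<ge> k" for m n
    using less[of m n] less[of n m] that L.N_diff_commute[OF dd_L2 dd_L2, of m n] by (cases "n \<le> m") auto
  then show "\<exists>k. \<forall>m\<ge>k. \<forall>n\<ge>k. L.N (dd m - dd n) < \<epsilon>" by (intro exI[of _ k]) simp
qed (rule dd_L2)


text \<open>
  Integration by parts on a single cell, with \<open>dd n\<close> in place of the derivative of
  \<open>g\<close>. The error comes from freezing \<open>g\<close> at the left and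
  \<open>\<phi>\<close> at the right end point. As the oscillation of \<open>g\<close> is of
  order \<open>sqrt (\<delta> n)\<close>, it is small compared with the length
  \<open>\<delta> n\<close> of the cell.
\<close>

lemma cell_identity:
  assumes \<phi>: "\<And>t. (\<phi> has_real_derivative D t) (at t)" "continuous_on UNIV D"
      "\<And>t. t \<in> {a..b} \<Longrightarrow> \<bar>D t\<bar> \<le> B"
    and k: "k < 2^n"
  shows "cmod (J a b (\<lambda>t. g t * complex_of_real (D t)) (P n k) (P n (Suc k))
      + J a b (\<lambda>t. dd n t * complex_of_real (\<phi> t)) (P n k) (P n (Suc k))
      - (g (P n (Suc k)) * complex_of_real (\<phi> (P n (Suc k))) - g (P n k) * complex_of_real (\<phi> (P n k))))
    \<le> 2 * (B * \<delta> n * sqrt (\<delta> n * (e b - e a)))"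
proof -
  define p q where "p = P n k" and "q = P n (Suc k)"
  let ?\<omega> = "sqrt (\<delta> n * (e b - e a))"
  have pq: "a \<le> p" "p \<le> q" "q \<le> b" "q - p = \<delta> n" and p_in: "p \<in> {a..b}"
    using k P_ge P_mono[of k "Suc k" n] P_le[of "Suc k" n] by (auto simp: p_def q_def P_Suc)
  have \<delta>0: "0 < \<delta> n" by (rule \<delta>_pos)
  have B0: "0 \<le> B" using \<phi>(3)[OF p_in] by linarith
  have \<omega>0: "0 \<le> ?\<omega>" using \<delta>0 total_nonneg by simp
  have gc: "continuous_on {p..q} g" using pq by (intro continuous_on_subset[OF g_continuous]) auto
  have Dc: "continuous_on {p..q} D" by (rule continuous_on_subset[OF \<phi>(2)]) simp
  have \<phi>c: "continuous_on {p..q} \<phi>"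
    using \<phi>(1) by (meson DERIV_isCont continuous_at_imp_continuous_on)
  have Dint: "((\<lambda>t. complex_of_real (D t)) has_integral complex_of_real (\<phi> q - \<phi> p)) {p..q}"
    using pq \<phi>(1) by (intro has_integral_of_real fundamental_theorem_of_calculus)
      (auto simp: has_real_derivative_iff_has_vector_derivative[symmetric] intro: has_field_derivative_at_within)
  have 1: "cmod (J a b (\<lambda>t. g t * complex_of_real (D t)) p q - g p * complex_of_real (\<phi> q - \<phi> p)) \<le> B * \<delta> n * ?\<omega>"
  proof -
    have "J a b (\<lambda>t. g t * complex_of_real (D t)) p q = integral {p..q} (\<lambda>t. g t * complex_of_real (D t))"
      by (intro J_continuous pq continuous_intros gc Dc)
    moreover have "g p * complex_of_real (\<phi> q - \<phi> p) = integral {p..q} (\<lambda>t. g p * complex_of_real (D t))"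
      using has_integral_mult_right[OF Dint, of "g p"] by (rule integral_unique[symmetric])
    ultimately have "J a b (\<lambda>t. g t * complex_of_real (D t)) p q - g p * complex_of_real (\<phi> q - \<phi> p)
        = integral {p..q} (\<lambda>t. g t * complex_of_real (D t) - g p * complex_of_real (D t))"
      by (simp only:) (intro Henstock_Kurzweil_Integration.integral_diff[symmetric]
          integrable_continuous_interval continuous_intros gc Dc)
    also have "cmod \<dots> \<le> (?\<omega> * B) * (q - p)"
    proof (rule integral_bound[OF pq(2)])
      show "continuous_on {p..q} (\<lambda>t. g t * complex_of_real (D t) - g p * complex_of_real (D t))"
        by (intro continuous_intros gc Dc)
      fix t assume t: "t \<in> {p..q}"
      have "cmod ((g t - g p) * complex_of_real (D t)) \<le> ?\<omega> * B"
        unfolding norm_mult norm_of_real using t pq \<omega>0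
        by (intro mult_mono energy_total \<phi>(3)) auto
      then show "cmod (g t * complex_of_real (D t) - g p * complex_of_real (D t)) \<le> ?\<omega> * B"
        by (simp add: left_diff_distrib)
    qed
    finally show ?thesis by (simp add: pq mult_ac)
  qed
  have 2: "cmod (J a b (\<lambda>t. dd n t * complex_of_real (\<phi> t)) p q - (g q - g p) * complex_of_real (\<phi> q)) \<le> B * \<delta> n * ?\<omega>"
  proof -
    have "J a b (\<lambda>t. dd n t * complex_of_real (\<phi> t)) p q = J a b (\<lambda>t. (\<Delta> n k /\<^sub>R \<delta> n) * complex_of_real (\<phi> t)) p q"
      unfolding p_def q_def by (intro J_cong) (simp add: dd_cell[OF k])
    also have "\<dots> = integral {p..q} (\<lambda>t. (\<Delta> n k /\<^sub>R \<delta> n) * complex_of_real (\<phi> t))"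
      by (intro J_continuous pq continuous_intros \<phi>c)
    finally have J2: "J a b (\<lambda>t. dd n t * complex_of_real (\<phi> t)) p q
       = integral {p..q} (\<lambda>t. (\<Delta> n k /\<^sub>R \<delta> n) * complex_of_real (\<phi> t))" .
    have "(g q - g p) * complex_of_real (\<phi> q) = integral {p..q} (\<lambda>t. (\<Delta> n k /\<^sub>R \<delta> n) * complex_of_real (\<phi> q))"
      using pq \<delta>0 by (simp add: \<Delta>_def p_def q_def)
    then have "J a b (\<lambda>t. dd n t * complex_of_real (\<phi> t)) p q - (g q - g p) * complex_of_real (\<phi> q)
        = integral {p..q} (\<lambda>t. (\<Delta> n k /\<^sub>R \<delta> n) * complex_of_real (\<phi> t) - (\<Delta> n k /\<^sub>R \<delta> n) * complex_of_real (\<phi> q))"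
      unfolding J2 by (simp only:) (intro Henstock_Kurzweil_Integration.integral_diff[symmetric]
          integrable_continuous_interval continuous_intros \<phi>c)
    also have "cmod \<dots> \<le> (?\<omega> / \<delta> n * (B * \<delta> n)) * (q - p)"
    proof (rule integral_bound[OF pq(2)])
      show "continuous_on {p..q} (\<lambda>t. (\<Delta> n k /\<^sub>R \<delta> n) * complex_of_real (\<phi> t) - (\<Delta> n k /\<^sub>R \<delta> n) * complex_of_real (\<phi> q))"
        by (intro continuous_intros \<phi>c)
      fix t assume t: "t \<in> {p..q}"
      have lip: "\<bar>\<phi> t - \<phi> q\<bar> \<le> B * \<delta> n"
      proof -
        have "norm (\<phi> q - \<phi> t) \<le> B * norm (q - t)"
        proof (rule field_differentiable_bound[of "{p..q}" \<phi> D])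
          show "(\<phi> has_field_derivative D z) (at z within {p..q})" for z
            using \<phi>(1) has_field_derivative_at_within by blast
          show "norm (D z) \<le> B" if "z \<in> {p..q}" for z using that pq \<phi>(3)[of z] by auto
        qed (use t pq in auto)
        also have "\<dots> \<le> B * \<delta> n" using t pq B0 by (intro mult_left_mono) auto
        finally show ?thesis by (simp add: abs_minus_commute)
      qed
      have "cmod ((\<Delta> n k /\<^sub>R \<delta> n) * complex_of_real (\<phi> t - \<phi> q)) \<le> ?\<omega> / \<delta> n * (B * \<delta> n)"
        unfolding norm_mult norm_of_real
      proof (intro mult_mono lip)
        have "cmod (\<Delta> n k) \<le> ?\<omega>" unfolding \<Delta>_def p_def[symmetric] q_def[symmetric]
          using pq by (intro energy_total) auto
        then show "cmod (\<Delta> n k /\<^sub>R \<delta> n) \<le> ?\<omega> / \<delta> n" using \<delta>0 by (simp add: divide_inverse mult.commute)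
      qed (use \<omega>0 \<delta>0 in auto)
      then show "cmod ((\<Delta> n k /\<^sub>R \<delta> n) * complex_of_real (\<phi> t) - (\<Delta> n k /\<^sub>R \<delta> n) * complex_of_real (\<phi> q)) \<le> ?\<omega> / \<delta> n * (B * \<delta> n)"
        by (simp only: right_diff_distrib of_real_diff)
    qed
    also have "\<dots> = B * \<delta> n * ?\<omega>" using \<delta>0 by (simp add: pq)
    finally show ?thesis .
  qed
  have "J a b (\<lambda>t. g t * complex_of_real (D t)) p q + J a b (\<lambda>t. dd n t * complex_of_real (\<phi> t)) p q
      - (g q * complex_of_real (\<phi> q) - g p * complex_of_real (\<phi> p))
     = (J a b (\<lambda>t. g t * complex_of_real (D t)) p q - g p * complex_of_real (\<phi> q - \<phi> p))
     + (J a b (\<lambda>t. dd n t * complex_of_real (\<phi> t)) p q - (g q - g p) * complex_of_real (\<phi> q))"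
    by (simp add: algebra_simps)
  then have "cmod (J a b (\<lambda>t. g t * complex_of_real (D t)) p q + J a b (\<lambda>t. dd n t * complex_of_real (\<phi> t)) p q
      - (g q * complex_of_real (\<phi> q) - g p * complex_of_real (\<phi> p)))
     \<le> cmod (J a b (\<lambda>t. g t * complex_of_real (D t)) p q - g p * complex_of_real (\<phi> q - \<phi> p))
     + cmod (J a b (\<lambda>t. dd n t * complex_of_real (\<phi> t)) p q - (g q - g p) * complex_of_real (\<phi> q))"
    by (simp only: norm_triangle_ineq)
  then show ?thesis using 1 2 unfolding p_def q_def by linarith
qed

lemma J_sum_cells:
  assumes "integrable M f" shows "(LINT t|M. f t) = (\<Sum>k<2^n. J a b f (P n k) (P n (Suc k)))"
proof -
  have "J a b f a (P n m) = (\<Sum>k<m. J a b f (P n k) (P n (Suc k)))" for m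
  proof (induction m)
    case 0
    show ?case by (simp add: J_def P_0)
  next
    case (Suc m)
    then show ?case using J_add[OF assms P_ge P_mono[of m "Suc m" n]] by simp
  qed
  from this[of "2^n"] show ?thesis by (simp add: P_end J_full)
qed

lemma dd_weak_derivative_defect:
  assumes \<phi>: "\<And>t. (\<phi> has_real_derivative D t) (at t)" "continuous_on UNIV D"
      "\<And>t. t \<in> {a..b} \<Longrightarrow> \<bar>D t\<bar> \<le> B" "\<phi> a = 0" "\<phi> b = 0"
  shows "cmod ((LINT t|M. g t * complex_of_real (D t)) + (LINT t|M. dd n t * complex_of_real (\<phi> t)))
    \<le> 2 * (B * (b - a) * sqrt (\<delta> n * (e b - e a)))"
proof -
  have Dc: "continuous_on {a..b} D" by (rule continuous_on_subset[OF \<phi>(2)]) simp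
  have \<phi>c: "continuous_on S \<phi>" for S
    using \<phi>(1) by (meson DERIV_isCont continuous_at_imp_continuous_on)
  have i1: "integrable M (\<lambda>t. g t * complex_of_real (D t))"
    by (intro Ioo_integrable_continuous continuous_intros g_continuous Dc)
  have \<phi>L: "(\<lambda>t. complex_of_real (\<phi> t)) \<in> L2_fun K M"
    unfolding L2_fun_def mem_Collect_eq
  proof (intro conjI ballI)
    show "(\<lambda>t. complex_of_real (\<phi> t)) \<in> borel_measurable M"
      by (intro Ioo_measurable borel_measurable_continuous_onI continuous_intros \<phi>c)
    have "integrable M (\<lambda>t. complex_of_real ((\<phi> t)\<^sup>2))"
      by (intro Ioo_integrable_continuous continuous_intros \<phi>c)
    then have "integrable M (\<lambda>t. Re (complex_of_real ((\<phi> t)\<^sup>2)))" by (rule integrable_Re)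
    then show "integrable M (\<lambda>t. (cmod (complex_of_real (\<phi> t)))\<^sup>2)" by simp
  qed (rule K_closed_ops(8)[OF K])
  have "integrable M (\<lambda>t. dd n t * cnj (complex_of_real (\<phi> t)))"
    by (rule L2_mult_integrable[OF dd_L2 \<phi>L])
  then have i2: "integrable M (\<lambda>t. dd n t * complex_of_real (\<phi> t))" by simp
  define R where "R k = g (P n k) * complex_of_real (\<phi> (P n k))" for k
  have "(\<Sum>k<2^n. R (Suc k) - R k) = 0"
    unfolding sum_lessThan_telescope by (simp add: R_def P_0 P_end \<phi>)
  moreover have "(\<Sum>k<2^n. A k + A' k - (R (Suc k) - R k)) = (\<Sum>k<2^n. A k) + (\<Sum>k<2^n. A' k) - (\<Sum>k<2^n. R (Suc k) - R k)"
    for A A' :: "nat \<Rightarrow> complex" unfolding sum_subtractf[of "\<lambda>k. A k + A' k"] sum.distrib ..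
  ultimately have split: "(LINT t|M. g t * complex_of_real (D t)) + (LINT t|M. dd n t * complex_of_real (\<phi> t))
     = (\<Sum>k<2^n. J a b (\<lambda>t. g t * complex_of_real (D t)) (P n k) (P n (Suc k))
      + J a b (\<lambda>t. dd n t * complex_of_real (\<phi> t)) (P n k) (P n (Suc k)) - (R (Suc k) - R k))"
    unfolding J_sum_cells[OF i1, of n] J_sum_cells[OF i2, of n] by (simp only: diff_zero)
  have "cmod ((LINT t|M. g t * complex_of_real (D t)) + (LINT t|M. dd n t * complex_of_real (\<phi> t)))
      \<le> (\<Sum>k<(2::nat)^n. 2 * (B * \<delta> n * sqrt (\<delta> n * (e b - e a))))"
    unfolding split
  proof (rule order_trans[OF norm_sum sum_mono])
    fix k :: nat assume "k \<in> {..<2^n}"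
    then have "k < 2^n" by simp
    from cell_identity[OF \<phi>(1-3) this]
    show "cmod (J a b (\<lambda>t. g t * complex_of_real (D t)) (P n k) (P n (Suc k))
      + J a b (\<lambda>t. dd n t * complex_of_real (\<phi> t)) (P n k) (P n (Suc k)) - (R (Suc k) - R k))
      \<le> 2 * (B * \<delta> n * sqrt (\<delta> n * (e b - e a)))" unfolding R_def .
  qed
  also have "\<dots> = 2 * (B * (b - a) * sqrt (\<delta> n * (e b - e a)))"
  proof -
    have "b - a = 2 ^ n * \<delta> n" by (simp add: \<delta>_def)
    moreover have "(\<Sum>k<(2::nat)^n. c) = 2 ^ n * c" for c :: real by simp
    moreover have "p * (2 * (B * d * s)) = 2 * (B * (p * d) * s)" for p d s :: real by algebra
    ultimately show ?thesis by (simp only:)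
  qed
  finally show ?thesis .
qed

text \<open>
  The weak derivative is the \<open>L\<^sub>2\<close>-limit of the martingale \<open>dd\<close>.
\<close>

theorem weak_derivative_exists:
  "\<exists>h\<in>L2_fun K M. has_weak_deriv a b g h \<and> (LINT t|M. (cmod (h t))\<^sup>2) \<le> e b - e a"
proof -
  obtain h where h: "h \<in> L2_fun K M" "(\<lambda>n. L.N (dd n - h)) \<longlonglongrightarrow> 0" using dd_converges by blast
  have Nh: "(L.N h)\<^sup>2 \<le> e b - e a"
  proof -
    have le: "L.N h \<le> sqrt (e b - e a) + L.N (dd n - h)" for n
    proof -
      have "L.N (dd n) \<le> sqrt (e b - e a)"
        using Q_le[of n] ip_dd[of n n] by (simp add: L.N_def)
      then show ?thesis using L.N_reverse[OF h(1) dd_L2, of n] L.N_diff_commute[OF h(1) dd_L2, of n] by simp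
    qed
    have "L.N h \<le> sqrt (e b - e a) + 0"
    proof (rule tendsto_lowerbound)
      show "(\<lambda>n. sqrt (e b - e a) + L.N (dd n - h)) \<longlonglongrightarrow> sqrt (e b - e a) + 0"
        by (intro tendsto_intros h(2))
    qed (use le in auto)
    then have "(L.N h)\<^sup>2 \<le> (sqrt (e b - e a))\<^sup>2" using L.N_nonneg[OF h(1)] by (intro power_mono) auto
    then show ?thesis using total_nonneg by simp
  qed
  have "has_weak_deriv a b g h"
    unfolding has_weak_deriv_def
  proof
    fix \<phi> assume "\<phi> \<in> test_fun a b"
    note phi = this
    obtain B where B: "0 \<le> B" "\<And>t. (\<phi> has_real_derivative deriv \<phi> t) (at t)" "continuous_on UNIV (deriv \<phi>)"
      "\<And>t. t \<in> {a..b} \<Longrightarrow> \<bar>deriv \<phi> t\<bar> \<le> B" "\<phi> a = 0" "\<phi> b = 0"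
      using test_fun_props[OF phi] by blast
    have \<phi>c: "continuous_on S \<phi>" for S
      using B(2) by (meson DERIV_isCont continuous_at_imp_continuous_on)
    have "bounded (\<phi> ` {a..b})" by (intro compact_imp_bounded compact_continuous_image \<phi>c compact_Icc)
    then obtain C where C: "\<forall>z\<in>\<phi> ` {a..b}. norm z \<le> C" unfolding bounded_iff by blast
    let ?I = "LINT t|M. g t * complex_of_real (deriv \<phi> t)"
    have \<phi>m: "(\<lambda>t. complex_of_real (\<phi> t)) \<in> borel_measurable M"
      by (intro Ioo_measurable borel_measurable_continuous_onI continuous_intros \<phi>c)
    have i: "integrable M (\<lambda>t. f t * complex_of_real (\<phi> t))"
       "cmod (LINT t|M. f t * complex_of_real (\<phi> t)) \<le> C * (sqrt (measure M (space M)) * L.N f)"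
       if f: "f \<in> L2_fun K M" for f
    proof -
      note F = L2_L1_bound[OF finite_measure_Ioo f]
      have C': "cmod (f t * complex_of_real (\<phi> t)) \<le> C * cmod (f t)" if "t \<in> space M" for t
      proof -
        have "t \<in> {a..b}" using that by (auto simp: space_restrict_space)
        then have "\<bar>\<phi> t\<bar> \<le> C" using C by simp
        then show ?thesis using mult_right_mono[of "\<bar>\<phi> t\<bar>" C "cmod (f t)"] by (simp add: norm_mult mult.commute)
      qed
      have C0: "0 \<le> C" using C[rule_format, of "\<phi> a"] ab by auto
      show int: "integrable M (\<lambda>t. f t * complex_of_real (\<phi> t))"
      proof (rule Bochner_Integration.integrable_bound)
        show "integrable M (\<lambda>t. C * cmod (f t))" using F(1) by (intro integrable_mult_right integrable_norm)
        show "(\<lambda>t. f t * complex_of_real (\<phi> t)) \<in> borel_measurable M"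
          using F(1) by (intro borel_measurable_times \<phi>m) auto
        show "AE t in M. norm (f t * complex_of_real (\<phi> t)) \<le> norm (C * cmod (f t))"
          using C' C0 by (intro AE_I2) (simp add: abs_mult)
      qed
      have "cmod (LINT t|M. f t * complex_of_real (\<phi> t)) \<le> (LINT t|M. cmod (f t * complex_of_real (\<phi> t)))"
        by (rule integral_norm_bound)
      also have "\<dots> \<le> (LINT t|M. C * cmod (f t))"
        using int F(1) C' by (intro integral_mono integrable_norm integrable_mult_right)
      also have "\<dots> = C * (LINT t|M. cmod (f t))" by simp
      also have "\<dots> \<le> C * (sqrt (measure M (space M)) * L.N f)"
        using F(2) C0 by (intro mult_left_mono) (auto simp: L.N_def L2_ip_self)
      finally show "cmod (LINT t|M. f t * complex_of_real (\<phi> t)) \<le> C * (sqrt (measure M (space M)) * L.N f)" .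
    qed
    have lim1: "(\<lambda>n. LINT t|M. dd n t * complex_of_real (\<phi> t)) \<longlonglongrightarrow> (LINT t|M. h t * complex_of_real (\<phi> t))"
    proof (rule LIM_zero_cancel, rule Lim_null_comparison)
      show "\<forall>\<^sub>F n in sequentially. norm ((LINT t|M. dd n t * complex_of_real (\<phi> t)) - (LINT t|M. h t * complex_of_real (\<phi> t)))
          \<le> C * (sqrt (measure M (space M)) * L.N (dd n - h))"
      proof (intro always_eventually allI)
        fix n
        have "(LINT t|M. dd n t * complex_of_real (\<phi> t)) - (LINT t|M. h t * complex_of_real (\<phi> t))
           = (LINT t|M. (dd n - h) t * complex_of_real (\<phi> t))"
          unfolding minus_apply left_diff_distrib
          by (rule Bochner_Integration.integral_diff[symmetric, OF i(1)[OF dd_L2] i(1)[OF h(1)]])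
        then show "norm ((LINT t|M. dd n t * complex_of_real (\<phi> t)) - (LINT t|M. h t * complex_of_real (\<phi> t)))
          \<le> C * (sqrt (measure M (space M)) * L.N (dd n - h))"
          using i(2)[OF L.closed_ops(3)[OF dd_L2 h(1)], of n] by simp
      qed
      show "(\<lambda>n. C * (sqrt (measure M (space M)) * L.N (dd n - h))) \<longlonglongrightarrow> 0"
        using tendsto_mult[OF tendsto_const tendsto_mult[OF tendsto_const h(2)]] by simp
    qed
    have lim2: "(\<lambda>n. ?I + (LINT t|M. dd n t * complex_of_real (\<phi> t))) \<longlonglongrightarrow> 0"
    proof (rule Lim_null_comparison)
      show "\<forall>\<^sub>F n in sequentially. norm (?I + (LINT t|M. dd n t * complex_of_real (\<phi> t)))
          \<le> 2 * (B * (b - a) * sqrt (\<delta> n * (e b - e a)))"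
        using dd_weak_derivative_defect[OF B(2-6)] by simp
      have "\<delta> \<longlonglongrightarrow> 0" unfolding \<delta>_def by real_asymp
      then have "(\<lambda>n. 2 * (B * (b - a) * sqrt (\<delta> n * (e b - e a)))) \<longlonglongrightarrow> 2 * (B * (b - a) * sqrt (0 * (e b - e a)))"
        by (intro tendsto_intros)
      then show "(\<lambda>n. 2 * (B * (b - a) * sqrt (\<delta> n * (e b - e a)))) \<longlonglongrightarrow> 0" by simp
    qed
    have "?I + (LINT t|M. h t * complex_of_real (\<phi> t)) = 0"
      using tendsto_add[OF tendsto_const lim1, of ?I] lim2 LIMSEQ_unique by blast
    then show "?I = - (LINT t|M. h t * complex_of_real (\<phi> t))" by (simp add: eq_neg_iff_add_eq_0)
  qed
  then show ?thesis using h(1) Nh by (auto simp: L.N_sq L2_ip_self)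
qed

end


section \<open>Interpolation over the gaps of a support\<close>

locale edge =
  fixes K :: "complex set" and a b :: real and \<mu> :: "real measure"
  assumes K: "K = \<real> \<or> K = UNIV" and ab: "a < b"
    and sets_\<mu>: "sets \<mu> = sets (restrict_space borel {a..b})"
    and finite_\<mu>: "finite_measure \<mu>"
    and a_spt: "a \<in> spt \<mu>" and b_spt: "b \<in> spt \<mu>"
begin

abbreviation "S \<equiv> spt \<mu>"

lemma space_\<mu>: "space \<mu> = {a..b}"
  using sets_eq_imp_space_eq[OF sets_\<mu>] by (simp add: space_restrict_space)

lemma S_subset: "S \<subseteq> {a..b}" unfolding spt_def space_\<mu> by blast

lemma null_open: "open U \<Longrightarrow> U \<inter> {a..b} \<in> sets \<mu>"
  unfolding sets_\<mu> by (auto simp: sets_restrict_space)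

lemma S_closed: "closed S"
proof -
  have "S = {a..b} - \<Union>{U. open U \<and> emeasure \<mu> (U \<inter> space \<mu>) = 0}"
    unfolding spt_def space_\<mu> by (auto simp: zero_less_iff_neq_zero)
  then show ?thesis by (auto intro!: closed_Diff open_Union)
qed

text \<open>
  The complement of the support is a countable union of null sets from a basis of the topology.
\<close>

lemma AE_S: "AE x in \<mu>. x \<in> S"
proof -
  define \<B> where "\<B> = (SOME B :: real set set. countable B \<and> topological_basis B)"
  have "\<exists>B :: real set set. countable B \<and> topological_basis B" by (rule ex_countable_basis)
  then have \<B>: "countable \<B>" "topological_basis \<B>" unfolding \<B>_def by (metis (mono_tags, lifting) someI_ex)+
  let ?Z = "{U \<in> \<B>. emeasure \<mu> (U \<inter> {a..b}) = 0}"
  have "AE x in \<mu>. \<forall>U\<in>?Z. x \<notin> U"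
  proof (subst AE_ball_countable)
    show "countable ?Z" using \<B>(1) by simp
    show "\<forall>U\<in>?Z. AE x in \<mu>. x \<notin> U"
    proof
      fix U assume U: "U \<in> ?Z"
      then have "U \<inter> {a..b} \<in> null_sets \<mu>"
        using null_open topological_basis_open[OF \<B>(2)] by (auto simp: null_sets_def)
      then have "AE x in \<mu>. x \<notin> U \<inter> {a..b}" by (rule AE_not_in)
      then show "AE x in \<mu>. x \<notin> U" using AE_space by eventually_elim (auto simp: space_\<mu>)
    qed
  qed
  then show ?thesis using AE_space
  proof eventually_elim
    case (elim x)
    show ?case unfolding spt_def
    proof (intro CollectI conjI allI impI)
      fix U assume U: "open U" "x \<in> U"
      obtain V where V: "V \<in> \<B>" "x \<in> V" "V \<subseteq> U" using topological_basisE[OF \<B>(2) U] by blast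
      have oV: "open V" using topological_basis_open[OF \<B>(2) V(1)] .
      have "emeasure \<mu> (V \<inter> {a..b}) \<noteq> 0" using elim(1) V by blast
      then have "0 < emeasure \<mu> (V \<inter> {a..b})" by (simp add: zero_less_iff_neq_zero)
      also have "\<dots> \<le> emeasure \<mu> (U \<inter> {a..b})" using V(3) by (intro emeasure_mono null_open U) auto
      finally show "0 < emeasure \<mu> (U \<inter> space \<mu>)" by (simp add: space_\<mu>)
    qed (rule elim(2))
  qed
qed

lemma AE_eq_imp_eq_on_S:
  fixes g1 g2 :: "real \<Rightarrow> complex"
  assumes c: "continuous_on {a..b} g1" "continuous_on {a..b} g2" and ae: "AE x in \<mu>. g1 x = g2 x" and x: "x \<in> S"
  shows "g1 x = g2 x"
proof (rule ccontr)
  assume ne: "g1 x \<noteq> g2 x"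
  have "open (- {0::complex})" by auto
  moreover have "continuous_on {a..b} (\<lambda>x. g1 x - g2 x)" by (intro continuous_intros c)
  ultimately obtain U where U: "open U" "U \<inter> {a..b} = (\<lambda>x. g1 x - g2 x) -` (- {0}) \<inter> {a..b}"
    unfolding continuous_on_open_invariant by metis
  have "x \<in> U" using U(2) ne x S_subset by auto
  then have "0 < emeasure \<mu> (U \<inter> {a..b})" using x U(1) by (auto simp: spt_def space_\<mu>)
  moreover have "emeasure \<mu> (U \<inter> {a..b}) = 0"
  proof -
    have "AE x in \<mu>. x \<notin> U \<inter> {a..b}" using ae by eventually_elim (use U(2) in auto)
    then show ?thesis using AE_iff_null_sets[OF null_open[OF U(1)]] by (auto simp: null_sets_def)
  qed
  ultimately show False by simp
qed

definition gl :: "real \<Rightarrow> real" where "gl x = Sup (S \<inter> {..x})"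
definition gr :: "real \<Rightarrow> real" where "gr x = Inf (S \<inter> {x..})"

lemma gl: assumes "x \<in> {a..b}"
  shows "gl x \<in> S" "gl x \<le> x" "\<And>s. \<lbrakk>s \<in> S; s \<le> x\<rbrakk> \<Longrightarrow> s \<le> gl x"
proof -
  have ne: "S \<inter> {..x} \<noteq> {}" using a_spt assms by auto
  have bd: "bdd_above (S \<inter> {..x})" by (rule bdd_aboveI[of _ x]) auto
  have "gl x \<in> S \<inter> {..x}" unfolding gl_def by (intro closed_contains_Sup ne bd closed_Int S_closed) auto
  then show "gl x \<in> S" "gl x \<le> x" by auto
  show "s \<le> gl x" if "s \<in> S" "s \<le> x" for s unfolding gl_def using that bd by (intro cSup_upper) auto
qed

lemma gr: assumes "x \<in> {a..b}"
  shows "gr x \<in> S" "x \<le> gr x" "\<And>s. \<lbrakk>s \<in> S; x \<le> s\<rbrakk> \<Longrightarrow> gr x \<le> s"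
proof -
  have ne: "S \<inter> {x..} \<noteq> {}" using b_spt assms by auto
  have bd: "bdd_below (S \<inter> {x..})" by (rule bdd_belowI[of _ x]) auto
  have "gr x \<in> S \<inter> {x..}" unfolding gr_def by (intro closed_contains_Inf ne bd closed_Int S_closed) auto
  then show "gr x \<in> S" "x \<le> gr x" by auto
  show "gr x \<le> s" if "s \<in> S" "x \<le> s" for s unfolding gr_def using that bd by (intro cInf_lower) auto
qed

text \<open>
  For \<open>x\<close> in the support, \<open>gl x = gr x = x\<close>, and the quotient is
  \<open>0 / 0 = 0\<close>. The type is general because \<open>g\<close> and the energy function
  \<open>e\<close> are both interpolated.
\<close>

definition interp :: "(real \<Rightarrow> 'v::real_vector) \<Rightarrow> real \<Rightarrow> 'v" where
  "interp g x = g (gl x) + ((x - gl x) / (gr x - gl x)) *\<^sub>R (g (gr x) - g (gl x))"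

lemma interp_S: assumes "x \<in> S" shows "interp g x = g x"
proof -
  have x: "x \<in> {a..b}" using assms S_subset by auto
  have "gl x = x" "gr x = x" using gl(2,3)[OF x] gr(2,3)[OF x] assms by (auto intro: antisym)
  then show ?thesis by (simp add: interp_def)
qed

lemma interp_gap:
  assumes cd: "c \<in> S" "d \<in> S" "c < d" "S \<inter> {c<..<d} = {}" and x: "x \<in> {c..d}"
  shows "interp g x = g c + ((x - c) / (d - c)) *\<^sub>R (g d - g c)"
proof -
  consider "x = c" | "x = d" | "c < x" "x < d" using x by fastforce
  then show ?thesis
  proof cases
    case 1
    then show ?thesis using interp_S[OF cd(1)] by simp
  next
    case 2
    then show ?thesis using interp_S[OF cd(2)] cd(3) by simp
  next
    case 3
    have X: "x \<in> {a..b}" using 3 cd S_subset by (meson atLeastAtMost_iff less_imp_le order_trans subsetD)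
    have "c \<le> gl x" "gr x \<le> d" using gl(3)[OF X cd(1)] gr(3)[OF X cd(2)] 3 by auto
    moreover have "\<not> c < gl x" using cd(4) gl(1,2)[OF X] 3 by force
    moreover have "\<not> gr x < d" using cd(4) gr(1,2)[OF X] 3 by force
    ultimately have "gl x = c" "gr x = d" by auto
    then show ?thesis by (simp add: interp_def)
  qed
qed

lemma gap_around:
  assumes x: "x \<in> {a..b}" and nS: "x \<notin> S"
  shows "gl x < x" "x < gr x" "S \<inter> {gl x<..<gr x} = {}"
proof -
  have ne: "gl x \<noteq> x" "gr x \<noteq> x" using gl(1)[OF x] gr(1)[OF x] nS by auto
  then show lt: "gl x < x" "x < gr x" using gl(2)[OF x] gr(2)[OF x] by auto
  show "S \<inter> {gl x<..<gr x} = {}"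
  proof (rule ccontr)
    assume "S \<inter> {gl x<..<gr x} \<noteq> {}"
    then obtain s where s: "s \<in> S" "gl x < s" "s < gr x" by auto
    then show False using gl(3)[OF x s(1)] gr(3)[OF x s(1)] by (cases "s \<le> x") auto
  qed
qed

text \<open>
  The increment inequality is transitive, by the inequality between arithmetic and geometric
  means. The letters \<open>u\<close> and \<open>v\<close> stand for increments of
  \<open>g\<close>, and \<open>s\<close> and \<open>e\<close> for those of the position and of
  the energy.
\<close>

lemma energy_trans:
  fixes u v s1 s2 e1 e2 :: real
  assumes "0 \<le> u" "0 \<le> v" "0 \<le> s1" "0 \<le> s2" "0 \<le> e1" "0 \<le> e2" "u\<^sup>2 \<le> s1 * e1" "v\<^sup>2 \<le> s2 * e2"
  shows "(u + v)\<^sup>2 \<le> (s1 + s2) * (e1 + e2)"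
proof -
  have "2 * (u * v) \<le> s1 * e2 + s2 * e1"
  proof (rule power2_le_imp_le)
    have "(2 * (u * v))\<^sup>2 = 4 * (u\<^sup>2 * v\<^sup>2)" by (simp add: power_mult_distrib)
    also have "\<dots> \<le> 4 * ((s1 * e1) * (s2 * e2))" using assms by (intro mult_left_mono mult_mono) auto
    also have "\<dots> \<le> (s1 * e2 + s2 * e1)\<^sup>2"
      using zero_le_power2[of "s1 * e2 - s2 * e1"] by (simp add: power2_eq_square algebra_simps)
    finally show "(2 * (u * v))\<^sup>2 \<le> (s1 * e2 + s2 * e1)\<^sup>2" .
  qed (use assms in simp)
  then show ?thesis using assms by (simp add: power2_sum algebra_simps)
qed

text \<open>
  In a gap both sides of the increment inequality are quadratic in \<open>y - x\<close>, and so
  the inequality for the ends of the gap suffices. The general case is composed of a piece of a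
  gap, a piece between two points of the support, and another piece of a gap.
\<close>

lemma interp_energy:
  assumes E: "\<And>x y. \<lbrakk>x \<in> S; y \<in> S; x \<le> y\<rbrakk> \<Longrightarrow> (cmod (g y - g x))\<^sup>2 \<le> (y - x) * (e y - e x)"
    and xy: "a \<le> x" "x \<le> y" "y \<le> b"
  shows "(cmod (interp g y - interp g x))\<^sup>2 \<le> (y - x) * (interp e y - interp e x)"
proof -
  define R where "R x y \<longleftrightarrow> x \<le> y \<and> interp e x \<le> interp e y \<and>
    (cmod (interp g y - interp g x))\<^sup>2 \<le> (y - x) * (interp e y - interp e x)" for x y
  have R_trans: "R x z" if "R x y" "R y z" for x y z
  proof -
    have "(cmod (interp g z - interp g x))\<^sup>2 \<le> (cmod (interp g y - interp g x) + cmod (interp g z - interp g y))\<^sup>2"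
      using norm_triangle_ineq[of "interp g y - interp g x" "interp g z - interp g y"] by (intro power_mono) auto
    also have "\<dots> \<le> ((y - x) + (z - y)) * ((interp e y - interp e x) + (interp e z - interp e y))"
      using that unfolding R_def by (intro energy_trans) auto
    finally show ?thesis using that by (auto simp: R_def)
  qed
  have e_mono: "e x \<le> e y" if "x \<in> S" "y \<in> S" "x \<le> y" for x y
  proof (cases "x = y")
    case False
    have "0 \<le> (y - x) * (e y - e x)" using E[OF that] zero_le_power2 order_trans by blast
    then show ?thesis using False that by (simp add: zero_le_mult_iff)
  qed simp
  have R_S: "R x y" if "x \<in> S" "y \<in> S" "x \<le> y" for x y
    using that E[OF that] e_mono[OF that] unfolding R_def by (simp add: interp_S)
  have R_gap: "R x y" if cd: "c \<in> S" "d \<in> S" "c < d" "S \<inter> {c<..<d} = {}" and xy: "c \<le> x" "x \<le> y" "y \<le> d" for c d x y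
  proof -
    have D: "interp f y - interp f x = ((y - x) / (d - c)) *\<^sub>R (f d - f c)" for f :: "real \<Rightarrow> 'v::real_vector"
      using interp_gap[OF cd, of x f] interp_gap[OF cd, of y f] xy
      by (simp add: diff_divide_distrib flip: scaleR_left_diff_distrib)
    let ?s = "(y - x) / (d - c)"
    have s0: "0 \<le> ?s" using xy cd by simp
    have ecd: "e c \<le> e d" using e_mono cd by simp
    have "(cmod (interp g y - interp g x))\<^sup>2 = ?s\<^sup>2 * (cmod (g d - g c))\<^sup>2"
      unfolding D norm_scaleR by (simp add: power_mult_distrib power_divide)
    also have "\<dots> \<le> ?s\<^sup>2 * ((d - c) * (e d - e c))" using E[OF cd(1,2)] cd(3) by (intro mult_left_mono) auto
    also have "\<dots> = (y - x) * (interp e y - interp e x)"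
      unfolding D using cd(3) by (simp add: power2_eq_square)
    finally have "(cmod (interp g y - interp g x))\<^sup>2 \<le> (y - x) * (interp e y - interp e x)" .
    moreover have "0 \<le> interp e y - interp e x" unfolding D using s0 ecd by (simp only: scaleR_nonneg_nonneg diff_ge_0_iff_ge)
    ultimately show ?thesis using xy unfolding R_def by simp
  qed
  have x_in: "x \<in> {a..b}" and y_in: "y \<in> {a..b}" using xy by auto
  have R_x: "R x (gr x)"
  proof (cases "x \<in> S")
    case True
    then have "gr x = x" using gr(2,3)[OF x_in] by force
    then show ?thesis using R_S True by simp
  next
    case False
    show ?thesis using gap_around[OF x_in False] gl(1)[OF x_in] gr(1)[OF x_in] by (intro R_gap[of "gl x" "gr x"]) auto
  qed
  have R_y: "R (gl y) y"
  proof (cases "y \<in> S")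
    case True
    then have "gl y = y" using gl(2,3)[OF y_in] by force
    then show ?thesis using R_S True by simp
  next
    case False
    show ?thesis using gap_around[OF y_in False] gl(1)[OF y_in] gr(1)[OF y_in] by (intro R_gap[of "gl y" "gr y"]) auto
  qed
  have "R x y"
  proof (cases "gr x \<le> gl y")
    case True
    then have "R (gr x) (gl y)" by (intro R_S gl(1)[OF y_in] gr(1)[OF x_in])
    then show ?thesis using R_trans[OF R_trans[OF R_x] R_y] by blast
  next
    case False
    have nS: "x \<notin> S"
    proof
      assume xS: "x \<in> S"
      then have "gr x \<le> x" using gr(3)[OF x_in xS] by simp
      moreover have "x \<le> gl y" using gl(3)[OF y_in xS] xy by simp
      ultimately show False using False by simp
    qed
    have "y \<le> gr x"
    proof (rule ccontr)
      assume "\<not> y \<le> gr x"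
      then have "gr x \<le> gl y" using gl(3)[OF y_in gr(1)[OF x_in]] by simp
      then show False using False by simp
    qed
    then show ?thesis using gap_around[OF x_in nS] gl(1)[OF x_in] gr(1)[OF x_in] xy by (intro R_gap[of "gl x" "gr x"]) auto
  qed
  then show ?thesis by (simp add: R_def)
qed

end


section \<open>The map \<open>\<iota>\<close> on an edge\<close>

lemma C_fun_L2:
  assumes "f \<in> C_fun K a b" shows "f \<in> L2_fun K (lebesgue_Ioo a b)"
  unfolding L2_fun_def mem_Collect_eq
proof (intro conjI ballI)
  have c: "continuous_on {a..b} f" using assms by (simp add: C_fun_def)
  show "f \<in> borel_measurable (lebesgue_Ioo a b)"
    by (rule borel_measurable_integrable[OF Ioo_integrable_continuous[OF c]])
  have "integrable (lebesgue_Ioo a b) (\<lambda>t. complex_of_real ((cmod (f t))\<^sup>2))"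
    by (intro Ioo_integrable_continuous continuous_intros c)
  then have "integrable (lebesgue_Ioo a b) (\<lambda>t. Re (complex_of_real ((cmod (f t))\<^sup>2)))" by (rule integrable_Re)
  then show "integrable (lebesgue_Ioo a b) (\<lambda>t. (cmod (f t))\<^sup>2)" by simp
qed (use assms in \<open>auto simp: C_fun_def space_restrict_space\<close>)

lemma J_Cauchy_Schwarz:
  assumes h: "h \<in> L2_fun K (lebesgue_Ioo a b)" and xy: "a \<le> x" "x \<le> y" "y \<le> b"
  shows "(cmod (J a b h x y))\<^sup>2 \<le> (y - x) * J a b (\<lambda>t. (cmod (h t))\<^sup>2) x y"
proof -
  let ?M = "lebesgue_Ioo a b"
  interpret L: semi_inner_product "L2_fun UNIV ?M" "L2_ip ?M" by (rule L2_semi_inner_product) simp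
  define u v where "u t = complex_of_real (indicator {x..<y} t * cmod (h t))"
    and "v t = complex_of_real (indicator {x..<y} t)" for t :: real
  have hm: "h \<in> borel_measurable ?M" and h2: "integrable ?M (\<lambda>t. (cmod (h t))\<^sup>2)"
    using h by (auto simp: L2_fun_def)
  have h1: "integrable ?M h" by (rule L2_L1_bound(1)[OF finite_measure_Ioo h])
  have one: "integrable ?M (\<lambda>t. 1 :: real)"
    using finite_measure.integrable_const[OF finite_measure_Ioo, of a b "1::real"] by simp
  have usq: "(cmod (u t))\<^sup>2 = indicator {x..<y} t *\<^sub>R (cmod (h t))\<^sup>2" for t
    by (simp add: u_def indicator_def)
  have vsq: "(cmod (v t))\<^sup>2 = indicator {x..<y} t *\<^sub>R 1" for t by (simp add: v_def indicator_def)
  have ind: "(\<lambda>t. indicator {x..<y} t :: real) \<in> borel_measurable ?M" by (intro Ioo_measurable) simp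
  have u: "u \<in> L2_fun UNIV ?M" unfolding L2_fun_def mem_Collect_eq usq
    using J_integrable[OF h2, of x y] ind measurable_compose[OF hm borel_measurable_norm]
    unfolding u_def[abs_def] by auto
  have v: "v \<in> L2_fun UNIV ?M" unfolding L2_fun_def mem_Collect_eq vsq
    using J_integrable[OF one, of x y] ind unfolding v_def[abs_def] by auto
  have "J a b (\<lambda>t. 1::real) x y = y - x" using xy by (subst J_continuous) auto
  then have Nv: "(L.N v)\<^sup>2 = y - x"
    unfolding L.N_sq[OF v] L2_ip_self vsq by (simp add: J_def)
  have Nu: "(L.N u)\<^sup>2 = J a b (\<lambda>t. (cmod (h t))\<^sup>2) x y"
    unfolding L.N_sq[OF u] L2_ip_self usq by (simp add: J_def)
  have "L2_ip ?M u v = (LINT t|?M. cmod (indicator {x..<y} t *\<^sub>R h t))"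
  proof -
    have "u t * cnj (v t) = complex_of_real (cmod (indicator {x..<y} t *\<^sub>R h t))" for t
      by (simp add: u_def v_def indicator_def)
    then show ?thesis unfolding L2_ip_def by (simp only: integral_complex_of_real Re_complex_of_real)
  qed
  then have "cmod (J a b h x y) \<le> L2_ip ?M u v" unfolding J_def by (simp only: integral_norm_bound)
  also have "\<dots> \<le> L.N u * L.N v" by (rule L.r_le[OF u v])
  finally have "(cmod (J a b h x y))\<^sup>2 \<le> (L.N u * L.N v)\<^sup>2" by (intro power_mono) auto
  then show ?thesis by (simp add: power_mult_distrib Nu Nv mult.commute)
qed

context edge
begin

abbreviation "I \<equiv> lebesgue_Ioo a b"

sublocale I: semi_inner_product "L2_fun K I" "L2_ip I" by (rule L2_semi_inner_product[OF K])
sublocale E: semi_inner_product "L2_fun K \<mu>" "L2_ip \<mu>" by (rule L2_semi_inner_product[OF K])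

lemma weak_deriv_props:
  assumes "g \<in> W12 K a b"
  shows "weak_deriv K a b g \<in> L2_fun K I" "has_weak_deriv a b g (weak_deriv K a b g)"
proof -
  have "\<exists>h. h \<in> L2_fun K I \<and> has_weak_deriv a b g h" using assms by (auto simp: W12_def)
  from someI_ex[OF this] show "weak_deriv K a b g \<in> L2_fun K I" "has_weak_deriv a b g (weak_deriv K a b g)"
    by (simp_all add: weak_deriv_def)
qed

lemma weak_deriv_unique:
  assumes g: "continuous_on {a..b} g" and h: "h1 \<in> L2_fun K I" "h2 \<in> L2_fun K I"
    and wd: "has_weak_deriv a b g h1" "has_weak_deriv a b g h2"
  shows "AE t in I. h1 t = h2 t"
proof -
  have int: "integrable I h1" "integrable I h2" using L2_L1_bound(1)[OF finite_measure_Ioo] h by blast+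
  have "AE t in I. h1 t - h2 t = 0"
  proof (rule J_zero_imp_AE_zero)
    fix y assume y: "a \<le> y" "y \<le> b"
    have "J a b (\<lambda>t. h1 t - h2 t) a y = J a b h1 a y - J a b h2 a y"
      unfolding J_def scaleR_diff_right by (intro Bochner_Integration.integral_diff J_integrable int)
    then show "J a b (\<lambda>t. h1 t - h2 t) a y = 0"
      using weak_derivative_FTC[OF g int(1) wd(1), of a y] weak_derivative_FTC[OF g int(2) wd(2), of a y] y by simp
  qed (use ab int in auto)
  then show ?thesis by eventually_elim simp
qed

lemma weak_deriv_AE:
  assumes "g \<in> C_fun K a b" "h \<in> L2_fun K I" "has_weak_deriv a b g h"
  shows "AE t in I. weak_deriv K a b g t = h t"
proof -
  have "g \<in> W12 K a b" using assms C_fun_L2 by (auto simp: W12_def)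
  then show ?thesis using weak_deriv_unique[OF _ _ assms(2) _ assms(3)] weak_deriv_props[of g] assms(1)
    by (auto simp: C_fun_def)
qed

definition energy :: "(real \<Rightarrow> complex) \<Rightarrow> real" where
  "energy g = (LINT t|I. (cmod (weak_deriv K a b g t))\<^sup>2)"

lemma energy_eq:
  assumes "g \<in> C_fun K a b" "h \<in> L2_fun K I" "has_weak_deriv a b g h"
  shows "energy g = (LINT t|I. (cmod (h t))\<^sup>2)"
  unfolding energy_def
proof (rule integral_cong_AE)
  have "g \<in> W12 K a b" using assms C_fun_L2 by (auto simp: W12_def)
  then show "(\<lambda>t. (cmod (weak_deriv K a b g t))\<^sup>2) \<in> borel_measurable I" "(\<lambda>t. (cmod (h t))\<^sup>2) \<in> borel_measurable I"
    using weak_deriv_props(1)[of g] assms(2) by (auto simp: L2_fun_def)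
  show "AE t in I. (cmod (weak_deriv K a b g t))\<^sup>2 = (cmod (h t))\<^sup>2"
    using weak_deriv_AE[OF assms] by eventually_elim simp
qed

definition energy_fun :: "(real \<Rightarrow> complex) \<Rightarrow> real \<Rightarrow> real" where
  "energy_fun g x = J a b (\<lambda>t. (cmod (weak_deriv K a b g t))\<^sup>2) a x"

lemma energy_fun_ends: "energy_fun g b - energy_fun g a = energy g"
  by (simp add: energy_fun_def energy_def J_full) (simp add: J_def)

lemma W12_increment:
  assumes g: "g \<in> W12 K a b" "continuous_on {a..b} g" and xy: "a \<le> x" "x \<le> y" "y \<le> b"
  shows "(cmod (g y - g x))\<^sup>2 \<le> (y - x) * (energy_fun g y - energy_fun g x)"
proof -
  note h = weak_deriv_props[OF g(1)]
  have int: "integrable I (weak_deriv K a b g)" by (rule L2_L1_bound(1)[OF finite_measure_Ioo h(1)])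
  have int2: "integrable I (\<lambda>t. (cmod (weak_deriv K a b g t))\<^sup>2)" using h(1) by (simp add: L2_fun_def)
  have "energy_fun g y - energy_fun g x = J a b (\<lambda>t. (cmod (weak_deriv K a b g t))\<^sup>2) x y"
    using J_add[OF int2 xy(1,2)] by (simp add: energy_fun_def)
  then show ?thesis using J_Cauchy_Schwarz[OF h(1) xy] weak_derivative_FTC[OF g(2) int h(2) xy] by simp
qed

text \<open>
  The interpolation, normalised to \<open>0\<close> outside the interval as in the definition of
  \<open>iota_edge\<close>.
\<close>

definition interp0 :: "(real \<Rightarrow> complex) \<Rightarrow> real \<Rightarrow> complex" where
  "interp0 g x = (if x \<in> {a..b} then interp g x else 0)"

text \<open>
  Both the existence of \<open>\<iota> f\<close> and the operation of contractions are
  instances: \<open>g\<close> is a representative of \<open>f\<close> in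
  \<open>W\<^sup>1\<^sub>2\<close> in the first case, and such a function composed with a
  contraction in the second.
\<close>

lemma interp0_props:
  assumes gK: "\<And>x. x \<in> S \<Longrightarrow> g x \<in> K"
    and E: "\<And>x y. \<lbrakk>x \<in> S; y \<in> S; x \<le> y\<rbrakk> \<Longrightarrow> (cmod (g y - g x))\<^sup>2 \<le> (y - x) * (e y - e x)"
  shows "interp0 g \<in> W12_mu K a b \<mu>" "energy (interp0 g) \<le> e b - e a" "\<And>x. x \<in> S \<Longrightarrow> interp0 g x = g x"
    "\<And>x. x \<notin> {a..b} \<Longrightarrow> interp0 g x = 0"
proof -
  interpret F: finite_energy K a b "interp0 g" "interp e"
  proof
    show "interp0 g x \<in> K" if x: "x \<in> {a..b}" for x
      using gl(1)[OF x] gr(1)[OF x] x gK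
      by (auto simp: interp0_def interp_def intro!: K_closed_ops(3,9)[OF K] K_closed_ops(4)[OF K])
    show "(cmod (interp0 g y - interp0 g x))\<^sup>2 \<le> (y - x) * (interp e y - interp e x)"
      if "a \<le> x" "x \<le> y" "y \<le> b" for x y
      using interp_energy[OF E that] that by (simp add: interp0_def)
  qed (use K ab in auto)
  show S: "interp0 g x = g x" if "x \<in> S" for x using that S_subset interp_S[OF that] by (auto simp: interp0_def)
  show "interp0 g x = 0" if "x \<notin> {a..b}" for x using that unfolding interp0_def by (rule if_not_P)
  have C: "interp0 g \<in> C_fun K a b" using F.g_continuous F.gK by (auto simp: C_fun_def)
  obtain h where h: "h \<in> L2_fun K I" "has_weak_deriv a b (interp0 g) h" "(LINT t|I. (cmod (h t))\<^sup>2) \<le> interp e b - interp e a"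
    using F.weak_derivative_exists by blast
  show "energy (interp0 g) \<le> e b - e a"
    using h(3) by (simp add: energy_eq[OF C h(1,2)] interp_S a_spt b_spt)
  have "\<exists>p q. \<forall>x\<in>Q. interp0 g x = p + q * complex_of_real x" if Q: "Q \<in> components ({a..b} - S)" for Q
  proof -
    obtain x0 where x0: "x0 \<in> Q" using Q in_components_nonempty by blast
    have Qsub: "Q \<subseteq> {a..b} - S" using in_components_subset[OF Q] .
    have Qconn: "connected Q" using in_components_connected[OF Q] .
    have x0': "x0 \<in> {a..b}" "x0 \<notin> S" using x0 Qsub by auto
    note gap = gap_around[OF x0']
    have c: "gl x0 \<in> S" "gr x0 \<in> S" using gl(1)[OF x0'(1)] gr(1)[OF x0'(1)] by auto
    \<comment> \<open>A component of the complement of the support cannot pass an end of the gap.\<close>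
    have "x \<in> {gl x0..gr x0}" if x: "x \<in> Q" for x
    proof (rule ccontr)
      assume "x \<notin> {gl x0..gr x0}"
      then consider "x < gl x0" | "gr x0 < x" by fastforce
      then show False
      proof cases
        case 1
        then have "gl x0 \<in> Q" using connected_contains_Icc[OF Qconn x x0] gap by auto
        then show False using c Qsub by auto
      next
        case 2
        then have "gr x0 \<in> Q" using connected_contains_Icc[OF Qconn x0 x] gap by auto
        then show False using c Qsub by auto
      qed
    qed
    then have form: "interp0 g x = g (gl x0) + ((x - gl x0) / (gr x0 - gl x0)) *\<^sub>R (g (gr x0) - g (gl x0))" if "x \<in> Q" for x
      using that Qsub interp_gap[OF c _ gap(3), of x g] gap by (auto simp: interp0_def)
    define q where "q = (g (gr x0) - g (gl x0)) / complex_of_real (gr x0 - gl x0)"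
    have "interp0 g x = (g (gl x0) - q * complex_of_real (gl x0)) + q * complex_of_real x" if "x \<in> Q" for x
    proof -
      have "((x - gl x0) / (gr x0 - gl x0)) *\<^sub>R (g (gr x0) - g (gl x0)) = q * (complex_of_real x - complex_of_real (gl x0))"
        by (simp add: q_def scaleR_conv_of_real)
      then show ?thesis unfolding form[OF that] by (simp add: algebra_simps)
    qed
    then show ?thesis by blast
  qed
  then have "interp0 g \<in> C_mu K a b \<mu>" using C by (auto simp: C_mu_def)
  moreover have "interp0 g \<in> W12 K a b" using C_fun_L2[OF C] h by (auto simp: W12_def)
  ultimately show "interp0 g \<in> W12_mu K a b \<mu>" by (simp add: W12_mu_def)
qed

text \<open>
  The functions agree on the support by continuity, in particular at the ends of every gap; two
  affine functions that agree at two points are equal.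
\<close>

lemma C_mu_unique:
  assumes g: "g1 \<in> C_mu K a b \<mu>" "g2 \<in> C_mu K a b \<mu>" and ae: "AE x in \<mu>. g1 x = g2 x" and x: "x \<in> {a..b}"
  shows "g1 x = g2 x"
proof -
  have c: "continuous_on {a..b} g1" "continuous_on {a..b} g2" using g by (auto simp: C_mu_def C_fun_def)
  note eqS = AE_eq_imp_eq_on_S[OF c ae]
  show ?thesis
  proof (cases "x \<in> S")
    case False
    note gap = gap_around[OF x False]
    let ?c = "gl x" and ?d = "gr x"
    have cd: "?c \<in> S" "?d \<in> S" using gl(1)[OF x] gr(1)[OF x] by auto
    have sub: "{?c<..<?d} \<subseteq> {a..b} - S" using gap cd S_subset by fastforce
    have ne: "{a..b} - S \<noteq> {}" "{?c<..<?d} \<noteq> {}" using x False gap by auto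
    obtain Q where Q: "Q \<in> components ({a..b} - S)" "{?c<..<?d} \<subseteq> Q"
      using exists_component_superset[OF sub ne(1) connected_Ioo] by blast
    obtain p1 q1 where 1: "\<And>y. y \<in> Q \<Longrightarrow> g1 y = p1 + q1 * complex_of_real y" using g(1) Q(1) unfolding C_mu_def by blast
    obtain p2 q2 where 2: "\<And>y. y \<in> Q \<Longrightarrow> g2 y = p2 + q2 * complex_of_real y" using g(2) Q(1) unfolding C_mu_def by blast
    define p q where "p = p1 - p2" and "q = q1 - q2"
    have D: "g1 y - g2 y = p + q * complex_of_real y" if "y \<in> {?c<..<?d}" for y
      using 1[of y] 2[of y] Q(2) that by (auto simp: p_def q_def algebra_simps)
    have "closure {?c<..<?d} = {?c..?d}" using gap by (intro closure_greaterThanLessThan) simp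
    moreover have "{?c..?d} \<subseteq> {a..b}" using cd S_subset by auto
    moreover have "g1 y - g2 y - (p + q * complex_of_real y) = 0" if "y \<in> closure {?c<..<?d}" for y
    proof (rule continuous_constant_on_closure[OF _ _ that])
      show "continuous_on (closure {?c<..<?d}) (\<lambda>y. g1 y - g2 y - (p + q * complex_of_real y))"
        using calculation by (intro continuous_intros continuous_on_subset[OF c(1)] continuous_on_subset[OF c(2)]) auto
    qed (simp add: D)
    ultimately have D': "g1 y - g2 y = p + q * complex_of_real y" if "y \<in> {?c..?d}" for y using that by auto
    have e1: "p + q * complex_of_real ?c = 0" using D'[of ?c] eqS[OF cd(1)] gap by simp
    have e2: "p + q * complex_of_real ?d = 0" using D'[of ?d] eqS[OF cd(2)] gap by simp
    have "q * complex_of_real (?d - ?c) = (p + q * complex_of_real ?d) - (p + q * complex_of_real ?c)"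
      by (simp add: algebra_simps)
    then have "q = 0" using e1 e2 gap by simp
    then show ?thesis using e1 D'[of x] gap by simp
  qed (rule eqS)
qed

lemma iota_eqI:
  assumes "g \<in> W12_mu K a b \<mu>" "AE x in \<mu>. g x = f x" "\<And>x. x \<notin> {a..b} \<Longrightarrow> g x = 0"
  shows "iota_edge K a b \<mu> f = g"
  unfolding iota_edge_def
proof (rule the_equality)
  fix g' assume g': "g' \<in> W12_mu K a b \<mu> \<and> (AE x in \<mu>. g' x = f x) \<and> (\<forall>x. x \<notin> {a..b} \<longrightarrow> g' x = 0)"
  then have "AE x in \<mu>. g' x = f x" by blast
  then have ae: "AE x in \<mu>. g' x = g x" using assms(2) by eventually_elim simp
  show "g' = g"
  proof
    fix x show "g' x = g x"
      using C_mu_unique[OF _ _ ae, of x] g' assms by (cases "x \<in> {a..b}") (auto simp: W12_mu_def)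
  qed
qed (use assms in blast)

lemma iota_exists:
  assumes "f \<in> D_iota_edge K a b \<mu>"
  shows "\<exists>g. g \<in> W12_mu K a b \<mu> \<and> (AE x in \<mu>. g x = f x) \<and> (\<forall>x. x \<notin> {a..b} \<longrightarrow> g x = 0)"
proof -
  obtain g where g: "g \<in> W12 K a b" "g \<in> C_fun K a b" "AE x in \<mu>. g x = f x"
    using assms by (auto simp: D_iota_edge_def)
  have gK: "g x \<in> K" if "x \<in> S" for x using g(2) S_subset that by (auto simp: C_fun_def)
  have "(cmod (g y - g x))\<^sup>2 \<le> (y - x) * (energy_fun g y - energy_fun g x)" if "x \<in> S" "y \<in> S" "x \<le> y" for x y
    using that S_subset g by (intro W12_increment) (auto simp: C_fun_def)
  note p = interp0_props[OF gK this]
  have "AE x in \<mu>. interp0 g x = f x" using g(3) AE_S by eventually_elim (simp add: p(3))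
  then show ?thesis using p(1,4) by blast
qed

abbreviation "\<iota> \<equiv> iota_edge K a b \<mu>"

lemma iota_props:
  assumes "f \<in> D_iota_edge K a b \<mu>"
  shows "\<iota> f \<in> W12_mu K a b \<mu>" "AE x in \<mu>. \<iota> f x = f x" "\<And>x. x \<notin> {a..b} \<Longrightarrow> \<iota> f x = 0"
    "\<iota> f \<in> W12 K a b" "\<iota> f \<in> C_fun K a b" "continuous_on {a..b} (\<iota> f)"
proof -
  obtain g where g: "g \<in> W12_mu K a b \<mu>" "AE x in \<mu>. g x = f x" "\<forall>x. x \<notin> {a..b} \<longrightarrow> g x = 0"
    using iota_exists[OF assms] by blast
  have eq: "\<iota> f = g" using iota_eqI[OF g(1,2)] g(3) by blast
  show "\<iota> f \<in> W12_mu K a b \<mu>" "AE x in \<mu>. \<iota> f x = f x" "\<And>x. x \<notin> {a..b} \<Longrightarrow> \<iota> f x = 0"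
    "\<iota> f \<in> W12 K a b" "\<iota> f \<in> C_fun K a b" "continuous_on {a..b} (\<iota> f)"
    using g unfolding eq by (auto simp: W12_mu_def C_mu_def C_fun_def)
qed

definition contraction :: "(complex \<Rightarrow> complex) \<Rightarrow> bool" where
  "contraction F \<longleftrightarrow> F 0 = 0 \<and> (\<forall>z w. cmod (F z - F w) \<le> cmod (z - w)) \<and> F ` K \<subseteq> K"

text \<open>
  On the support, \<open>F \<circ> \<iota> f\<close> satisfies the increment inequality with the
  energy function of \<open>\<iota> f\<close>. Hence its interpolation, which is
  \<open>\<iota> (F \<circ> f)\<close>, has at most the energy of \<open>\<iota> f\<close>.
\<close>

theorem contraction_operates:
  assumes f: "f \<in> D_iota_edge K a b \<mu>" and F: "contraction F"
  shows "(\<lambda>x. F (f x)) \<in> D_iota_edge K a b \<mu>" "\<iota> (\<lambda>x. F (f x)) a = F (\<iota> f a)" "\<iota> (\<lambda>x. F (f x)) b = F (\<iota> f b)"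
    "energy (\<iota> (\<lambda>x. F (f x))) \<le> energy (\<iota> f)"
proof -
  have F0: "F 0 = 0" and FL: "\<And>z w. cmod (F z - F w) \<le> cmod (z - w)" and FK: "\<And>z. z \<in> K \<Longrightarrow> F z \<in> K"
    using F by (auto simp: contraction_def)
  note g = iota_props[OF f]
  let ?g = "\<lambda>x. F (\<iota> f x)"
  have gK: "?g x \<in> K" if "x \<in> S" for x using g(5) S_subset that by (intro FK) (auto simp: C_fun_def)
  have "(cmod (?g y - ?g x))\<^sup>2 \<le> (y - x) * (energy_fun (\<iota> f) y - energy_fun (\<iota> f) x)" if "x \<in> S" "y \<in> S" "x \<le> y" for x y
  proof -
    have "(cmod (?g y - ?g x))\<^sup>2 \<le> (cmod (\<iota> f y - \<iota> f x))\<^sup>2" using FL by (intro power_mono) auto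
    also have "\<dots> \<le> (y - x) * (energy_fun (\<iota> f) y - energy_fun (\<iota> f) x)"
      using that S_subset g by (intro W12_increment) auto
    finally show ?thesis .
  qed
  note p = interp0_props[OF gK this]
  have ae: "AE x in \<mu>. interp0 ?g x = F (f x)" using g(2) AE_S by eventually_elim (simp add: p(3))
  have eq: "\<iota> (\<lambda>x. F (f x)) = interp0 ?g" by (rule iota_eqI[OF p(1) ae p(4)])
  show "\<iota> (\<lambda>x. F (f x)) a = F (\<iota> f a)" "\<iota> (\<lambda>x. F (f x)) b = F (\<iota> f b)"
    unfolding eq using p(3) a_spt b_spt by auto
  show "energy (\<iota> (\<lambda>x. F (f x))) \<le> energy (\<iota> f)" unfolding eq using p(2) by (simp add: energy_fun_ends)
  have fL: "f \<in> L2_fun K \<mu>" using f by (simp add: D_iota_edge_def)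
  have "continuous_on UNIV F"
    unfolding continuous_on_iff dist_norm using FL by (meson le_less_trans)
  then have Fm: "F \<in> borel_measurable borel" by (rule borel_measurable_continuous_onI)
  have "(\<lambda>x. F (f x)) \<in> L2_fun K \<mu>"
    unfolding L2_fun_def mem_Collect_eq
  proof (intro conjI ballI)
    show m: "(\<lambda>x. F (f x)) \<in> borel_measurable \<mu>"
      using fL by (intro measurable_compose[OF _ Fm]) (simp add: L2_fun_def)
    show "F (f x) \<in> K" if "x \<in> space \<mu>" for x using fL that by (intro FK) (simp add: L2_fun_def)
    show "integrable \<mu> (\<lambda>x. (cmod (F (f x)))\<^sup>2)"
    proof (rule Bochner_Integration.integrable_bound)
      show "integrable \<mu> (\<lambda>x. (cmod (f x))\<^sup>2)" using fL by (simp add: L2_fun_def)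
      show "AE x in \<mu>. norm ((cmod (F (f x)))\<^sup>2) \<le> norm ((cmod (f x))\<^sup>2)"
        using FL[of _ 0] F0 by (intro always_eventually allI) (simp add: power_mono)
    qed (intro borel_measurable_power measurable_compose[OF m borel_measurable_norm])
  qed
  then show "(\<lambda>x. F (f x)) \<in> D_iota_edge K a b \<mu>"
    using p(1) ae unfolding D_iota_edge_def W12_mu_def C_mu_def by blast
qed


lemma weak_deriv_diff:
  assumes g: "g1 \<in> C_fun K a b" "g2 \<in> C_fun K a b"
    and h: "h1 \<in> L2_fun K I" "h2 \<in> L2_fun K I"
    and wd: "has_weak_deriv a b g1 h1" "has_weak_deriv a b g2 h2"
  shows "has_weak_deriv a b (\<lambda>x. g1 x - complex_of_real c * g2 x) (\<lambda>x. h1 x - complex_of_real c * h2 x)"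
  unfolding has_weak_deriv_def
proof
  fix \<phi> assume \<phi>: "\<phi> \<in> test_fun a b"
  obtain B where B: "0 \<le> B" "\<And>t. (\<phi> has_real_derivative deriv \<phi> t) (at t)" "continuous_on UNIV (deriv \<phi>)"
    "\<And>t. t \<in> {a..b} \<Longrightarrow> \<bar>deriv \<phi> t\<bar> \<le> B" "\<phi> a = 0" "\<phi> b = 0"
    using test_fun_props[OF \<phi>] by blast
  have \<phi>c: "continuous_on {a..b} \<phi>"
    using B(2) by (meson DERIV_isCont continuous_at_imp_continuous_on)
  have dc: "continuous_on {a..b} (deriv \<phi>)" by (rule continuous_on_subset[OF B(3)]) simp
  have L2c: "(\<lambda>t. complex_of_real (f t)) \<in> L2_fun K I" if "continuous_on {a..b} f" for f
    using that by (intro C_fun_L2) (auto simp: C_fun_def K_closed_ops(8)[OF K] intro!: continuous_intros)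
  have int: "integrable I (\<lambda>t. f t * complex_of_real (q t))" if "f \<in> L2_fun K I" "continuous_on {a..b} q" for f q
    using L2_mult_integrable[OF that(1) L2c[OF that(2)]] by simp
  have lin: "(LINT t|I. (f1 t - complex_of_real c * f2 t) * complex_of_real (q t))
     = (LINT t|I. f1 t * complex_of_real (q t)) - complex_of_real c * (LINT t|I. f2 t * complex_of_real (q t))"
    if f: "f1 \<in> L2_fun K I" "f2 \<in> L2_fun K I" and q: "continuous_on {a..b} q" for f1 f2 q
  proof -
    have "(LINT t|I. (f1 t - complex_of_real c * f2 t) * complex_of_real (q t))
       = (LINT t|I. f1 t * complex_of_real (q t) - complex_of_real c * (f2 t * complex_of_real (q t)))"
      by (simp add: algebra_simps)
    then show ?thesis using int[OF f(1) q] int[OF f(2) q] by simp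
  qed
  have "(LINT x|I. g1 x * complex_of_real (deriv \<phi> x)) = - (LINT x|I. h1 x * complex_of_real (\<phi> x))"
    "(LINT x|I. g2 x * complex_of_real (deriv \<phi> x)) = - (LINT x|I. h2 x * complex_of_real (\<phi> x))"
    using wd \<phi> unfolding has_weak_deriv_def by blast+
  then show "(LINT x|I. (g1 x - complex_of_real c * g2 x) * complex_of_real (deriv \<phi> x))
      = - (LINT x|I. (h1 x - complex_of_real c * h2 x) * complex_of_real (\<phi> x))"
    unfolding lin[OF C_fun_L2[OF g(1)] C_fun_L2[OF g(2)] dc] lin[OF h \<phi>c] by simp
qed

lemma L2_diff: "\<lbrakk>h1 \<in> L2_fun K N; h2 \<in> L2_fun K N\<rbrakk> \<Longrightarrow> (\<lambda>x. h1 x - complex_of_real c * h2 x) \<in> L2_fun K N"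
  using subspace_diff[OF L2_subspace[OF K, of N], of h1 "c *\<^sub>R h2"] subspace_scale[OF L2_subspace[OF K, of N], of h2 c]
  by (simp add: fun_diff_def scaleR_fun_def scaleR_conv_of_real)

lemma C_mu_diff:
  assumes g: "g1 \<in> C_mu K a b \<mu>" "g2 \<in> C_mu K a b \<mu>"
  shows "(\<lambda>x. g1 x - complex_of_real c * g2 x) \<in> C_mu K a b \<mu>"
  unfolding C_mu_def
proof (intro CollectI conjI ballI)
  show "(\<lambda>x. g1 x - complex_of_real c * g2 x) \<in> C_fun K a b"
    unfolding C_fun_def
  proof (intro CollectI conjI ballI)
    have c: "continuous_on {a..b} g1" "continuous_on {a..b} g2"
      and k: "\<And>x. x \<in> {a..b} \<Longrightarrow> g1 x \<in> K" "\<And>x. x \<in> {a..b} \<Longrightarrow> g2 x \<in> K"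
      using g by (auto simp: C_mu_def C_fun_def)
    show "continuous_on {a..b} (\<lambda>x. g1 x - complex_of_real c * g2 x)"
      by (intro continuous_on_diff continuous_on_mult continuous_on_const c)
    fix x assume "x \<in> {a..b}"
    then show "g1 x - complex_of_real c * g2 x \<in> K"
      by (intro K_closed_ops(4)[OF K] K_closed_ops(5)[OF K] K_closed_ops(8)[OF K] k)
  qed
  fix Q assume Q: "Q \<in> components ({a..b} - S)"
  obtain p1 q1 where 1: "\<And>y. y \<in> Q \<Longrightarrow> g1 y = p1 + q1 * complex_of_real y" using g(1) Q unfolding C_mu_def by blast
  obtain p2 q2 where 2: "\<And>y. y \<in> Q \<Longrightarrow> g2 y = p2 + q2 * complex_of_real y" using g(2) Q unfolding C_mu_def by blast
  have "g1 y - complex_of_real c * g2 y = (p1 - complex_of_real c * p2) + (q1 - complex_of_real c * q2) * complex_of_real y" if "y \<in> Q" for y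
    using 1[OF that] 2[OF that] by (simp add: algebra_simps)
  then show "\<exists>p q. \<forall>y\<in>Q. g1 y - complex_of_real c * g2 y = p + q * complex_of_real y" by blast
qed

abbreviation "\<D> \<equiv> D_iota_edge K a b \<mu>"
abbreviation "der f \<equiv> weak_deriv K a b (\<iota> f)"

lemma der_props: "f \<in> \<D> \<Longrightarrow> der f \<in> L2_fun K I" "f \<in> \<D> \<Longrightarrow> has_weak_deriv a b (\<iota> f) (der f)"
  using weak_deriv_props[OF iota_props(4)] by auto

text \<open>
  Expanding the square in \<open>energy (\<iota> (u - 2 F u)) \<le> energy (\<iota> u)\<close>
  gives
  \<open>4 * energy (\<iota> (F u)) \<le> 4 * L2_ip I (\<iota> u)' (\<iota> (F u))'\<close>. In
  this way the contraction property of the reflection replaces a chain rule for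
  \<open>F\<close>.
\<close>

theorem energy_of_remainder:
  assumes u: "u \<in> \<D>" and F: "contraction F" and R: "contraction (\<lambda>z. z - 2 * F z)"
  shows "energy (\<iota> (\<lambda>x. F (u x))) \<le> L2_ip I (der u) (der (\<lambda>x. F (u x)))"
proof -
  let ?w = "\<lambda>x. F (u x)" and ?v = "\<lambda>x. u x - 2 * F (u x)"
  have w: "?w \<in> \<D>" by (rule contraction_operates(1)[OF u F])
  note U = iota_props[OF u] and W = iota_props[OF w]
  let ?g = "\<lambda>x. \<iota> u x - complex_of_real 2 * \<iota> ?w x"
  let ?h = "\<lambda>x. der u x - complex_of_real 2 * der ?w x"
  have gC: "?g \<in> C_mu K a b \<mu>" using U(1) W(1) by (intro C_mu_diff) (auto simp: W12_mu_def)
  then have gCf: "?g \<in> C_fun K a b" by (simp add: C_mu_def)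
  have hL: "?h \<in> L2_fun K I" by (intro L2_diff der_props u w)
  have wd: "has_weak_deriv a b ?g ?h" by (intro weak_deriv_diff U(5) W(5) der_props u w)
  have "?g \<in> W12_mu K a b \<mu>" using gC C_fun_L2[OF gCf] hL wd by (auto simp: W12_mu_def W12_def)
  moreover have "AE x in \<mu>. ?g x = ?v x" using U(2) W(2) by eventually_elim simp
  moreover have "?g x = 0" if "x \<notin> {a..b}" for x using U(3)[OF that] W(3)[OF that] by simp
  ultimately have eq: "\<iota> ?v = ?g" by (rule iota_eqI)
  have "energy ?g \<le> energy (\<iota> u)" using contraction_operates(4)[OF u R] unfolding eq .
  then have "L2_ip I ?h ?h \<le> L2_ip I (der u) (der u)"
    unfolding energy_eq[OF gCf hL wd] L2_ip_self energy_def .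
  moreover have "?h = der u - (2::real) *\<^sub>R der ?w" by (simp add: fun_eq_iff scaleR_fun_def scaleR_conv_of_real)
  ultimately have "L2_ip I (der u - (2::real) *\<^sub>R der ?w) (der u - (2::real) *\<^sub>R der ?w) \<le> L2_ip I (der u) (der u)" by simp
  moreover have "L2_ip I (der u - (2::real) *\<^sub>R der ?w) (der u - (2::real) *\<^sub>R der ?w)
     = L2_ip I (der u) (der u) - 4 * L2_ip I (der u) (der ?w) + 4 * L2_ip I (der ?w) (der ?w)"
  proof -
    have "p - 2 * q - 2 * (q - 2 * s) = p - 4 * q + 4 * s" for p q s :: real by simp
    then show ?thesis
      using der_props(1)[OF u] der_props(1)[OF w] I.r_sym[OF der_props(1)[OF w] der_props(1)[OF u]]
      by (simp only: I.r_bilinear I.closed_ops)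
  qed
  ultimately show ?thesis by (simp add: energy_def L2_ip_self)
qed

lemma energy_nonneg: "0 \<le> energy g" unfolding energy_def by simp

lemma increment_total:
  assumes g: "g \<in> W12 K a b" "continuous_on {a..b} g" and x: "x \<in> {a..b}" "y \<in> {a..b}" "\<bar>y - x\<bar> \<le> d"
  shows "(cmod (g y - g x))\<^sup>2 \<le> d * energy g"
proof -
  have *: "(cmod (g y - g x))\<^sup>2 \<le> d * energy g" if xy: "x \<in> {a..b}" "y \<in> {a..b}" "x \<le> y" "y - x \<le> d" for x y
  proof -
    have int: "integrable I (\<lambda>t. (cmod (weak_deriv K a b g t))\<^sup>2)" using weak_deriv_props(1)[OF g(1)] by (simp add: L2_fun_def)
    let ?J = "J a b (\<lambda>t. (cmod (weak_deriv K a b g t))\<^sup>2)"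
    have J0: "0 \<le> ?J p q" for p q unfolding J_def by (rule Bochner_Integration.integral_nonneg) (simp add: indicator_def)
    have "?J a x + ?J x y = ?J a y" "?J a y + ?J y b = ?J a b" using xy by (auto intro!: J_add int)
    then have le: "energy_fun g y - energy_fun g x \<le> energy g"
      using J0[of a x] J0[of y b] by (simp add: energy_fun_def energy_def J_full)
    have "(cmod (g y - g x))\<^sup>2 \<le> (y - x) * (energy_fun g y - energy_fun g x)"
      using xy by (intro W12_increment g) auto
    also have "\<dots> \<le> (y - x) * energy g" using le xy by (intro mult_left_mono) auto
    also have "\<dots> \<le> d * energy g" using xy energy_nonneg by (intro mult_right_mono) auto
    finally show ?thesis .
  qed
  show ?thesis using *[of x y] *[of y x] x by (cases "x \<le> y") (auto simp: norm_minus_commute)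
qed

text \<open>
  Near \<open>p\<close> the function \<open>\<iota> f\<close> differs little from its value at
  \<open>p\<close>, compared with the energy. Every neighbourhood of a point of the support has
  positive measure, and so averaging over one bounds this value by the
  \<open>L\<^sub>2\<close>-norm.
\<close>

theorem trace_inequality:
  assumes p: "p \<in> S" and \<epsilon>: "0 < \<epsilon>"
  shows "\<exists>C\<ge>0. \<forall>f\<in>\<D>. (cmod (\<iota> f p))\<^sup>2 \<le> \<epsilon> * energy (\<iota> f) + C * (LINT x|\<mu>. (cmod (f x))\<^sup>2)"
proof -
  interpret finite_measure \<mu> by (rule finite_\<mu>)
  \<comment> \<open>The squared increments of \<open>\<iota> f\<close> on \<open>A\<close> are at most
    \<open>\<epsilon>/2\<close> times the energy; the other factor \<open>2\<close> comes from
    squaring a sum.\<close>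
  define A where "A = {p - \<epsilon>/2<..<p + \<epsilon>/2} \<inter> {a..b}"
  have A: "A \<in> sets \<mu>" unfolding A_def by (intro null_open) simp
  have "0 < emeasure \<mu> A" using p \<epsilon> unfolding A_def spt_def space_\<mu> by auto
  then have m: "0 < measure \<mu> A" by (simp add: emeasure_eq_measure)
  have p_in: "p \<in> {a..b}" using p S_subset by auto
  show ?thesis
  proof (intro exI[of _ "2 / measure \<mu> A"] conjI ballI)
    fix f assume f: "f \<in> \<D>"
    note g = iota_props[OF f]
    have f2: "integrable \<mu> (\<lambda>x. (cmod (f x))\<^sup>2)" using f by (simp add: D_iota_edge_def L2_fun_def)
    have ind: "integrable \<mu> (\<lambda>x. indicator A x * c)" for c :: real
      using A by (intro integrable_mult_left integrable_real_indicator) (auto simp: emeasure_eq_measure)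
    have "measure \<mu> A * (cmod (\<iota> f p))\<^sup>2 = (LINT x|\<mu>. indicator A x * (cmod (\<iota> f p))\<^sup>2)"
      using A by simp
    also have "\<dots> \<le> (LINT x|\<mu>. 2 * (cmod (f x))\<^sup>2 + indicator A x * (\<epsilon> * energy (\<iota> f)))"
    proof (rule integral_mono_AE)
      show "AE x in \<mu>. indicator A x * (cmod (\<iota> f p))\<^sup>2 \<le> 2 * (cmod (f x))\<^sup>2 + indicator A x * (\<epsilon> * energy (\<iota> f))"
        using g(2)
      proof eventually_elim
        case (elim x)
        show ?case
        proof (cases "x \<in> A")
          case True
          have "(cmod (\<iota> f p - \<iota> f x))\<^sup>2 \<le> (\<epsilon>/2) * energy (\<iota> f)"
          proof (rule increment_total[OF g(4,6)])
            show "x \<in> {a..b}" using True by (simp add: A_def)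
            have "p - \<epsilon> / 2 < x" "x < p + \<epsilon> / 2" using True by (auto simp: A_def)
            then show "\<bar>p - x\<bar> \<le> \<epsilon> / 2" by linarith
          qed (rule p_in)
          moreover have "(cmod (\<iota> f p))\<^sup>2 \<le> 2 * (cmod (\<iota> f x))\<^sup>2 + 2 * (cmod (\<iota> f p - \<iota> f x))\<^sup>2"
          proof -
            have "(cmod (\<iota> f p))\<^sup>2 \<le> (cmod (\<iota> f x) + cmod (\<iota> f p - \<iota> f x))\<^sup>2"
              using norm_triangle_ineq[of "\<iota> f x" "\<iota> f p - \<iota> f x"] by (intro power_mono) auto
            also have "\<dots> \<le> 2 * (cmod (\<iota> f x))\<^sup>2 + 2 * (cmod (\<iota> f p - \<iota> f x))\<^sup>2"
              using sum_squares_bound[of "cmod (\<iota> f x)" "cmod (\<iota> f p - \<iota> f x)"] by (simp add: power2_sum)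
            finally show ?thesis .
          qed
          ultimately show ?thesis using True elim by simp
        qed simp
      qed
    qed (intro Bochner_Integration.integrable_add integrable_mult_right f2 ind)+
    also have "\<dots> = 2 * (LINT x|\<mu>. (cmod (f x))\<^sup>2) + measure \<mu> A * (\<epsilon> * energy (\<iota> f))"
      using A f2 ind by (subst Bochner_Integration.integral_add) auto
    finally have "measure \<mu> A * (cmod (\<iota> f p))\<^sup>2 \<le> 2 * (LINT x|\<mu>. (cmod (f x))\<^sup>2) + measure \<mu> A * (\<epsilon> * energy (\<iota> f))" .
    then show "(cmod (\<iota> f p))\<^sup>2 \<le> \<epsilon> * energy (\<iota> f) + 2 / measure \<mu> A * (LINT x|\<mu>. (cmod (f x))\<^sup>2)"
      using m by (simp add: field_simps)
  qed (use m in simp)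
qed

end


section \<open>Linear operators on spaces of functions on a finite set\<close>

lemma K_subspace_add: "K_subspace K S Y \<Longrightarrow> x \<in> Y \<Longrightarrow> y \<in> Y \<Longrightarrow> (\<lambda>i. x i + y i) \<in> Y"
  by (simp add: K_subspace_def)

lemma K_subspace_scale: "K_subspace K S Y \<Longrightarrow> c \<in> K \<Longrightarrow> x \<in> Y \<Longrightarrow> (\<lambda>i. c * x i) \<in> Y"
  by (simp add: K_subspace_def)

lemma K_subspace_lincomb:
  assumes "K_subspace K S Y" "x \<in> Y" "y \<in> Y" "c \<in> K" "K = \<real> \<or> K = UNIV"
  shows "(\<lambda>i. x i - c * y i) \<in> Y"
  using K_subspace_add[OF assms(1,2) K_subspace_scale[OF assms(1) K_closed_ops(7)[OF assms(5,4)] assms(3)]]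
  by simp

text \<open>
  One step of Gaussian elimination. It permits induction on the number of coordinates, without
  the choice of a basis.
\<close>

lemma K_subspace_reduce:
  assumes K: "K = \<real> \<or> K = UNIV" and Y: "K_subspace K (insert i S) Y" and i: "i \<notin> S"
  shows "K_subspace K S {x \<in> Y. x i = 0}"
    and "(\<forall>x\<in>Y. x i = 0) \<or> (\<exists>y\<in>Y. y i = 1)"
proof -
  show "K_subspace K S {x \<in> Y. x i = 0}"
    using Y i unfolding K_subspace_def K_fun_def by (auto simp: subset_iff)
  show "(\<forall>x\<in>Y. x i = 0) \<or> (\<exists>y\<in>Y. y i = 1)"
  proof (rule disjCI)
    assume n: "\<not> (\<exists>y\<in>Y. y i = 1)"
    show "\<forall>x\<in>Y. x i = 0"
    proof (rule ballI, rule ccontr)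
      fix x assume x: "x \<in> Y" "x i \<noteq> 0"
      have "x i \<in> K" using Y x(1) by (auto simp: K_subspace_def K_fun_def)
      then have "1 / x i \<in> K" using K_closed_ops(2,6)[OF K] by blast
      then have "(\<lambda>j. 1 / x i * x j) \<in> Y" by (rule K_subspace_scale[OF Y _ x(1)])
      moreover have "1 / x i * x i = 1" using x(2) by simp
      ultimately show False using n by (metis (no_types, lifting))
    qed
  qed
qed

lemma K_subspace_closed:
  assumes K: "K = \<real> \<or> K = UNIV" and S: "finite S" and Y: "K_subspace K S Y"
    and F: "\<And>n::nat. F n \<in> Y" and lim: "\<And>i. (\<lambda>n. F n i) \<longlonglongrightarrow> x i"
  shows "x \<in> Y"
  using S Y F lim
proof (induction S arbitrary: Y F x rule: finite_induct)
  case empty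
  have "F n i = 0" for n i using empty(1,2) unfolding K_subspace_def K_fun_def by blast
  then have "x i = 0" for i using empty(3)[of i] by (simp add: LIMSEQ_const_iff)
  then have "x = (\<lambda>i. 0)" by blast
  then show ?case using empty(1) unfolding K_subspace_def by blast
next
  case (insert i S)
  note red = K_subspace_reduce[OF K insert.prems(1) insert.hyps(2)]
  show ?case
  proof (cases "\<forall>x\<in>Y. x i = 0")
    case True
    then have "{x \<in> Y. x i = 0} = Y" by blast
    then show ?thesis using insert.IH[OF _ insert.prems(2,3)] red(1) by simp
  next
    case False
    then obtain y where y: "y \<in> Y" "y i = 1" using red(2) by blast
    have FK: "F n i \<in> K" for n using insert.prems(1,2) by (auto simp: K_subspace_def K_fun_def)
    have xK: "x i \<in> K" using closed_sequentially[OF K_closed_ops(11)[OF K] FK insert.prems(3)] .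
    \<comment> \<open>Subtracting a multiple of \<open>y\<close> eliminates the coordinate \<open>i\<close>.\<close>
    have "(\<lambda>j. x j - x i * y j) \<in> {x \<in> Y. x i = 0}"
    proof (rule insert.IH[OF red(1)])
      show "(\<lambda>j. F n j - F n i * y j) \<in> {x \<in> Y. x i = 0}" for n
        using K_subspace_lincomb[OF insert.prems(1) insert.prems(2) y(1) FK K] y(2) by simp
      show "(\<lambda>n. F n j - F n i * y j) \<longlonglongrightarrow> x j - x i * y j" for j
        by (intro tendsto_intros insert.prems(3))
    qed
    then have "(\<lambda>j. (x j - x i * y j) - (- x i) * y j) \<in> Y"
      by (intro K_subspace_lincomb[OF insert.prems(1) _ y(1) K_closed_ops(7)[OF K xK] K]) simp
    then show ?thesis by simp
  qed
qed

lemma functional_bounded: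
  assumes K: "K = \<real> \<or> K = UNIV" and S: "finite S" and Y: "K_subspace K S Y"
    and add: "\<And>x y. \<lbrakk>x \<in> Y; y \<in> Y\<rbrakk> \<Longrightarrow> l (\<lambda>i. x i + y i) = l x + l y"
    and hom: "\<And>c x. \<lbrakk>c \<in> K; x \<in> Y\<rbrakk> \<Longrightarrow> l (\<lambda>i. c * x i) = c * l x"
  shows "\<exists>C\<ge>0. \<forall>x\<in>Y. cmod (l x) \<le> C * (\<Sum>i\<in>S. cmod (x i))"
  using S Y add hom
proof (induction S arbitrary: Y rule: finite_induct)
  case empty
  have "l x = 0" if "x \<in> Y" for x
  proof -
    have "x = (\<lambda>i. 0 * x i)" using empty(1) that unfolding K_subspace_def K_fun_def by (auto simp: fun_eq_iff)
    then show ?thesis using empty(3)[OF K_closed_ops(1)[OF K] that] by simp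
  qed
  then show ?case by (intro exI[of _ 0]) simp
next
  case (insert i S)
  note red = K_subspace_reduce[OF K insert.prems(1) insert.hyps(2)]
  obtain C where C: "C \<ge> 0" "\<And>x. x \<in> Y \<Longrightarrow> x i = 0 \<Longrightarrow> cmod (l x) \<le> C * (\<Sum>i\<in>S. cmod (x i))"
    using insert.IH[OF red(1)] insert.prems(2,3) by auto
  show ?case
  proof (cases "\<forall>x\<in>Y. x i = 0")
    case True
    have "cmod (l x) \<le> C * (\<Sum>i\<in>insert i S. cmod (x i))" if "x \<in> Y" for x
    proof -
      have "x i = 0" using True that by blast
      then show ?thesis using C(2)[OF that] insert.hyps by simp
    qed
    then show ?thesis using C(1) by (intro exI[of _ C] conjI ballI)
  next
    case False
    then obtain y where y: "y \<in> Y" "y i = 1" using red(2) by blast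
    let ?s = "\<lambda>x. \<Sum>i\<in>S. cmod (x i)"
    have s0: "0 \<le> ?s x" for x :: "'a \<Rightarrow> complex" by (intro sum_nonneg) simp
    have "cmod (l x) \<le> (C + C * ?s y + cmod (l y)) * (\<Sum>i\<in>insert i S. cmod (x i))" if x: "x \<in> Y" for x
    proof -
      have xK: "x i \<in> K" using insert.prems(1) x by (auto simp: K_subspace_def K_fun_def)
      let ?z = "\<lambda>j. x j - x i * y j"
      have z: "?z \<in> Y" "?z i = 0" using K_subspace_lincomb[OF insert.prems(1) x y(1) xK K] y(2) by auto
      have yY: "(\<lambda>j. x i * y j) \<in> Y" by (rule K_subspace_scale[OF insert.prems(1) xK y(1)])
      have "l x = l ?z + x i * l y"
        using insert.prems(2)[OF z(1) yY] insert.prems(3)[OF xK y(1)] by simp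
      then have "cmod (l x) \<le> cmod (l ?z) + cmod (x i) * cmod (l y)"
        using norm_triangle_ineq[of "l ?z" "x i * l y"] by (simp add: norm_mult)
      also have "cmod (l ?z) \<le> C * ?s ?z" by (rule C(2)[OF z])
      also have "?s ?z \<le> ?s x + cmod (x i) * ?s y"
        unfolding sum_distrib_left sum.distrib[symmetric]
        unfolding norm_mult[symmetric] by (intro sum_mono norm_triangle_ineq4)
      finally have "cmod (l x) \<le> C * (?s x + cmod (x i) * ?s y) + cmod (x i) * cmod (l y)"
        using C(1) by (simp add: mult_left_mono)
      also have "\<dots> \<le> (C + C * ?s y + cmod (l y)) * (cmod (x i) + ?s x)"
        using C(1) s0[of x] s0[of y] by (simp add: algebra_simps)
      finally show ?thesis using insert.hyps by simp
    qed
    moreover have "0 \<le> C + C * ?s y + cmod (l y)" using C(1) s0[of y] by simp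
    ultimately show ?thesis by (intro exI[of _ "C + C * ?s y + cmod (l y)"] conjI ballI)
  qed
qed

locale linear_on =
  fixes K :: "complex set" and S :: "'i set" and X :: "('i \<Rightarrow> complex) set" and L :: "('i \<Rightarrow> complex) \<Rightarrow> 'i \<Rightarrow> complex"
  assumes K: "K = \<real> \<or> K = UNIV" and S: "finite S" and X: "K_subspace K S X"
    and L_X: "x \<in> X \<Longrightarrow> L x \<in> X"
    and L_add: "\<lbrakk>x \<in> X; y \<in> X\<rbrakk> \<Longrightarrow> L (\<lambda>i. x i + y i) = (\<lambda>i. L x i + L y i)"
    and L_hom: "\<lbrakk>c \<in> K; x \<in> X\<rbrakk> \<Longrightarrow> L (\<lambda>i. c * x i) = (\<lambda>i. c * L x i)"
begin

lemma X_add: "\<lbrakk>x \<in> X; y \<in> X\<rbrakk> \<Longrightarrow> (\<lambda>i. x i + y i) \<in> X" by (rule K_subspace_add[OF X])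
lemma X_scale: "\<lbrakk>c \<in> K; x \<in> X\<rbrakk> \<Longrightarrow> (\<lambda>i. c * x i) \<in> X" by (rule K_subspace_scale[OF X])
lemma X_fun: "x \<in> X \<Longrightarrow> x \<in> K_fun K S" using X by (auto simp: K_subspace_def)
lemma X_zero: "\<lbrakk>x \<in> X; i \<notin> S\<rbrakk> \<Longrightarrow> x i = 0" using X_fun by (simp add: K_fun_def)
lemma X_K: "x \<in> X \<Longrightarrow> x i \<in> K"
  using X_fun[of x] by (cases "i \<in> S") (simp_all add: K_fun_def K_closed_ops(1)[OF K])

abbreviation "norm1 x \<equiv> \<Sum>i\<in>S. cmod (x i)"

lemma L_bounded: "\<exists>C\<ge>0. \<forall>x\<in>X. norm1 (L x) \<le> C * norm1 x"
proof -
  have "\<exists>C\<ge>0. \<forall>x\<in>X. cmod (L x j) \<le> C * norm1 x" for j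
    by (rule functional_bounded[OF K S X]) (simp_all add: L_add L_hom)
  then obtain C where C: "\<And>j. 0 \<le> C j" "\<And>j x. x \<in> X \<Longrightarrow> cmod (L x j) \<le> C j * norm1 x" by metis
  show ?thesis
    by (intro exI[of _ "\<Sum>j\<in>S. C j"] conjI ballI sum_nonneg C(1))
       (simp add: sum_distrib_right sum_mono C(2))
qed

lemma power_X: "x \<in> X \<Longrightarrow> (L ^^ n) x \<in> X" by (induction n) (auto intro: L_X)

lemma power_bound:
  obtains C where "0 \<le> C" "\<And>x n i. x \<in> X \<Longrightarrow> cmod ((L ^^ n) x i) \<le> C ^ n * norm1 x"
proof -
  obtain C where C: "0 \<le> C" "\<And>x. x \<in> X \<Longrightarrow> norm1 (L x) \<le> C * norm1 x" using L_bounded by blast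
  have n1: "norm1 ((L ^^ n) x) \<le> C ^ n * norm1 x" if "x \<in> X" for x n
  proof (induction n)
    case (Suc n)
    have "norm1 ((L ^^ Suc n) x) \<le> C * norm1 ((L ^^ n) x)" using C(2)[OF power_X[OF that]] by simp
    also have "\<dots> \<le> C * (C ^ n * norm1 x)" using Suc C(1) by (intro mult_left_mono)
    finally show ?case by (simp add: mult.assoc)
  qed simp
  have "cmod ((L ^^ n) x i) \<le> norm1 ((L ^^ n) x)" if "x \<in> X" for x n i
  proof (cases "i \<in> S")
    case True
    then show ?thesis using S by (intro member_le_sum) auto
  next
    case False
    then show ?thesis using X_zero[OF power_X[OF that]] by (simp add: sum_nonneg)
  qed
  then have "cmod ((L ^^ n) x i) \<le> C ^ n * norm1 x" if "x \<in> X" for x n i using n1 that order_trans by blast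
  then show thesis using that C(1) by blast
qed

text \<open>
  The coefficients of the power series of \<open>exp (- t L) x\<close> in \<open>t\<close>.
\<close>

definition cf :: "('i \<Rightarrow> complex) \<Rightarrow> 'i \<Rightarrow> nat \<Rightarrow> complex" where "cf x i n = (-1) ^ n * (L ^^ n) x i / fact n"

lemma cf_summable: assumes x: "x \<in> X" shows "summable (\<lambda>n. cf x i n * z ^ n)"
proof -
  obtain C where C: "0 \<le> C" "\<And>x n i. x \<in> X \<Longrightarrow> cmod ((L ^^ n) x i) \<le> C ^ n * norm1 x" using power_bound by blast
  show ?thesis
  proof (rule summable_comparison_test')
    show "summable (\<lambda>n. norm1 x * ((C * cmod z) ^ n /\<^sub>R fact n))" by (intro summable_mult summable_exp_generic)
    fix n :: nat assume "0 \<le> n"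
    have "cmod (cf x i n * z ^ n) = cmod ((L ^^ n) x i) * (cmod z ^ n / fact n)"
      by (simp add: cf_def norm_mult norm_divide norm_power)
    also have "\<dots> \<le> (C ^ n * norm1 x) * (cmod z ^ n / fact n)" using C(2)[OF x] by (intro mult_right_mono) auto
    finally show "norm (cf x i n * z ^ n) \<le> norm1 x * ((C * cmod z) ^ n /\<^sub>R fact n)"
      by (simp add: power_mult_distrib divide_inverse mult_ac)
  qed
qed

lemma exp_eq:
  assumes x: "x \<in> X" shows "exp_semigroup L t x i = (\<Sum>n. cf x i n * complex_of_real t ^ n)"
proof -
  define A where "A = (\<lambda>x i. - complex_of_real t * L x i)"
  have tK: "(- complex_of_real t) ^ n \<in> K" for n
    using K_closed_ops(8)[OF K, of "(- t) ^ n"] by simp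
  have "(A ^^ n) x = (\<lambda>i. (- complex_of_real t) ^ n * (L ^^ n) x i)" for n
  proof (induction n)
    case (Suc n)
    have "(A ^^ Suc n) x = A (\<lambda>i. (- complex_of_real t) ^ n * (L ^^ n) x i)" using Suc by simp
    also have "\<dots> = (\<lambda>i. (- complex_of_real t) ^ Suc n * (L ^^ Suc n) x i)"
      unfolding A_def L_hom[OF tK power_X[OF x]] by (simp add: mult.assoc)
    finally show ?case .
  qed simp
  then show ?thesis
    unfolding exp_semigroup_def operator_exp_def A_def[symmetric] cf_def
    by (intro suminf_cong) (simp add: power_minus[of "complex_of_real t"])
qed

lemma power_add: "\<lbrakk>x \<in> X; y \<in> X\<rbrakk> \<Longrightarrow> (L ^^ n) (\<lambda>i. x i + y i) = (\<lambda>i. (L ^^ n) x i + (L ^^ n) y i)"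
  by (induction n) (simp_all add: L_add power_X)
lemma power_hom: "\<lbrakk>c \<in> K; x \<in> X\<rbrakk> \<Longrightarrow> (L ^^ n) (\<lambda>i. c * x i) = (\<lambda>i. c * (L ^^ n) x i)"
  by (induction n) (simp_all add: L_hom power_X)

lemma exp_add: "\<lbrakk>x \<in> X; y \<in> X\<rbrakk> \<Longrightarrow> exp_semigroup L t (\<lambda>i. x i + y i) i = exp_semigroup L t x i + exp_semigroup L t y i"
  using suminf_add[OF cf_summable cf_summable, of x y i "complex_of_real t" i "complex_of_real t"]
  by (simp add: exp_eq X_add cf_def power_add distrib_left add_divide_distrib distrib_right)

lemma exp_hom: "\<lbrakk>c \<in> K; x \<in> X\<rbrakk> \<Longrightarrow> exp_semigroup L t (\<lambda>i. c * x i) i = c * exp_semigroup L t x i"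
proof -
  assume c: "c \<in> K" and x: "x \<in> X"
  have "cf (\<lambda>i. c * x i) i n = c * cf x i n" for n
    by (simp add: cf_def power_hom[OF c x] mult.left_commute)
  then show ?thesis using suminf_mult[OF cf_summable[OF x], of c i "complex_of_real t"]
    by (simp add: exp_eq[OF x] exp_eq[OF X_scale[OF c x]] mult.assoc)
qed

lemma exp_minus: "x \<in> X \<Longrightarrow> exp_semigroup L t (\<lambda>i. - x i) i = - exp_semigroup L t x i"
  using exp_hom[OF K_closed_ops(7)[OF K K_closed_ops(2)[OF K]], of x t i] by simp

lemma X_minus: "x \<in> X \<Longrightarrow> (\<lambda>i. - x i) \<in> X"
  using X_scale[OF K_closed_ops(7)[OF K K_closed_ops(2)[OF K]], of x] by simp

lemma exp_derivative:
  assumes x: "x \<in> X"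
  shows "((\<lambda>t. (exp_semigroup L t x i - x i) / complex_of_real t) \<longlongrightarrow> - L x i) (at_right 0)"
proof -
  have "((\<lambda>z. \<Sum>n. cf x i n * z ^ n) has_field_derivative (\<Sum>n. diffs (cf x i) n * 0 ^ n)) (at 0)"
    by (rule termdiffs_strong_converges_everywhere[OF cf_summable[OF x]])
  moreover have "(\<Sum>n. diffs (cf x i) n * 0 ^ n) = - L x i"
    unfolding powser_zero by (simp add: diffs_def cf_def)
  moreover have "(\<Sum>n. cf x i n * 0 ^ n) = x i" unfolding powser_zero by (simp add: cf_def)
  ultimately have "((\<lambda>z. ((\<Sum>n. cf x i n * z ^ n) - x i) / z) \<longlongrightarrow> - L x i) (at 0)"
    by (simp add: has_field_derivative_iff)
  moreover have "filterlim complex_of_real (at 0) (at_right 0)"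
    unfolding filterlim_at
  proof
    show "\<forall>\<^sub>F t in at_right 0. complex_of_real t \<in> UNIV \<and> complex_of_real t \<noteq> 0"
      using eventually_at_right_less[of "0::real"] by eventually_elim simp
    show "(complex_of_real \<longlongrightarrow> 0) (at_right 0)" by (auto intro!: tendsto_eq_intros)
  qed
  ultimately have "((\<lambda>t. ((\<Sum>n. cf x i n * complex_of_real t ^ n) - x i) / complex_of_real t) \<longlongrightarrow> - L x i) (at_right 0)"
    by (rule filterlim_compose)
  then show ?thesis using exp_eq[OF x] by simp
qed


text \<open>
  The difference quotient of \<open>exp (- t L) z\<close> at \<open>z = x - w\<close> is
  considered coordinatewise. Where \<open>w i\<close> is positive, \<open>Re (z i) = c\<close>
  is the largest possible value, and so the real part of the difference quotient is not
  positive. The limit \<open>t \<rightarrow> 0\<close> gives the claim for \<open>- L z\<close>.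
  Invariance of the half-plane is assumed for real vectors only; \<open>z\<close> reduces to
  them because real vectors stay real.
\<close>

theorem form_of_remainder_nonneg:
  assumes c: "0 \<le> c"
    and ReX: "\<And>x. x \<in> X \<Longrightarrow> (\<lambda>i. complex_of_real (Re (x i))) \<in> X"
    and wX: "\<And>x. x \<in> X \<Longrightarrow> (\<lambda>i. complex_of_real (max (Re (x i) - c) 0)) \<in> X"
    and real: "\<And>y t i. \<lbrakk>y \<in> X; \<And>i. y i \<in> \<real>; 0 \<le> t; i \<in> S\<rbrakk> \<Longrightarrow> exp_semigroup L t y i \<in> \<real>"
    and inv: "\<And>y t i. \<lbrakk>y \<in> X; \<And>i. y i \<in> \<real>; \<And>i. i \<in> S \<Longrightarrow> Re (y i) \<le> c; 0 \<le> t; i \<in> S\<rbrakk> \<Longrightarrow> Re (exp_semigroup L t y i) \<le> c"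
    and m: "\<And>i. i \<in> S \<Longrightarrow> 0 \<le> m i"
    and x: "x \<in> X"
  defines "w \<equiv> \<lambda>i. complex_of_real (max (Re (x i) - c) 0)"
  shows "0 \<le> (\<Sum>i\<in>S. m i * Re (L (\<lambda>i. x i - w i) i * cnj (w i)))"
proof -
  define wr where "wr i = max (Re (x i) - c) 0" for i
  define z where "z = (\<lambda>i. x i - w i)"
  have zX: "z \<in> X"
    using X_add[OF x X_minus[OF wX[OF x]]] by (simp add: z_def w_def)
  have Re_z: "Re (z i) = Re (x i) - wr i" for i by (simp add: z_def w_def wr_def)
  have exp_le: "Re (exp_semigroup L t z i) \<le> c" if t: "0 \<le> t" and i: "i \<in> S" for t i
  proof -
    define p where "p = (\<lambda>i. complex_of_real (Re (z i)))"
    have p: "p \<in> X" "\<And>i. p i \<in> \<real>" "\<And>i. i \<in> S \<Longrightarrow> Re (p i) \<le> c"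
      using ReX[OF zX] by (auto simp: p_def Re_z wr_def)
    have "Re (exp_semigroup L t z i) = Re (exp_semigroup L t p i)"
    proof (cases "K = UNIV")
      case True
      define q where "q = (\<lambda>i. complex_of_real (Re (- \<i> * z i)))"
      have q: "q \<in> X" "\<And>i. q i \<in> \<real>" unfolding q_def
        using ReX[OF X_scale[OF _ zX, of "- \<i>"]] True by auto
      have iq: "(\<lambda>i. \<i> * q i) \<in> X" using X_scale[OF _ q(1), of "\<i>"] True by simp
      have "z = (\<lambda>i. p i + \<i> * q i)" by (simp add: p_def q_def fun_eq_iff complex_eq_iff)
      then have "exp_semigroup L t z i = exp_semigroup L t p i + \<i> * exp_semigroup L t q i"
        using exp_add[OF p(1) iq, of t i] exp_hom[OF _ q(1), of "\<i>" t i] True by simp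
      moreover have "Im (exp_semigroup L t q i) = 0" using real[OF q t i] by (simp add: complex_is_Real_iff)
      ultimately show ?thesis by simp
    next
      case False
      then have "z i \<in> \<real>" for i using X_K[OF zX] K by auto
      then have "z = p" by (simp add: p_def fun_eq_iff)
      then show ?thesis by simp
    qed
    then show ?thesis using inv[OF p t i] by simp
  qed
  have le: "(\<Sum>i\<in>S. m i * (Re ((exp_semigroup L t z i - z i) / complex_of_real t) * wr i)) \<le> 0" if t: "0 < t" for t
  proof (rule sum_nonpos)
    fix i assume i: "i \<in> S"
    have le0: "(Re (exp_semigroup L t z i) - Re (z i)) / t * wr i \<le> 0"
    proof (cases "wr i = 0")
      case False
      then have "Re (z i) = c" "0 < wr i" unfolding Re_z by (auto simp: wr_def max_def split: if_splits)
      then show ?thesis using exp_le[of t i] t i by (intro mult_nonpos_nonneg divide_nonpos_pos) auto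
    qed simp
    show "m i * (Re ((exp_semigroup L t z i - z i) / complex_of_real t) * wr i) \<le> 0"
      by (rule mult_nonneg_nonpos[OF m[OF i]]) (use le0 in \<open>simp only: Re_divide_of_real minus_complex.sel\<close>)
  qed
  have "(\<Sum>i\<in>S. m i * (Re (- L z i) * wr i)) \<le> 0"
  proof (rule tendsto_upperbound)
    show "((\<lambda>t. \<Sum>i\<in>S. m i * (Re ((exp_semigroup L t z i - z i) / complex_of_real t) * wr i))
       \<longlongrightarrow> (\<Sum>i\<in>S. m i * (Re (- L z i) * wr i))) (at_right 0)"
      by (intro tendsto_sum tendsto_mult tendsto_const tendsto_Re exp_derivative[OF zX])
    show "\<forall>\<^sub>F t in at_right 0. (\<Sum>i\<in>S. m i * (Re ((exp_semigroup L t z i - z i) / complex_of_real t) * wr i)) \<le> 0"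
      using eventually_at_right_less[of "0::real"] by eventually_elim (rule le)
  qed simp
  then have "0 \<le> (\<Sum>i\<in>S. m i * (Re (L z i) * wr i))" by (simp add: sum_negf)
  moreover have "Re (L z i * cnj (w i)) = Re (L z i) * wr i" for i by (simp add: w_def wr_def)
  ultimately show ?thesis by (simp add: z_def)
qed

end

section \<open>Sublattices\<close>

text \<open>
  A sublattice is closed under taking moduli, and the directional derivative of the modulus at
  the point \<open>cmod z\<close> in the direction of \<open>z\<close> is \<open>Re z\<close>.
  Difference quotients of the modulus are in the sublattice, and finite-dimensional subspaces
  are closed.
\<close>

lemma sublattice_Re:
  assumes K: "K = \<real> \<or> K = UNIV" and S: "finite S" and X: "sublattice K S X" and x: "x \<in> X"
  shows "(\<lambda>i. complex_of_real (Re (x i))) \<in> X"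
proof (rule K_subspace_closed[OF K S])
  show sub: "K_subspace K S X" using X by (simp add: sublattice_def)
  have mod: "(\<lambda>i. complex_of_real (cmod (y i))) \<in> X" if "y \<in> X" for y using X that by (simp add: sublattice_def)
  \<comment> \<open>The difference quotients \<open>(| |x| + \<epsilon> x | - |x|) / \<epsilon>\<close> with
    \<open>\<epsilon> = 1 / (n + 1)\<close>.\<close>
  define F where "F n = (\<lambda>i. complex_of_real (real (Suc n)) *
     (complex_of_real (cmod (complex_of_real (cmod (x i)) + complex_of_real (1 / real (Suc n)) * x i)) - 1 * complex_of_real (cmod (x i))))" for n
  show "F n \<in> X" for n
    unfolding F_def
    by (intro K_subspace_scale[OF sub] K_closed_ops(8)[OF K] K_subspace_lincomb[OF sub _ _ _ K] mod
        K_subspace_add[OF sub] x K_closed_ops(2)[OF K])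
  show "(\<lambda>n. F n i) \<longlonglongrightarrow> complex_of_real (Re (x i))" for i
  proof (cases "x i = 0")
    case True
    then show ?thesis by (simp add: F_def)
  next
    case False
    define r p where "r = cmod (x i)" and "p = Re (x i)"
    have r: "r > 0" using False by (simp add: r_def)
    have F_eq: "F n i = complex_of_real ((2 * r * p + r\<^sup>2 * (1 / Suc n)) /
         (sqrt (r\<^sup>2 + 2 * r * p * (1 / Suc n) + r\<^sup>2 * (1 / Suc n)\<^sup>2) + r))" for n
    proof -
      define \<epsilon> where "\<epsilon> = 1 / real (Suc n)"
      have \<epsilon>: "\<epsilon> > 0" "real (Suc n) = 1 / \<epsilon>" by (auto simp: \<epsilon>_def)
      define Q where "Q = cmod (complex_of_real r + complex_of_real \<epsilon> * x i)"
      have rsq: "r\<^sup>2 = p\<^sup>2 + (Im (x i))\<^sup>2" by (simp add: r_def p_def cmod_power2)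
      have Qsq: "Q\<^sup>2 = r\<^sup>2 + 2 * r * p * \<epsilon> + r\<^sup>2 * \<epsilon>\<^sup>2"
      proof -
        have "Q\<^sup>2 = (r + \<epsilon> * p)\<^sup>2 + (\<epsilon> * Im (x i))\<^sup>2" unfolding Q_def cmod_power2 by (simp add: p_def)
        also have "\<dots> = r\<^sup>2 + 2 * r * p * \<epsilon> + (p\<^sup>2 + (Im (x i))\<^sup>2) * \<epsilon>\<^sup>2"
          by (simp add: power2_eq_square algebra_simps)
        finally show ?thesis by (simp add: rsq)
      qed
      have Q0: "0 \<le> Q" by (simp add: Q_def)
      have sq: "sqrt (r\<^sup>2 + 2 * r * p * \<epsilon> + r\<^sup>2 * \<epsilon>\<^sup>2) = Q" using Q0 by (simp flip: Qsq)
      have "(Q - r) * (Q + r) = \<epsilon> * (2 * r * p + r\<^sup>2 * \<epsilon>)"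
        using Qsq by (simp add: power2_eq_square algebra_simps)
      then have "(1 / \<epsilon>) * (Q - r) = (2 * r * p + r\<^sup>2 * \<epsilon>) / (Q + r)"
        using r Q0 \<epsilon> by (simp add: field_simps)
      moreover have "F n i = complex_of_real ((1 / \<epsilon>) * (Q - r))"
        unfolding F_def \<epsilon>(2) r_def[symmetric] Q_def by simp
      ultimately show ?thesis unfolding \<epsilon>_def[symmetric] sq by simp
    qed
    have "(\<lambda>n. 1 / real (Suc n)) \<longlonglongrightarrow> 0" by (rule LIMSEQ_Suc) real_asymp
    then have "(\<lambda>n. (2 * r * p + r\<^sup>2 * (1 / Suc n)) /
         (sqrt (r\<^sup>2 + 2 * r * p * (1 / Suc n) + r\<^sup>2 * (1 / Suc n)\<^sup>2) + r))
       \<longlonglongrightarrow> (2 * r * p + r\<^sup>2 * 0) / (sqrt (r\<^sup>2 + 2 * r * p * 0 + r\<^sup>2 * 0\<^sup>2) + r)"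
      using r by (intro tendsto_intros) auto
    moreover have "(2 * r * p + r\<^sup>2 * 0) / (sqrt (r\<^sup>2 + 2 * r * p * 0 + r\<^sup>2 * 0\<^sup>2) + r) = p" using r by simp
    ultimately have "(\<lambda>n. (2 * r * p + r\<^sup>2 * (1 / Suc n)) /
         (sqrt (r\<^sup>2 + 2 * r * p * (1 / Suc n) + r\<^sup>2 * (1 / Suc n)\<^sup>2) + r)) \<longlonglongrightarrow> p" by (simp only:)
    then show ?thesis unfolding F_eq p_def[symmetric] by (rule tendsto_of_real)
  qed
qed

lemma sublattice_pos:
  assumes K: "K = \<real> \<or> K = UNIV" and X: "sublattice K S X" and y: "y \<in> X" "\<And>i. y i \<in> \<real>"
  shows "(\<lambda>i. complex_of_real (max (Re (y i)) 0)) \<in> X"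
proof -
  have sub: "K_subspace K S X" using X by (simp add: sublattice_def)
  have "(\<lambda>i. complex_of_real (1/2) * (complex_of_real (cmod (y i)) + y i)) \<in> X"
    using X y(1) by (intro K_subspace_scale[OF sub K_closed_ops(8)[OF K]] K_subspace_add[OF sub]) (auto simp: sublattice_def)
  moreover have "complex_of_real (1/2) * (complex_of_real (cmod (y i)) + y i) = complex_of_real (max (Re (y i)) 0)" for i
  proof -
    obtain s where s: "y i = complex_of_real s" using y(2)[of i] by (auto simp: Reals_def)
    show ?thesis unfolding s by (simp add: max_def abs_if flip: of_real_add)
  qed
  ultimately show ?thesis by simp
qed

text \<open>
  The scaling \<open>(s - c)\<^sup>+ = s - c * min (s / c) 1\<close> reduces clipping at
  \<open>c\<close> to clipping at \<open>1\<close>.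
\<close>

lemma stonean_clip:
  assumes K: "K = \<real> \<or> K = UNIV" and X: "stonean_sublattice K S X" and y: "y \<in> X" "\<And>i. y i \<in> \<real>" and c: "0 < c"
  shows "(\<lambda>i. complex_of_real (max (Re (y i) - c) 0)) \<in> X"
proof -
  have sub: "K_subspace K S X" using X by (simp add: sublattice_def stonean_sublattice_def)
  have sc: "(\<lambda>i. complex_of_real (1 / c) * y i) \<in> X" by (intro K_subspace_scale[OF sub K_closed_ops(8)[OF K] y(1)])
  have "(\<lambda>i. complex_of_real (min (Re (complex_of_real (1 / c) * y i)) 1)) \<in> X"
  proof -
    have st: "(\<lambda>i. complex_of_real (min (Re (x i)) 1)) \<in> X" if "x \<in> X" "\<forall>i. x i \<in> \<real>" for x
      using X that by (simp add: stonean_sublattice_def)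
    show ?thesis by (rule st[OF sc]) (intro allI Reals_mult Reals_of_real y(2))
  qed
  then have "(\<lambda>i. y i - complex_of_real c * complex_of_real (min (Re (complex_of_real (1 / c) * y i)) 1)) \<in> X"
    by (intro K_subspace_lincomb[OF sub y(1) _ K_closed_ops(8)[OF K] K])
  moreover have "y i - complex_of_real c * complex_of_real (min (Re (complex_of_real (1 / c) * y i)) 1) = complex_of_real (max (Re (y i) - c) 0)" for i
  proof -
    obtain s where s: "y i = complex_of_real s" using y(2)[of i] by (auto simp: Reals_def)
    have "s - c * min (s / c) 1 = max (s - c) 0" using c by (simp add: min_def max_def field_simps)
    then show ?thesis unfolding s by (simp flip: of_real_mult of_real_diff)
  qed
  ultimately show ?thesis by simp
qed


section \<open>Half-planes\<close>

text \<open>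
  The displacement of \<open>z\<close> from its nearest point in the half-plane
  \<open>{z. Re z \<le> c}\<close>.
\<close>

definition clip :: "real \<Rightarrow> complex \<Rightarrow> complex" where
  "clip c z = complex_of_real (max (Re z - c) 0)"

lemma cmod_le_iff: "cmod z \<le> cmod w \<longleftrightarrow> (Re z)\<^sup>2 + (Im z)\<^sup>2 \<le> (Re w)\<^sup>2 + (Im w)\<^sup>2"
  by (simp add: cmod_def)

lemma clip_lipschitz: "cmod (clip c z - clip c w) \<le> cmod (z - w)"
proof -
  have "cmod (clip c z - clip c w) = \<bar>max (Re z - c) 0 - max (Re w - c) 0\<bar>"
    unfolding clip_def of_real_diff[symmetric] norm_of_real ..
  also have "\<dots> \<le> \<bar>Re (z - w)\<bar>" by (auto simp: max_def)
  also have "\<dots> \<le> cmod (z - w)" by (rule abs_Re_le_cmod)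
  finally show ?thesis .
qed

text \<open>The map folds the plane along the line \<open>Re z = c\<close>.\<close>

lemma reflect_lipschitz: "cmod ((z - 2 * clip c z) - (w - 2 * clip c w)) \<le> cmod (z - w)"
proof -
  have "\<bar>Re ((z - 2 * clip c z) - (w - 2 * clip c w))\<bar> \<le> \<bar>Re (z - w)\<bar>"
    by (auto simp: clip_def max_def)
  then have "(Re ((z - 2 * clip c z) - (w - 2 * clip c w)))\<^sup>2 \<le> (Re (z - w))\<^sup>2" by (simp only: abs_le_square_iff)
  moreover have "Im ((z - 2 * clip c z) - (w - 2 * clip c w)) = Im (z - w)" by (simp add: clip_def)
  ultimately show ?thesis unfolding cmod_le_iff by simp
qed

lemma clip_0: "0 \<le> c \<Longrightarrow> clip c 0 = 0" by (simp add: clip_def)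

text \<open>
  The pointwise version of the second hypothesis of \<open>growth_of_remainder\<close>. The
  right-hand side is the distance of \<open>z + w\<close> from a point of the half-plane, namely
  from the projection of \<open>z\<close>.
\<close>

lemma clip_add: "cmod (clip c (z + w)) \<le> cmod (clip c z + w)"
proof -
  have "cmod (clip c (z + w)) = max (Re z + Re w - c) 0" by (simp add: clip_def)
  also have "\<dots> \<le> \<bar>Re (clip c z + w)\<bar>" by (auto simp: clip_def max_def)
  also have "\<dots> \<le> cmod (clip c z + w)" by (rule abs_Re_le_cmod)
  finally show ?thesis .
qed

lemma clip_zero_iff: "clip c z = 0 \<longleftrightarrow> Re z \<le> c" by (auto simp: clip_def max_def)

lemma clip_measurable: "clip c \<in> borel_measurable borel"
  unfolding clip_def[abs_def] by (intro borel_measurable_continuous_onI continuous_intros)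

context edge
begin

lemma clip_contraction: "0 \<le> c \<Longrightarrow> contraction (clip c)"
  using clip_lipschitz clip_0 K_closed_ops(8)[OF K] by (auto simp: contraction_def clip_def)

lemma reflect_contraction: "0 \<le> c \<Longrightarrow> contraction (\<lambda>z. z - 2 * clip c z)"
  unfolding contraction_def
proof (intro conjI allI subsetI reflect_lipschitz)
  assume "0 \<le> c"
  then show "0 - 2 * clip c 0 = 0" by (simp add: clip_0)
next
  fix y assume "y \<in> (\<lambda>z. z - 2 * clip c z) ` K"
  then obtain z where z: "z \<in> K" "y = z - complex_of_real (2 * max (Re z - c) 0)" by (auto simp: clip_def)
  show "y \<in> K" unfolding z(2) by (rule K_closed_ops(4)[OF K z(1) K_closed_ops(8)[OF K]])
qed

end

lemma L2_clip:
  assumes K: "K = \<real> \<or> K = UNIV" and f: "f \<in> L2_fun K M" and c: "0 \<le> c"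
  shows "(\<lambda>x. clip c (f x)) \<in> L2_fun K M"
  unfolding L2_fun_def mem_Collect_eq
proof (intro conjI ballI)
  show m: "(\<lambda>x. clip c (f x)) \<in> borel_measurable M"
    using f by (intro measurable_compose[OF _ clip_measurable]) (simp add: L2_fun_def)
  show "clip c (f x) \<in> K" for x unfolding clip_def by (rule K_closed_ops(8)[OF K])
  show "integrable M (\<lambda>x. (cmod (clip c (f x)))\<^sup>2)"
  proof (rule Bochner_Integration.integrable_bound)
    show "integrable M (\<lambda>x. (cmod (f x))\<^sup>2)" using f by (simp add: L2_fun_def)
    have "cmod (clip c z) \<le> cmod z" for z using clip_lipschitz[of c z 0] clip_0[OF c] by simp
    then show "AE x in M. norm ((cmod (clip c (f x)))\<^sup>2) \<le> norm ((cmod (f x))\<^sup>2)"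
      by (intro always_eventually allI) (simp add: power_mono)
  qed (intro borel_measurable_power measurable_compose[OF m borel_measurable_norm])
qed

lemma L2_zero_imp_AE:
  assumes "f \<in> L2_fun K M" "L2_ip M f f = 0" shows "AE x in M. f x = 0"
proof -
  have "AE x in M. (cmod (f x))\<^sup>2 = 0"
    using assms by (subst integral_nonneg_eq_0_iff_AE[symmetric]) (auto simp: L2_fun_def L2_ip_self)
  then show ?thesis by eventually_elim simp
qed

section \<open>The Hilbert space of a graph\<close>

locale graph_form =
  fixes K :: "complex set" and G :: "('v, 'e) measured_graph" and X :: "('v, 'e) tfun set"
    and L :: "('v, 'e) tfun \<Rightarrow> ('v, 'e) tfun"
  assumes K: "K = \<real> \<or> K = UNIV" and wf: "wf_measured_graph G"
    and X: "K_subspace K (trace_index G) X" and L: "selfadjoint_in K X (trace_inner G) L"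
begin

abbreviation "lft e \<equiv> mg_left G e"
abbreviation "rgt e \<equiv> mg_right G e"
abbreviation "ms e \<equiv> mg_edge_measure G e"
abbreviation "wt v \<equiv> mg_vertex_weight G v"
abbreviation "H \<equiv> H_space K G"

lemma finite_E1: "finite (E1 G)"
proof -
  have "finite (arcs (mg_digraph G))" using wf by (simp add: wf_measured_graph_def fin_digraph.finite_arcs)
  then show ?thesis by (simp add: E1_def)
qed

lemma finite_V1: "finite (V1 G)"
proof -
  have "finite (verts (mg_digraph G))" using wf by (simp add: wf_measured_graph_def fin_digraph.finite_verts)
  then show ?thesis by (simp add: V1_def)
qed

lemma wt_pos: "v \<in> V1 G \<Longrightarrow> 0 < wt v"
  using wf by (auto simp: wf_measured_graph_def V1_def less_le)

lemma edge_E1: assumes "e \<in> E1 G" shows "edge K (lft e) (rgt e) (ms e)"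
proof -
  have "e \<in> arcs (mg_digraph G)" "emeasure (ms e) (space (ms e)) \<noteq> 0" using assms by (auto simp: E1_def)
  moreover have "\<forall>e\<in>arcs (mg_digraph G). lft e < rgt e \<and> sets (ms e) = sets (restrict_space borel {lft e..rgt e}) \<and>
      finite_measure (ms e) \<and> (emeasure (ms e) (space (ms e)) = 0 \<or> lft e \<in> spt (ms e) \<and> rgt e \<in> spt (ms e) \<and>
         emeasure (ms e) {lft e, rgt e} = 0)"
    using wf by (simp add: wf_measured_graph_def)
  ultimately have "lft e < rgt e" "sets (ms e) = sets (restrict_space borel {lft e..rgt e})"
    "finite_measure (ms e)" "lft e \<in> spt (ms e)" "rgt e \<in> spt (ms e)" by blast+
  then show ?thesis using K by (intro edge.intro)
qed

lemma finite_ms: "e \<in> E1 G \<Longrightarrow> finite_measure (ms e)" using edge.finite_\<mu>[OF edge_E1] .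

lemma finite_trace_index: "finite (trace_index G)"
  unfolding trace_index_def using finite_E1 finite_V1 by simp

definition r :: "('v, 'e) gfun \<Rightarrow> ('v, 'e) gfun \<Rightarrow> real" where "r f g = Re (H_inner G f g)"

lemma r_eq: "r f g = (\<Sum>e\<in>E1 G. L2_ip (ms e) (edge_part f e) (edge_part g e))
    + (\<Sum>v\<in>V1 G. wt v * Re (f (Inr v) * cnj (g (Inr v))))"
  by (simp add: r_def H_inner_def L2_ip_def mult.commute)

lemma H_edge: "f \<in> H \<Longrightarrow> e \<in> E1 G \<Longrightarrow> edge_part f e \<in> L2_fun K (ms e)" by (simp add: H_space_def)
lemma H_vertex: "f \<in> H \<Longrightarrow> v \<in> V1 G \<Longrightarrow> f (Inr v) \<in> K" by (simp add: H_space_def)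

lemma edge_part_ops: "edge_part (f + g) e = edge_part f e + edge_part g e" "edge_part (f - g) e = edge_part f e - edge_part g e"
  "edge_part (c *\<^sub>R f) e = c *\<^sub>R edge_part f e"
  by (simp_all add: fun_eq_iff scaleR_fun_def)

lemma H_subspace: "subspace H"
  unfolding subspace_def
proof (intro conjI ballI allI)
  note L2 = L2_subspace[OF K]
  have z: "edge_part 0 e = 0" for e :: 'e by (simp add: fun_eq_iff)
  show "0 \<in> H" unfolding H_space_def mem_Collect_eq z
    using subspace_0[OF L2] K_closed_ops(1)[OF K] by simp
  fix f g assume fg: "f \<in> H" "g \<in> H"
  show "f + g \<in> H" unfolding H_space_def mem_Collect_eq edge_part_ops
  proof (intro conjI ballI)
    show "edge_part f e + edge_part g e \<in> L2_fun K (ms e)" if "e \<in> E1 G" for e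
      by (intro subspace_add[OF L2] H_edge fg that)
    show "(f + g) (Inr v) \<in> K" if "v \<in> V1 G" for v
      unfolding plus_fun_apply by (intro K_closed_ops(3)[OF K] H_vertex fg that)
  qed
next
  note L2 = L2_subspace[OF K]
  fix c :: real and f assume f: "f \<in> H"
  show "c *\<^sub>R f \<in> H" unfolding H_space_def mem_Collect_eq edge_part_ops
  proof (intro conjI ballI)
    show "c *\<^sub>R edge_part f e \<in> L2_fun K (ms e)" if "e \<in> E1 G" for e
      by (intro subspace_scale[OF L2] H_edge f that)
    show "(c *\<^sub>R f) (Inr v) \<in> K" if "v \<in> V1 G" for v
      unfolding scaleR_fun_def by (intro K_closed_ops(9)[OF K] H_vertex f that)
  qed
qed

sublocale H: semi_inner_product H r
proof
  show "subspace H" by (rule H_subspace)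
next
  fix f g h assume *: "f \<in> H" "g \<in> H" "h \<in> H"
  have "L2_ip (ms e) (edge_part (f + g) e) (edge_part h e)
     = L2_ip (ms e) (edge_part f e) (edge_part h e) + L2_ip (ms e) (edge_part g e) (edge_part h e)" if "e \<in> E1 G" for e
    unfolding edge_part_ops by (intro semi_inner_product.r_add[OF L2_semi_inner_product[OF K]] H_edge * that)
  then show "r (f + g) h = r f h + r g h" unfolding r_eq by (simp add: sum.distrib algebra_simps)
next
  fix f h c assume *: "f \<in> H" "h \<in> H"
  have "L2_ip (ms e) (edge_part (c *\<^sub>R f) e) (edge_part h e)
     = c * L2_ip (ms e) (edge_part f e) (edge_part h e)" if "e \<in> E1 G" for e
    unfolding edge_part_ops by (intro semi_inner_product.r_scale[OF L2_semi_inner_product[OF K]] H_edge * that)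
  then show "r (c *\<^sub>R f) h = c * r f h"
    unfolding r_eq by (simp add: sum_distrib_left scaleR_fun_def algebra_simps)
next
  fix f g assume *: "f \<in> H" "g \<in> H"
  have "L2_ip (ms e) (edge_part f e) (edge_part g e) = L2_ip (ms e) (edge_part g e) (edge_part f e)" if "e \<in> E1 G" for e
    by (intro semi_inner_product.r_sym[OF L2_semi_inner_product[OF K]] H_edge * that)
  then show "r f g = r g f" unfolding r_eq by (simp add: algebra_simps)
next
  fix f assume "f \<in> H"
  show "0 \<le> r f f" unfolding r_eq
  proof (intro add_nonneg_nonneg sum_nonneg)
    show "0 \<le> wt v * Re (f (Inr v) * cnj (f (Inr v)))" if "v \<in> V1 G" for v
      using wt_pos[OF that] by simp
  qed (simp add: L2_ip_self)
qed

lemma N_sq_eq: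
  assumes f: "f \<in> H"
  shows "(H.N f)\<^sup>2 = (\<Sum>e\<in>E1 G. L2_ip (ms e) (edge_part f e) (edge_part f e))
    + (\<Sum>v\<in>V1 G. wt v * (cmod (f (Inr v)))\<^sup>2)"
proof -
  have "Re (z * cnj z) = (cmod z)\<^sup>2" for z by (simp add: cmod_power2) (simp add: power2_eq_square)
  then show ?thesis by (simp only: H.N_sq[OF f] r_eq)
qed

lemma N_edge_le:
  assumes "f \<in> H" "e \<in> E1 G" shows "L2_ip (ms e) (edge_part f e) (edge_part f e) \<le> (H.N f)\<^sup>2"
proof -
  have "L2_ip (ms e) (edge_part f e) (edge_part f e) \<le> (\<Sum>e\<in>E1 G. L2_ip (ms e) (edge_part f e) (edge_part f e))"
    by (rule member_le_sum[OF assms(2) _ finite_E1]) (simp add: L2_ip_self)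
  moreover have "0 \<le> (\<Sum>v\<in>V1 G. wt v * (cmod (f (Inr v)))\<^sup>2)"
    using wt_pos by (intro sum_nonneg) (simp add: less_imp_le)
  ultimately show ?thesis unfolding N_sq_eq[OF assms(1)] by linarith
qed

lemma N_vertex_le:
  assumes "f \<in> H" "v \<in> V1 G" shows "wt v * (cmod (f (Inr v)))\<^sup>2 \<le> (H.N f)\<^sup>2"
proof -
  have "wt v * (cmod (f (Inr v)))\<^sup>2 \<le> (\<Sum>v\<in>V1 G. wt v * (cmod (f (Inr v)))\<^sup>2)"
    using wt_pos by (intro member_le_sum[OF assms(2) _ finite_V1]) (simp add: less_imp_le)
  moreover have "0 \<le> (\<Sum>e\<in>E1 G. L2_ip (ms e) (edge_part f e) (edge_part f e))"
    by (intro sum_nonneg) (simp add: L2_ip_self)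
  ultimately show ?thesis unfolding N_sq_eq[OF assms(1)] by linarith
qed

text \<open>The space is a finite direct sum, and completeness holds in each summand.\<close>

lemma H_complete:
  assumes F: "\<And>n::nat. F n \<in> H" and Cau: "\<And>\<epsilon>. \<epsilon> > 0 \<Longrightarrow> \<exists>k. \<forall>m\<ge>k. \<forall>n\<ge>k. H.N (F m - F n) < \<epsilon>"
  shows "\<exists>f\<in>H. (\<lambda>n. H.N (F n - f)) \<longlonglongrightarrow> 0"
proof -
  have Fd: "F m - F n \<in> H" for m n by (rule H.closed_ops(3)[OF F F])
  have "\<exists>g. g \<in> L2_fun K (ms e) \<and> (\<lambda>n. semi_inner_product.N (L2_ip (ms e)) (edge_part (F n) e - g)) \<longlonglongrightarrow> 0"
    if e: "e \<in> E1 G" for e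
  proof -
    interpret E: semi_hilbert "L2_fun K (ms e)" "L2_ip (ms e)" by (rule L2_semi_hilbert[OF K finite_ms[OF e]])
    have "E.N (edge_part (F m) e - edge_part (F n) e) \<le> H.N (F m - F n)" for m n
    proof (rule power2_le_imp_le)
      show "(E.N (edge_part (F m) e - edge_part (F n) e))\<^sup>2 \<le> (H.N (F m - F n))\<^sup>2"
        using N_edge_le[OF Fd e, of m n] E.N_sq[OF E.closed_ops(3)[OF H_edge[OF F e] H_edge[OF F e]], of m n]
        unfolding edge_part_ops by simp
    qed (simp add: Fd)
    then have "\<exists>k. \<forall>m\<ge>k. \<forall>n\<ge>k. E.N (edge_part (F m) e - edge_part (F n) e) < \<epsilon>" if "\<epsilon> > 0" for \<epsilon>
      using Cau[OF that] le_less_trans by (meson le_less_trans)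
    then show ?thesis using E.complete[of "\<lambda>n. edge_part (F n) e"] H_edge[OF F e] by auto
  qed
  then obtain g where g: "\<And>e. e \<in> E1 G \<Longrightarrow> g e \<in> L2_fun K (ms e)"
    "\<And>e. e \<in> E1 G \<Longrightarrow> (\<lambda>n. semi_inner_product.N (L2_ip (ms e)) (edge_part (F n) e - g e)) \<longlonglongrightarrow> 0"
    by metis
  have "\<exists>z. (\<lambda>n. F n (Inr v)) \<longlonglongrightarrow> z" if v: "v \<in> V1 G" for v
  proof -
    have "Cauchy (\<lambda>n. F n (Inr v))"
    proof (rule CauchyI)
      fix \<epsilon> :: real assume \<epsilon>: "0 < \<epsilon>"
      have pos: "0 < sqrt (wt v) * \<epsilon>" using wt_pos[OF v] \<epsilon> by simp
      obtain k where k: "\<forall>m\<ge>k. \<forall>n\<ge>k. H.N (F m - F n) < sqrt (wt v) * \<epsilon>" by (rule exE[OF Cau[OF pos]])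
      have "norm (F m (Inr v) - F n (Inr v)) < \<epsilon>" if "m \<ge> k" "n \<ge> k" for m n
      proof -
        have "(sqrt (wt v) * cmod (F m (Inr v) - F n (Inr v)))\<^sup>2 \<le> (H.N (F m - F n))\<^sup>2"
          using N_vertex_le[OF Fd v, of m n] wt_pos[OF v] by (simp add: power_mult_distrib)
        then have "sqrt (wt v) * cmod (F m (Inr v) - F n (Inr v)) \<le> H.N (F m - F n)"
          by (rule power2_le_imp_le) (simp add: Fd)
        also have "\<dots> < sqrt (wt v) * \<epsilon>" using k that by blast
        finally show ?thesis using wt_pos[OF v] by simp
      qed
      then show "\<exists>M. \<forall>m\<ge>M. \<forall>n\<ge>M. norm (F m (Inr v) - F n (Inr v)) < \<epsilon>" by blast
    qed
    then show ?thesis by (simp add: Cauchy_convergent_iff convergent_def)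
  qed
  then obtain z where z: "\<And>v. v \<in> V1 G \<Longrightarrow> (\<lambda>n. F n (Inr v)) \<longlonglongrightarrow> z v" by metis
  define f where "f i = (case i of Inl (e, x) \<Rightarrow> g e x | Inr v \<Rightarrow> z v)" for i
  have fe: "edge_part f e = g e" "f (Inr v) = z v" for e v by (simp_all add: f_def)
  have fH: "f \<in> H" unfolding H_space_def mem_Collect_eq fe
  proof (intro conjI ballI g(1))
    show "z v \<in> K" if "v \<in> V1 G" for v
      by (rule closed_sequentially[OF K_closed_ops(11)[OF K] H_vertex[OF F that] z[OF that]])
  qed
  have FfH: "F n - f \<in> H" for n by (rule H.closed_ops(3)[OF F fH])
  have "(\<lambda>n. (H.N (F n - f))\<^sup>2) \<longlonglongrightarrow> (\<Sum>e\<in>E1 G. 0\<^sup>2) + (\<Sum>v\<in>V1 G. wt v * (cmod 0)\<^sup>2)"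
    unfolding N_sq_eq[OF FfH]
  proof (intro tendsto_add tendsto_sum)
    fix e assume e: "e \<in> E1 G"
    interpret E: semi_inner_product "L2_fun K (ms e)" "L2_ip (ms e)" by (rule L2_semi_inner_product[OF K])
    have "(\<lambda>n. (E.N (edge_part (F n) e - g e))\<^sup>2) \<longlonglongrightarrow> 0\<^sup>2" by (intro tendsto_power g(2) e)
    then show "(\<lambda>n. L2_ip (ms e) (edge_part (F n - f) e) (edge_part (F n - f) e)) \<longlonglongrightarrow> 0\<^sup>2"
      unfolding edge_part_ops fe E.N_sq[OF E.closed_ops(3)[OF H_edge[OF F e] g(1)[OF e]]] .
  next
    fix v assume v: "v \<in> V1 G"
    have "(\<lambda>n. wt v * (cmod (F n (Inr v) - z v))\<^sup>2) \<longlonglongrightarrow> wt v * (cmod (z v - z v))\<^sup>2"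
      by (intro tendsto_intros z v)
    then show "(\<lambda>n. wt v * (cmod ((F n - f) (Inr v)))\<^sup>2) \<longlonglongrightarrow> wt v * (cmod 0)\<^sup>2" by (simp add: fe)
  qed
  then have "(\<lambda>n. (H.N (F n - f))\<^sup>2) \<longlonglongrightarrow> 0" by simp
  then have "(\<lambda>n. sqrt ((H.N (F n - f))\<^sup>2)) \<longlonglongrightarrow> sqrt 0" by (rule tendsto_real_sqrt)
  then have "(\<lambda>n. H.N (F n - f)) \<longlonglongrightarrow> 0" using H.N_nonneg[OF FfH] by simp
  then show ?thesis using fH by (rule bexI)
qed

sublocale H: semi_hilbert H r
  by unfold_locales (rule H_complete)


section \<open>The form\<close>

abbreviation "tr u \<equiv> trace_map G (iota K G u)"
abbreviation "\<iota> e u \<equiv> iota_edge K (lft e) (rgt e) (ms e) (edge_part u e)"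
abbreviation "der e u \<equiv> weak_deriv K (lft e) (rgt e) (\<iota> e u)"
abbreviation "En e u \<equiv> (LINT t|lebesgue_Ioo (lft e) (rgt e). (cmod (der e u t))\<^sup>2)"

lemma iota_simps:
  "e \<in> E1 G \<Longrightarrow> edge_part (iota K G u) e = \<iota> e u" "v \<in> V1 G \<Longrightarrow> iota K G u (Inr v) = u (Inr v)"
  by (simp_all add: iota_def)

lemma tr_simps:
  "e \<in> E1 G \<Longrightarrow> tr u (Inl (e, 0)) = \<iota> e u (lft e)" "e \<in> E1 G \<Longrightarrow> tr u (Inl (e, Suc 0)) = \<iota> e u (rgt e)"
  "v \<in> V1 G \<Longrightarrow> tr u (Inr v) = u (Inr v)" "i \<notin> trace_index G \<Longrightarrow> tr u i = 0"
  by (auto simp: trace_map_def iota_def trace_index_def)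

lemma trace_index_cases:
  assumes "i \<in> trace_index G"
  obtains e where "e \<in> E1 G" "i = Inl (e, 0)" | e where "e \<in> E1 G" "i = Inl (e, Suc 0)" | v where "v \<in> V1 G" "i = Inr v"
  using assms by (auto simp: trace_index_def)

text \<open>
  The weights that turn the scalar product of the trace space into a single sum over its index
  set.
\<close>

definition tw :: "('e \<times> nat) + 'v \<Rightarrow> real" where "tw i = (case i of Inl _ \<Rightarrow> 1 | Inr v \<Rightarrow> wt v)"

lemma tw_nonneg: "i \<in> trace_index G \<Longrightarrow> 0 \<le> tw i"
  using wt_pos by (auto simp: trace_index_def tw_def less_imp_le)

lemma Re_trace_inner: "Re (trace_inner G \<xi> \<eta>) = (\<Sum>i\<in>trace_index G. tw i * Re (\<xi> i * cnj (\<eta> i)))"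
  unfolding trace_index_def trace_inner_def using finite_E1 finite_V1
  by (subst sum.Plus) (simp_all add: tw_def mult.commute)

lemma Re_tau: "Re (tau K G L u w) = (\<Sum>e\<in>E1 G. L2_ip (lebesgue_Ioo (lft e) (rgt e)) (der e u) (der e w))
    + Re (trace_inner G (L (tr u)) (tr w))"
  unfolding tau_def by (simp add: L2_ip_def iota_simps)

sublocale L: linear_on K "trace_index G" X L
  using K finite_trace_index X L unfolding selfadjoint_in_def by unfold_locales simp_all

definition w :: "real \<Rightarrow> ('v, 'e) gfun \<Rightarrow> ('v, 'e) gfun" where "w c f = (\<lambda>i. clip c (f i))"

lemma D_tau_H: "u \<in> D_tau K G X \<Longrightarrow> u \<in> H" by (simp add: D_tau_def D_iota_def)
lemma D_tau_edge: "u \<in> D_tau K G X \<Longrightarrow> e \<in> E1 G \<Longrightarrow> edge_part u e \<in> D_iota_edge K (lft e) (rgt e) (ms e)"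
  by (simp add: D_tau_def D_iota_def)
lemma D_tau_X: "u \<in> D_tau K G X \<Longrightarrow> tr u \<in> X" by (simp add: D_tau_def)

lemma w_H: assumes c: "0 \<le> c" and f: "f \<in> H" shows "w c f \<in> H"
  unfolding H_space_def w_def mem_Collect_eq
proof (intro conjI ballI)
  show "(\<lambda>x. clip c (f (Inl (e, x)))) \<in> L2_fun K (ms e)" if "e \<in> E1 G" for e
    by (rule L2_clip[OF K H_edge[OF f that] c])
  show "clip c (f (Inr v)) \<in> K" for v unfolding clip_def by (rule K_closed_ops(8)[OF K])
qed

lemma w_add:
  assumes c: "0 \<le> c" and fg: "f \<in> H" "g \<in> H"
  shows "H.N (w c (f + g)) \<le> H.N (w c f + g)"
proof (rule power2_le_imp_le)
  have 1: "w c (f + g) \<in> H" by (intro w_H c H.closed_ops fg)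
  have 2: "w c f + g \<in> H" by (intro w_H c H.closed_ops fg)
  have sq: "(cmod (w c (f + g) i))\<^sup>2 \<le> (cmod ((w c f + g) i))\<^sup>2" for i
    using clip_add[of c "f i" "g i"] by (intro power_mono) (simp_all add: w_def)
  show "(H.N (w c (f + g)))\<^sup>2 \<le> (H.N (w c f + g))\<^sup>2"
    unfolding N_sq_eq[OF 1] N_sq_eq[OF 2]
  proof (intro add_mono sum_mono)
    fix e assume e: "e \<in> E1 G"
    show "L2_ip (ms e) (edge_part (w c (f + g)) e) (edge_part (w c (f + g)) e)
      \<le> L2_ip (ms e) (edge_part (w c f + g) e) (edge_part (w c f + g) e)"
      unfolding L2_ip_self
      using H_edge[OF 1 e] H_edge[OF 2 e] sq by (intro integral_mono) (auto simp: L2_fun_def)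
  next
    fix v assume v: "v \<in> V1 G"
    show "wt v * (cmod (w c (f + g) (Inr v)))\<^sup>2 \<le> wt v * (cmod ((w c f + g) (Inr v)))\<^sup>2"
      using sq wt_pos[OF v] by (intro mult_left_mono) auto
  qed
  show "0 \<le> H.N (w c f + g)" using 2 by simp
qed

text \<open>
  On edges this is the trace inequality at the end points; they belong to the support. The value
  at a vertex in \<open>V1\<close> is controlled by the norm because of its positive weight.
\<close>

lemma trace_bound:
  assumes \<epsilon>: "0 < \<epsilon>" and i: "i \<in> trace_index G"
  shows "\<exists>C\<ge>0. \<forall>u\<in>D_tau K G X. (cmod (tr u i))\<^sup>2 \<le> \<epsilon> * (\<Sum>e\<in>E1 G. En e u) + C * (H.N u)\<^sup>2"
proof -
  have edge: "\<exists>C\<ge>0. \<forall>u\<in>D_tau K G X. (cmod (\<iota> e u p))\<^sup>2 \<le> \<epsilon> * (\<Sum>e\<in>E1 G. En e u) + C * (H.N u)\<^sup>2"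
    if e: "e \<in> E1 G" and p: "p \<in> spt (ms e)" for e p
  proof -
    interpret E: edge K "lft e" "rgt e" "ms e" by (rule edge_E1[OF e])
    obtain C where C: "0 \<le> C" "\<And>f. f \<in> D_iota_edge K (lft e) (rgt e) (ms e) \<Longrightarrow>
        (cmod (iota_edge K (lft e) (rgt e) (ms e) f p))\<^sup>2 \<le> \<epsilon> * E.energy (iota_edge K (lft e) (rgt e) (ms e) f) + C * (LINT x|ms e. (cmod (f x))\<^sup>2)"
      using E.trace_inequality[OF p \<epsilon>] by blast
    have "(cmod (\<iota> e u p))\<^sup>2 \<le> \<epsilon> * (\<Sum>e\<in>E1 G. En e u) + C * (H.N u)\<^sup>2" if u: "u \<in> D_tau K G X" for u
    proof -
      have "(cmod (\<iota> e u p))\<^sup>2 \<le> \<epsilon> * En e u + C * L2_ip (ms e) (edge_part u e) (edge_part u e)"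
        using C(2)[OF D_tau_edge[OF u e]] by (simp add: E.energy_def L2_ip_self)
      also have "\<dots> \<le> \<epsilon> * (\<Sum>e\<in>E1 G. En e u) + C * (H.N u)\<^sup>2"
        using N_edge_le[OF D_tau_H[OF u] e] C(1) \<epsilon>
        by (intro add_mono mult_left_mono member_le_sum[OF e _ finite_E1]) auto
      finally show ?thesis .
    qed
    then show ?thesis using C(1) by (intro exI[of _ C] conjI ballI)
  qed
  show ?thesis
    using i
  proof (cases rule: trace_index_cases)
    case (1 e)
    then show ?thesis using edge[OF 1(1) edge.a_spt[OF edge_E1[OF 1(1)]]] by (simp add: tr_simps)
  next
    case (2 e)
    then show ?thesis using edge[OF 2(1) edge.b_spt[OF edge_E1[OF 2(1)]]] by (simp add: tr_simps)
  next
    case (3 v)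
    have "(cmod (tr u i))\<^sup>2 \<le> \<epsilon> * (\<Sum>e\<in>E1 G. En e u) + 1 / wt v * (H.N u)\<^sup>2" if u: "u \<in> D_tau K G X" for u
    proof -
      have "(cmod (u (Inr v)))\<^sup>2 \<le> 1 / wt v * (H.N u)\<^sup>2"
        using N_vertex_le[OF D_tau_H[OF u] 3(1)] wt_pos[OF 3(1)] by (simp add: field_simps)
      moreover have "0 \<le> \<epsilon> * (\<Sum>e\<in>E1 G. En e u)" using \<epsilon> by (intro mult_nonneg_nonneg sum_nonneg) auto
      ultimately show ?thesis using 3 by (simp add: tr_simps)
    qed
    then show ?thesis using wt_pos[OF 3(1)] by (intro exI[of _ "1 / wt v"] conjI ballI) auto
  qed
qed

lemma trace_form_bound:
  "\<exists>B\<ge>0. \<forall>x\<in>X. \<bar>Re (trace_inner G (L x) x)\<bar> \<le> B * (\<Sum>i\<in>trace_index G. (cmod (x i))\<^sup>2)"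
proof -
  let ?S = "trace_index G"
  obtain C where C: "0 \<le> C" "\<And>x. x \<in> X \<Longrightarrow> L.norm1 (L x) \<le> C * L.norm1 x" using L.L_bounded by blast
  define m where "m = (\<Sum>i\<in>?S. tw i)"
  have m: "0 \<le> m" "\<And>i. i \<in> ?S \<Longrightarrow> tw i \<le> m" unfolding m_def
    using tw_nonneg finite_trace_index by (auto intro!: sum_nonneg member_le_sum)
  have "\<bar>Re (trace_inner G (L x) x)\<bar> \<le> (m * C * card ?S) * (\<Sum>i\<in>?S. (cmod (x i))\<^sup>2)" if x: "x \<in> X" for x
  proof -
    have n0: "0 \<le> L.norm1 x" by (intro sum_nonneg) simp
    have "\<bar>Re (trace_inner G (L x) x)\<bar> \<le> (\<Sum>i\<in>?S. \<bar>tw i * Re (L x i * cnj (x i))\<bar>)"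
      unfolding Re_trace_inner by (rule sum_abs)
    also have "\<dots> \<le> (\<Sum>i\<in>?S. m * (cmod (L x i) * L.norm1 x))"
    proof (rule sum_mono)
      fix i assume i: "i \<in> ?S"
      have "\<bar>Re (L x i * cnj (x i))\<bar> \<le> cmod (L x i) * cmod (x i)"
        using abs_Re_le_cmod[of "L x i * cnj (x i)"] by (simp add: norm_mult)
      also have "\<dots> \<le> cmod (L x i) * L.norm1 x"
        using finite_trace_index i by (intro mult_left_mono member_le_sum) auto
      finally show "\<bar>tw i * Re (L x i * cnj (x i))\<bar> \<le> m * (cmod (L x i) * L.norm1 x)"
        using m(2)[OF i] m(1) tw_nonneg[OF i] unfolding abs_mult by (intro mult_mono) auto
    qed
    also have "\<dots> = m * (L.norm1 (L x) * L.norm1 x)" by (simp only: sum_distrib_left[symmetric] sum_distrib_right[symmetric])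
    also have "\<dots> \<le> m * ((C * L.norm1 x) * L.norm1 x)" using C(2)[OF x] n0 m(1) by (intro mult_left_mono mult_right_mono)
    also have "\<dots> = m * C * (L.norm1 x)\<^sup>2" by (simp add: power2_eq_square)
    also have "\<dots> \<le> m * C * ((\<Sum>i\<in>?S. (cmod (x i))\<^sup>2) * card ?S)"
      by (rule mult_left_mono[OF sum_squared_le_sum_of_squares mult_nonneg_nonneg[OF m(1) C(1)]])
    finally show ?thesis by (simp only: mult_ac)
  qed
  moreover have "0 \<le> m * C * card ?S" using m(1) C(1) by simp
  ultimately show ?thesis by (intro exI[of _ "m * C * card ?S"] conjI ballI)
qed

text \<open>
  The trace part is at most a constant times the sum of the squares of the boundary values. With
  a small \<open>\<epsilon>\<close> in the trace inequality, their energy contributions are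
  absorbed by the energies of the edges.
\<close>

theorem form_bounded_below:
  "\<exists>\<omega>\<ge>0. \<forall>u\<in>D_tau K G X. - \<omega> * (H.N u)\<^sup>2 \<le> (\<Sum>e\<in>E1 G. En e u) + Re (trace_inner G (L (tr u)) (tr u))"
proof -
  let ?S = "trace_index G"
  obtain B where B: "0 \<le> B" "\<And>x. x \<in> X \<Longrightarrow> \<bar>Re (trace_inner G (L x) x)\<bar> \<le> B * (\<Sum>i\<in>?S. (cmod (x i))\<^sup>2)"
    using trace_form_bound by blast
  define \<epsilon> where "\<epsilon> = 1 / (B * card ?S + 1)"
  have Bp: "0 < B * card ?S + 1" using B(1) by (simp add: add_nonneg_pos)
  then have \<epsilon>: "0 < \<epsilon>" by (simp add: \<epsilon>_def)
  have "\<forall>i\<in>?S. \<exists>C\<ge>0. \<forall>u\<in>D_tau K G X. (cmod (tr u i))\<^sup>2 \<le> \<epsilon> * (\<Sum>e\<in>E1 G. En e u) + C * (H.N u)\<^sup>2"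
    using trace_bound[OF \<epsilon>] by blast
  from bchoice[OF this] obtain C where
    C': "\<forall>i\<in>?S. 0 \<le> C i \<and> (\<forall>u\<in>D_tau K G X. (cmod (tr u i))\<^sup>2 \<le> \<epsilon> * (\<Sum>e\<in>E1 G. En e u) + C i * (H.N u)\<^sup>2)" ..
  have C: "0 \<le> C i" "u \<in> D_tau K G X \<Longrightarrow> (cmod (tr u i))\<^sup>2 \<le> \<epsilon> * (\<Sum>e\<in>E1 G. En e u) + C i * (H.N u)\<^sup>2"
    if "i \<in> ?S" for i u using bspec[OF C' that] by simp_all
  have "- (B * sum C ?S) * (H.N u)\<^sup>2 \<le> (\<Sum>e\<in>E1 G. En e u) + Re (trace_inner G (L (tr u)) (tr u))"
    if u: "u \<in> D_tau K G X" for u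
  proof -
    let ?E = "\<Sum>e\<in>E1 G. En e u"
    have E0: "0 \<le> ?E" by (intro sum_nonneg) auto
    have "(\<Sum>i\<in>?S. (cmod (tr u i))\<^sup>2) \<le> (\<Sum>i\<in>?S. \<epsilon> * ?E + C i * (H.N u)\<^sup>2)" by (intro sum_mono C(2) u)
    also have "\<dots> = card ?S * (\<epsilon> * ?E) + sum C ?S * (H.N u)\<^sup>2" by (simp add: sum.distrib sum_distrib_right)
    finally have "B * (\<Sum>i\<in>?S. (cmod (tr u i))\<^sup>2) \<le> B * (card ?S * (\<epsilon> * ?E) + sum C ?S * (H.N u)\<^sup>2)"
      using B(1) by (rule mult_left_mono)
    also have "\<dots> = (B * card ?S * \<epsilon>) * ?E + B * sum C ?S * (H.N u)\<^sup>2" by (simp add: algebra_simps)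
    also have "(B * card ?S * \<epsilon>) * ?E \<le> 1 * ?E"
    proof (rule mult_right_mono[OF _ E0])
      show "B * card ?S * \<epsilon> \<le> 1" using Bp by (simp add: \<epsilon>_def)
    qed
    finally have "B * (\<Sum>i\<in>?S. (cmod (tr u i))\<^sup>2) \<le> ?E + B * sum C ?S * (H.N u)\<^sup>2" by simp
    then show ?thesis using B(2)[OF D_tau_X[OF u]] by simp
  qed
  moreover have "0 \<le> B * sum C ?S" using B(1) C(1) by (intro mult_nonneg_nonneg sum_nonneg)
  ultimately show ?thesis by (intro exI[of _ "B * sum C ?S"] conjI ballI)
qed

section \<open>Invariance of half-planes\<close>

lemma H_ae_mono: "H_ae G P \<Longrightarrow> (\<And>i. P i \<Longrightarrow> Q i) \<Longrightarrow> H_ae G Q"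
  unfolding H_ae_def by (auto elim: eventually_mono)

lemma H_ae_conj: "H_ae G P \<Longrightarrow> H_ae G Q \<Longrightarrow> H_ae G (\<lambda>i. P i \<and> Q i)"
  unfolding H_ae_def by (auto intro: eventually_conj)

lemma H_ae_ball_countable:
  "countable \<Theta> \<Longrightarrow> (\<And>\<theta>. \<theta> \<in> \<Theta> \<Longrightarrow> H_ae G (P \<theta>)) \<Longrightarrow> H_ae G (\<lambda>i. \<forall>\<theta>\<in>\<Theta>. P \<theta> i)"
  unfolding H_ae_def by (simp add: AE_ball_countable)

lemma N_zero_imp_ae:
  assumes f: "f \<in> H" and z: "H.N f = 0" shows "H_ae G (\<lambda>i. f i = 0)"
  unfolding H_ae_def
proof (intro conjI ballI)
  fix e assume e: "e \<in> E1 G"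
  have "L2_ip (ms e) (edge_part f e) (edge_part f e) = 0"
  proof (rule antisym)
    show "L2_ip (ms e) (edge_part f e) (edge_part f e) \<le> 0" using N_edge_le[OF f e] z by simp
    show "0 \<le> L2_ip (ms e) (edge_part f e) (edge_part f e)" by (simp add: L2_ip_self)
  qed
  then show "AE x in ms e. f (Inl (e, x)) = 0" by (rule L2_zero_imp_AE[OF H_edge[OF f e]])
next
  fix v assume v: "v \<in> V1 G"
  have "wt v * (cmod (f (Inr v)))\<^sup>2 \<le> 0" using N_vertex_le[OF f v] z by simp
  then show "f (Inr v) = 0" using wt_pos[OF v] by (simp add: mult_le_0_iff)
qed

lemma H_norm_eq: "H_norm G = H.N"
  by (simp add: fun_eq_iff H_norm_def H.N_def r_def)

lemma c0_semigroup_of_generated: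
  assumes gen: "generated_by_minus K H (H_norm G) A T"
  shows "c0_semigroup H r T A"
proof unfold_locales
  have C0: "C0_semigroup K H H.N T" using gen by (simp add: generated_by_minus_def H_norm_eq)
  note C = C0[unfolded C0_semigroup_def]
  show "T t f \<in> H" if "0 \<le> t" "f \<in> H" for t f using C that by blast
  show "H.N (T t (f + g) - (T t f + T t g)) = 0" if "0 \<le> t" "f \<in> H" "g \<in> H" for t f g
  proof -
    have "H.N (\<lambda>i. T t (\<lambda>j. f j + g j) i - (T t f i + T t g i)) = 0" using C that by simp
    then show ?thesis by (simp only: plus_fun_def fun_diff_def)
  qed
  show "H.N (T t (c *\<^sub>R f) - c *\<^sub>R T t f) = 0" if "0 \<le> t" "f \<in> H" for t f c
  proof -
    have "H.N (\<lambda>i. T t (\<lambda>j. complex_of_real c * f j) i - complex_of_real c * T t f i) = 0"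
      using C that K_closed_ops(8)[OF K] by simp
    then show ?thesis by (simp only: scaleR_fun_def scaleR_conv_of_real fun_diff_def)
  qed
  show "\<exists>C. \<forall>f\<in>H. H.N (T t f) \<le> C * H.N f" if "0 \<le> t" for t using C that by blast
  show "H.N (T 0 f - f) = 0" if "f \<in> H" for f
  proof -
    have "H.N (\<lambda>i. T 0 f i - f i) = 0" using C that by simp
    then show ?thesis by (simp only: fun_diff_def)
  qed
  show "H.N (T (s + t) f - T s (T t f)) = 0" if "0 \<le> s" "0 \<le> t" "f \<in> H" for s t f
  proof -
    have "H.N (\<lambda>i. T (s + t) f i - T s (T t f) i) = 0" using C that by simp
    then show ?thesis by (simp only: fun_diff_def)
  qed
  show "((\<lambda>t. H.N (T t f - f)) \<longlongrightarrow> 0) (at_right 0)" if "f \<in> H" for f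
  proof -
    have "((\<lambda>t. H.N (\<lambda>i. T t f i - f i)) \<longlongrightarrow> 0) (at_right 0)" using C that by simp
    then show ?thesis by (simp only: fun_diff_def)
  qed
  show "(f, h) \<in> A \<longleftrightarrow> ((\<lambda>t. H.N ((1 / t) *\<^sub>R (T t f - f) + h)) \<longlongrightarrow> 0) (at_right 0)"
    if "f \<in> H" "h \<in> H" for f h
  proof -
    have "(\<lambda>i. (T t f i - f i) / complex_of_real t - (- h i)) = (1 / t) *\<^sub>R (T t f - f) + h" for t
      by (simp add: fun_eq_iff scaleR_fun_def scaleR_conv_of_real)
    then show ?thesis using gen that by (simp add: generated_by_minus_def H_norm_eq)
  qed
qed

text \<open>
  The distance from the half-plane is controlled by \<open>growth_of_remainder\<close>. Its
  hypothesis on the generator follows from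
  \<open>Re \<tau>(u, w u) \<ge> \<tau>(w u, w u) \<ge> - \<omega> \<parallel>w u\<parallel>\<^sup>2\<close>,
  where the first inequality is shown separately for the energies and for the trace part.
\<close>

theorem half_plane_invariance:
  assumes gen: "generated_by_minus K H (H_norm G) (H_op K G X L) T"
    and c: "0 \<le> c"
    and ReX: "\<And>x. x \<in> X \<Longrightarrow> (\<lambda>i. complex_of_real (Re (x i))) \<in> X"
    and wX: "\<And>x. x \<in> X \<Longrightarrow> (\<lambda>i. complex_of_real (max (Re (x i) - c) 0)) \<in> X"
    and real: "\<And>y t i. \<lbrakk>y \<in> X; \<And>i. y i \<in> \<real>; 0 \<le> t; i \<in> trace_index G\<rbrakk> \<Longrightarrow> exp_semigroup L t y i \<in> \<real>"
    and inv: "\<And>y t i. \<lbrakk>y \<in> X; \<And>i. y i \<in> \<real>; \<And>i. i \<in> trace_index G \<Longrightarrow> Re (y i) \<le> c; 0 \<le> t; i \<in> trace_index G\<rbrakk>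
        \<Longrightarrow> Re (exp_semigroup L t y i) \<le> c"
    and t: "0 \<le> t" and f: "f \<in> H" and fc: "H_ae G (\<lambda>i. Re (f i) \<le> c)"
  shows "H_ae G (\<lambda>i. Re (T t f i) \<le> c)"
proof -
  interpret T: c0_semigroup H r T "H_op K G X L" by (rule c0_semigroup_of_generated[OF gen])
  have w_D: "w c u \<in> D_tau K G X" and tr_w: "tr (w c u) = (\<lambda>i. clip c (tr u i))"
    and En_w: "e \<in> E1 G \<Longrightarrow> En e (w c u) \<le> L2_ip (lebesgue_Ioo (lft e) (rgt e)) (der e u) (der e (w c u))"
    if u: "u \<in> D_tau K G X" for u e
  proof -
    have E: "edge_part (w c u) e \<in> D_iota_edge K (lft e) (rgt e) (ms e)"
      "\<iota> e (w c u) (lft e) = clip c (\<iota> e u (lft e))" "\<iota> e (w c u) (rgt e) = clip c (\<iota> e u (rgt e))"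
      "En e (w c u) \<le> L2_ip (lebesgue_Ioo (lft e) (rgt e)) (der e u) (der e (w c u))"
      if e: "e \<in> E1 G" for e
    proof -
      interpret E: edge K "lft e" "rgt e" "ms e" by (rule edge_E1[OF e])
      note ue = D_tau_edge[OF u e]
      have eq: "edge_part (w c u) e = (\<lambda>x. clip c (edge_part u e x))" by (simp add: w_def)
      show "edge_part (w c u) e \<in> D_iota_edge K (lft e) (rgt e) (ms e)"
        "\<iota> e (w c u) (lft e) = clip c (\<iota> e u (lft e))" "\<iota> e (w c u) (rgt e) = clip c (\<iota> e u (rgt e))"
        unfolding eq by (rule E.contraction_operates[OF ue E.clip_contraction[OF c]])+
      show "En e (w c u) \<le> L2_ip (lebesgue_Ioo (lft e) (rgt e)) (der e u) (der e (w c u))"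
        using E.energy_of_remainder[OF ue E.clip_contraction[OF c] E.reflect_contraction[OF c]]
        unfolding eq E.energy_def .
    qed
    show tr: "tr (w c u) = (\<lambda>i. clip c (tr u i))"
    proof
      fix i show "tr (w c u) i = clip c (tr u i)"
      proof (cases "i \<in> trace_index G")
        case True
        then show ?thesis
        proof (cases rule: trace_index_cases)
          case (3 v)
          then show ?thesis by (simp add: tr_simps) (simp add: w_def)
        qed (simp_all add: tr_simps E(2,3))
      next
        case False
        then show ?thesis by (simp add: tr_simps clip_0[OF c])
      qed
    qed
    have "tr (w c u) \<in> X" unfolding tr using wX[OF D_tau_X[OF u]] by (simp add: clip_def)
    then show "w c u \<in> D_tau K G X" using w_H[OF c D_tau_H[OF u]] E(1) by (simp add: D_tau_def D_iota_def)
    show "En e (w c u) \<le> L2_ip (lebesgue_Ioo (lft e) (rgt e)) (der e u) (der e (w c u))" if "e \<in> E1 G"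
      by (rule E(4)[OF that])
  qed
  obtain \<omega> where \<omega>: "0 \<le> \<omega>" "\<And>u. u \<in> D_tau K G X \<Longrightarrow>
      - \<omega> * (H.N u)\<^sup>2 \<le> (\<Sum>e\<in>E1 G. En e u) + Re (trace_inner G (L (tr u)) (tr u))"
    using form_bounded_below by blast
  have acc: "- \<omega> * (H.N (w c u))\<^sup>2 \<le> r h (w c u)" if uh: "(u, h) \<in> H_op K G X L" for u h
  proof -
    have u: "u \<in> D_tau K G X" and tau: "\<And>g. g \<in> D_tau K G X \<Longrightarrow> tau K G L u g = H_inner G h g"
      using uh by (auto simp: H_op_def)
    let ?x = "tr u" and ?y = "tr (w c u)"
    have xX: "?x \<in> X" and yX: "?y \<in> X" using D_tau_X u w_D by auto
    have y_eq: "?y = (\<lambda>i. complex_of_real (max (Re (?x i) - c) 0))" unfolding tr_w[OF u] clip_def ..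
    have dX: "(\<lambda>i. ?x i - ?y i) \<in> X" using L.X_add[OF xX L.X_minus[OF yX]] by simp
    have "0 \<le> (\<Sum>i\<in>trace_index G. tw i * Re (L (\<lambda>i. ?x i - ?y i) i * cnj (?y i)))"
      unfolding y_eq
      by (rule L.form_of_remainder_nonneg[OF c ReX wX real inv tw_nonneg xX])
    moreover have "L ?x i = L (\<lambda>i. ?x i - ?y i) i + L ?y i" for i
      using fun_cong[OF L.L_add[OF dX yX], of i] by simp
    ultimately have "Re (trace_inner G (L ?y) ?y) \<le> Re (trace_inner G (L ?x) ?y)"
      unfolding Re_trace_inner by (simp add: distrib_left distrib_right sum.distrib)
    moreover have "(\<Sum>e\<in>E1 G. En e (w c u)) \<le> (\<Sum>e\<in>E1 G. L2_ip (lebesgue_Ioo (lft e) (rgt e)) (der e u) (der e (w c u)))"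
      by (intro sum_mono En_w u)
    ultimately have "- \<omega> * (H.N (w c u))\<^sup>2 \<le> Re (tau K G L u (w c u))"
      using \<omega>(2)[OF w_D[OF u]] unfolding Re_tau by linarith
    then show ?thesis using tau[OF w_D[OF u]] by (simp add: r_def)
  qed
  have Tf: "T t f \<in> H" by (rule T.T_closed[OF t f])
  have "H.N (w c (T t f)) \<le> exp (\<omega> * t) * H.N (w c f)"
    by (rule T.growth_of_remainder[OF w_H[OF c] w_add[OF c] \<omega>(1) acc t f])
  moreover have "(H.N (w c f))\<^sup>2 = 0"
  proof -
    have "L2_ip (ms e) (edge_part (w c f) e) (edge_part (w c f) e) = 0" if "e \<in> E1 G" for e
    proof -
      have "AE x in ms e. Re (edge_part f e x) \<le> c" using fc that by (simp add: H_ae_def)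
      then have "AE x in ms e. (cmod (edge_part (w c f) e x))\<^sup>2 = 0"
        by eventually_elim (simp add: w_def clip_zero_iff)
      then show ?thesis unfolding L2_ip_self by (rule integral_eq_zero_AE)
    qed
    moreover have "w c f (Inr v) = 0" if "v \<in> V1 G" for v
      using fc that by (simp add: H_ae_def w_def clip_zero_iff)
    ultimately show ?thesis by (simp add: N_sq_eq[OF w_H[OF c f]])
  qed
  ultimately have "H.N (w c (T t f)) = 0"
    using H.N_nonneg[OF w_H[OF c Tf]] by simp
  from N_zero_imp_ae[OF w_H[OF c Tf] this] show ?thesis
    by (rule H_ae_mono) (simp add: w_def clip_zero_iff)
qed

end


section \<open>Positivity and the submarkovian property\<close>

text \<open>
  The rotations by rational angles are dense among all rotations; for real numbers the two signs
  suffice. Countability matters because statements that hold almost everywhere are to be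
  combined.
\<close>

lemma disc_from_half_planes:
  assumes K: "K = \<real> \<or> K = UNIV"
  shows "\<exists>\<Theta>. countable \<Theta> \<and> \<Theta> \<subseteq> K \<and> (\<forall>\<theta>\<in>\<Theta>. cmod \<theta> = 1) \<and>
    (\<forall>z\<in>K. \<forall>c. (\<forall>\<theta>\<in>\<Theta>. Re (\<theta> * z) \<le> c) \<longrightarrow> cmod z \<le> c)"
proof (cases "K = UNIV")
  case True
  show ?thesis
  proof (intro exI[of _ "cis ` \<rat>"] conjI ballI allI impI)
    show "countable (cis ` \<rat>)" by (intro countable_image countable_rat)
    fix z :: complex and c assume le: "\<forall>\<theta>\<in>cis ` \<rat>. Re (\<theta> * z) \<le> c"
    have "Re (cis s * z) \<le> c" for s
    proof (rule continuous_le_on_closure[where S="\<rat>" and f="\<lambda>s. Re (cis s * z)"])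
      show "continuous_on (closure \<rat>) (\<lambda>s. Re (cis s * z))" by (intro continuous_intros)
      show "s \<in> closure \<rat>" by (simp add: Rats_closure_real)
      show "Re (cis x * z) \<le> c" if "x \<in> \<rat>" for x by (rule bspec[OF le imageI[OF that]])
    qed
    from this[of "- Arg z"] have "Re (cis (- Arg z) * z) \<le> c" .
    moreover have "cis (- Arg z) * z = complex_of_real (cmod z)"
    proof -
      define a q where "a = Arg z" and "q = complex_of_real (cmod z)"
      have "z = q * cis a" using rcis_cmod_Arg[of z] by (simp add: rcis_def a_def q_def)
      then have "cis (- a) * z = q * (cis (- a) * cis a)" by (simp only: mult.left_commute)
      then show ?thesis by (simp add: cis_mult a_def q_def)
    qed
    ultimately show "cmod z \<le> c" by simp
  qed (auto simp: True)
next
  case False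
  then have KR: "K = \<real>" using K by simp
  show ?thesis
  proof (intro exI[of _ "{1, -1}"] conjI ballI allI impI)
    fix z :: complex and c assume z: "z \<in> K" and le: "\<forall>\<theta>\<in>{1, -1}. Re (\<theta> * z) \<le> c"
    obtain s where "z = complex_of_real s" using z KR by (auto simp: Reals_def)
    then show "cmod z \<le> c" using le by (simp add: abs_le_iff)
  qed (auto simp: KR)
qed

context graph_form
begin

context
  assumes lat: "sublattice K (trace_index G) X"
    and pos: "positivity_preserving (Ball (trace_index G)) X (exp_semigroup L)"
begin

lemma ReX: "x \<in> X \<Longrightarrow> (\<lambda>i. complex_of_real (Re (x i))) \<in> X"
  by (rule sublattice_Re[OF K finite_trace_index lat])

lemma exp_pos:
  assumes "y \<in> X" "\<And>i. i \<in> trace_index G \<Longrightarrow> y i \<in> \<real>\<^sub>\<ge>\<^sub>0" "0 \<le> t" "i \<in> trace_index G"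
  shows "exp_semigroup L t y i \<in> \<real>\<^sub>\<ge>\<^sub>0"
  using pos assms unfolding positivity_preserving_def by blast

lemma pos_neg_parts:
  assumes y: "y \<in> X" "\<And>i. y i \<in> \<real>"
  obtains p n where "p \<in> X" "n \<in> X" "\<And>i. p i = complex_of_real (max (Re (y i)) 0)"
    "\<And>i. n i = complex_of_real (max (- Re (y i)) 0)"
    "\<And>t i. exp_semigroup L t y i = exp_semigroup L t p i - exp_semigroup L t n i"
proof -
  define p n where "p = (\<lambda>i. complex_of_real (max (Re (y i)) 0))" and "n = (\<lambda>i. complex_of_real (max (- Re (y i)) 0))"
  have p: "p \<in> X" unfolding p_def by (rule sublattice_pos[OF K lat y])
  have "(\<lambda>i. complex_of_real (max (Re (- y i)) 0)) \<in> X"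
    by (rule sublattice_pos[OF K lat L.X_minus[OF y(1)]]) (simp add: y(2))
  then have n: "n \<in> X" by (simp add: n_def)
  have "y i = p i + - n i" for i
  proof -
    obtain s where s: "y i = complex_of_real s" using y(2)[of i] by (auto simp: Reals_def)
    show ?thesis by (simp add: p_def n_def s max_def)
  qed
  then have "y = (\<lambda>i. p i + - n i)" by blast
  then have "exp_semigroup L t y i = exp_semigroup L t p i - exp_semigroup L t n i" for t i
    using L.exp_add[OF p L.X_minus[OF n], of t i] L.exp_minus[OF n, of t i] by simp
  then show thesis using that[OF p n] by (simp add: p_def n_def)
qed

lemma exp_real:
  assumes y: "y \<in> X" "\<And>i. y i \<in> \<real>" and t: "0 \<le> t" and i: "i \<in> trace_index G"
  shows "exp_semigroup L t y i \<in> \<real>"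
proof -
  obtain p n where pn: "p \<in> X" "n \<in> X" "\<And>i. p i = complex_of_real (max (Re (y i)) 0)"
    "\<And>i. n i = complex_of_real (max (- Re (y i)) 0)"
    "\<And>t i. exp_semigroup L t y i = exp_semigroup L t p i - exp_semigroup L t n i"
    using pos_neg_parts[OF y] by blast
  have "exp_semigroup L t p i \<in> \<real>\<^sub>\<ge>\<^sub>0" "exp_semigroup L t n i \<in> \<real>\<^sub>\<ge>\<^sub>0"
    using exp_pos[OF pn(1) _ t i] exp_pos[OF pn(2) _ t i] by (simp_all add: pn(3,4))
  then show ?thesis unfolding pn(5) by (intro Reals_diff) (auto elim: nonneg_Reals_cases)
qed

lemma exp_nonpos:
  assumes y: "y \<in> X" "\<And>i. y i \<in> \<real>" "\<And>i. i \<in> trace_index G \<Longrightarrow> Re (y i) \<le> 0" and t: "0 \<le> t" and i: "i \<in> trace_index G"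
  shows "Re (exp_semigroup L t y i) \<le> 0"
proof -
  have "- y i \<in> \<real>\<^sub>\<ge>\<^sub>0" if "i \<in> trace_index G" for i
    using y(2)[of i] y(3)[OF that] by (auto simp: complex_nonneg_Reals_iff complex_is_Real_iff)
  then have "exp_semigroup L t (\<lambda>i. - y i) i \<in> \<real>\<^sub>\<ge>\<^sub>0" by (rule exp_pos[OF L.X_minus[OF y(1)] _ t i])
  then show ?thesis by (simp add: L.exp_minus[OF y(1)] complex_nonneg_Reals_iff)
qed

lemma clip_X_0: "x \<in> X \<Longrightarrow> (\<lambda>i. complex_of_real (max (Re (x i) - 0) 0)) \<in> X"
  using sublattice_pos[OF K lat ReX] by simp

lemma half_plane_0:
  assumes gen: "generated_by_minus K H (H_norm G) (H_op K G X L) T"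
    and "0 \<le> t" "f \<in> H" "H_ae G (\<lambda>i. Re (f i) \<le> 0)"
  shows "H_ae G (\<lambda>i. Re (T t f i) \<le> 0)"
  by (rule half_plane_invariance[OF gen order_refl ReX clip_X_0 exp_real exp_nonpos assms(2-4)])

end

lemma T_scalar:
  assumes gen: "generated_by_minus K H (H_norm G) A T"
    and t: "0 \<le> t" and \<theta>: "\<theta> \<in> K" and f: "f \<in> H"
  shows "(\<lambda>i. \<theta> * f i) \<in> H" "H_ae G (\<lambda>i. T t (\<lambda>i. \<theta> * f i) i = \<theta> * T t f i)"
proof -
  have scale: "(\<lambda>i. \<theta> * f i) \<in> H" if "f \<in> H" for f
    unfolding H_space_def mem_Collect_eq
  proof (intro conjI ballI)
    fix e assume e: "e \<in> E1 G"
    show "(\<lambda>x. \<theta> * f (Inl (e, x))) \<in> L2_fun K (ms e)"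
      using H_edge[OF that e] K_closed_ops(5)[OF K \<theta>] by (auto simp: L2_fun_def norm_mult power_mult_distrib)
  next
    fix v assume v: "v \<in> V1 G"
    show "\<theta> * f (Inr v) \<in> K" by (rule K_closed_ops(5)[OF K \<theta> H_vertex[OF that v]])
  qed
  show fH: "(\<lambda>i. \<theta> * f i) \<in> H" by (rule scale[OF f])
  have C: "C0_semigroup K H H.N T" using gen by (simp add: generated_by_minus_def H_norm_eq)
  note C = C[unfolded C0_semigroup_def]
  have Tf: "T t f \<in> H" "T t (\<lambda>i. \<theta> * f i) \<in> H" using C t f fH by blast+
  have "H.N (\<lambda>i. T t (\<lambda>j. \<theta> * f j) i - \<theta> * T t f i) = 0" using C t f \<theta> by simp
  then have "H.N (T t (\<lambda>j. \<theta> * f j) - (\<lambda>i. \<theta> * T t f i)) = 0" by (simp only: fun_diff_def)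
  then have "H_ae G (\<lambda>i. (T t (\<lambda>j. \<theta> * f j) - (\<lambda>i. \<theta> * T t f i)) i = 0)"
    by (rule N_zero_imp_ae[OF H.closed_ops(3)[OF Tf(2) scale[OF Tf(1)]]])
  then show "H_ae G (\<lambda>i. T t (\<lambda>i. \<theta> * f i) i = \<theta> * T t f i)" by (rule H_ae_mono) simp
qed

lemma rotated_half_plane:
  assumes gen: "generated_by_minus K H (H_norm G) A T"
    and hp: "\<And>f. \<lbrakk>f \<in> H; H_ae G (\<lambda>i. Re (f i) \<le> c)\<rbrakk> \<Longrightarrow> H_ae G (\<lambda>i. Re (T t f i) \<le> c)"
    and t: "0 \<le> t" and \<theta>: "\<theta> \<in> K" and f: "f \<in> H" and le: "H_ae G (\<lambda>i. Re (\<theta> * f i) \<le> c)"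
  shows "H_ae G (\<lambda>i. Re (\<theta> * T t f i) \<le> c)"
  by (rule H_ae_mono[OF H_ae_conj[OF hp[OF T_scalar(1)[OF gen t \<theta> f] le] T_scalar(2)[OF gen t \<theta> f]]]) auto

lemma H_ae_K: "f \<in> H \<Longrightarrow> H_ae G (\<lambda>i. f i \<in> K)"
  unfolding H_ae_def
proof (intro conjI ballI)
  fix e assume "f \<in> H" "e \<in> E1 G"
  from H_edge[OF this] have "\<forall>x\<in>space (ms e). f (Inl (e, x)) \<in> K" by (simp add: L2_fun_def)
  then show "AE x in ms e. f (Inl (e, x)) \<in> K" by (intro AE_I2) blast
qed (rule H_vertex)

text \<open>
  A complex number is a nonnegative real if and only if it belongs to the half-planes of all
  \<open>z\<close> with \<open>Re (\<theta> z) \<le> 0\<close>, where \<open>\<theta>\<close> is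
  \<open>- 1\<close>, \<open>\<i>\<close> and \<open>- \<i>\<close>. In the real case the first
  one suffices.
\<close>

theorem positivity:
  assumes gen: "generated_by_minus K H (H_norm G) (H_op K G X L) T"
    and lat: "sublattice K (trace_index G) X"
    and pos: "positivity_preserving (Ball (trace_index G)) X (exp_semigroup L)"
  shows "positivity_preserving (H_ae G) H T"
  unfolding positivity_preserving_def
proof (intro allI impI ballI)
  fix t :: real and f assume t: "0 \<le> t" and f: "f \<in> H" and nn: "H_ae G (\<lambda>i. f i \<in> \<real>\<^sub>\<ge>\<^sub>0)"
  have rot: "H_ae G (\<lambda>i. Re (\<theta> * T t f i) \<le> 0)" if "\<theta> \<in> K" "\<And>z. z \<in> \<real>\<^sub>\<ge>\<^sub>0 \<Longrightarrow> Re (\<theta> * z) \<le> 0" for \<theta>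
  proof (rule rotated_half_plane[OF gen _ t that(1) f])
    show "H_ae G (\<lambda>i. Re (T t g i) \<le> 0)" if "g \<in> H" "H_ae G (\<lambda>i. Re (g i) \<le> 0)" for g
      by (rule half_plane_0[OF lat pos gen t that])
    show "H_ae G (\<lambda>i. Re (\<theta> * f i) \<le> 0)" by (rule H_ae_mono[OF nn that(2)])
  qed
  have Tf: "T t f \<in> H" using gen t f by (auto simp: generated_by_minus_def C0_semigroup_def)
  have Re: "H_ae G (\<lambda>i. Re (- 1 * T t f i) \<le> 0)"
    using K_closed_ops(7)[OF K K_closed_ops(2)[OF K]] by (intro rot) (auto simp: complex_nonneg_Reals_iff)
  have Im: "H_ae G (\<lambda>i. Im (T t f i) = 0)"
  proof (cases "K = UNIV")
    case True
    have "H_ae G (\<lambda>i. Re (\<i> * T t f i) \<le> 0)" "H_ae G (\<lambda>i. Re (- \<i> * T t f i) \<le> 0)"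
      by (rule rot; simp add: True complex_nonneg_Reals_iff)+
    from H_ae_conj[OF this] show ?thesis by (rule H_ae_mono) simp
  next
    case False
    then show ?thesis using H_ae_K[OF Tf] K by (auto elim!: H_ae_mono simp: complex_is_Real_iff)
  qed
  show "H_ae G (\<lambda>i. T t f i \<in> \<real>\<^sub>\<ge>\<^sub>0)"
    by (rule H_ae_mono[OF H_ae_conj[OF Re Im]]) (simp add: complex_nonneg_Reals_iff)
qed

text \<open>
  The submarkovian property bounds moduli; a one-sided bound for \<open>y\<close> is transferred
  through \<open>exp (- t L) y \<le> exp (- t L) y\<^sup>+\<close>.
\<close>

lemma exp_le_const:
  assumes lat: "sublattice K (trace_index G) X"
    and sm: "submarkovian (Ball (trace_index G)) X (exp_semigroup L)"
    and c: "0 \<le> c"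
    and y: "y \<in> X" "\<And>i. y i \<in> \<real>" "\<And>i. i \<in> trace_index G \<Longrightarrow> Re (y i) \<le> c" and t: "0 \<le> t" and i: "i \<in> trace_index G"
  shows "Re (exp_semigroup L t y i) \<le> c"
proof -
  let ?S = "trace_index G"
  have pos: "positivity_preserving (Ball ?S) X (exp_semigroup L)" using sm by (simp add: submarkovian_def)
  obtain p n where pn: "p \<in> X" "n \<in> X" "\<And>i. p i = complex_of_real (max (Re (y i)) 0)"
    "\<And>i. n i = complex_of_real (max (- Re (y i)) 0)"
    "\<And>t i. exp_semigroup L t y i = exp_semigroup L t p i - exp_semigroup L t n i"
    using pos_neg_parts[OF lat pos y(1,2)] by blast
  have "sup_norm (Ball ?S) p \<le> ennreal c"
    unfolding sup_norm_def using y(3) c by (intro Inf_lower) (simp add: pn(3) ennreal_leI)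
  moreover have "sup_norm (Ball ?S) p < \<infinity>" using le_less_trans[OF calculation, of \<infinity>] by simp
  ultimately have "sup_norm (Ball ?S) (exp_semigroup L t p) \<le> ennreal c"
    using sm t pn(1) unfolding submarkovian_def by (meson order_trans)
  moreover have "ennreal (cmod (exp_semigroup L t p i)) \<le> sup_norm (Ball ?S) (exp_semigroup L t p)"
    unfolding sup_norm_def using i by (intro Inf_greatest) simp
  ultimately have "ennreal (cmod (exp_semigroup L t p i)) \<le> ennreal c" by (rule order_trans[rotated])
  then have "cmod (exp_semigroup L t p i) \<le> c" using c by simp
  then have "Re (exp_semigroup L t p i) \<le> c" using complex_Re_le_cmod order_trans by blast
  moreover have "exp_semigroup L t n i \<in> \<real>\<^sub>\<ge>\<^sub>0"
    by (rule exp_pos[OF lat pos pn(2) _ t i]) (simp add: pn(4))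
  ultimately show ?thesis unfolding pn(5) by (simp add: complex_nonneg_Reals_iff)
qed

text \<open>
  A bound \<open>cmod (f i) \<le> c\<close> is equivalent to countably many half-plane
  conditions for rotations of \<open>f\<close>.
\<close>

theorem submarkovian_property:
  assumes gen: "generated_by_minus K H (H_norm G) (H_op K G X L) T"
    and st: "stonean_sublattice K (trace_index G) X"
    and sm: "submarkovian (Ball (trace_index G)) X (exp_semigroup L)"
  shows "submarkovian (H_ae G) H T"
  unfolding submarkovian_def
proof (intro conjI allI impI ballI)
  have lat: "sublattice K (trace_index G) X" using st by (simp add: stonean_sublattice_def)
  have pos: "positivity_preserving (Ball (trace_index G)) X (exp_semigroup L)" using sm unfolding submarkovian_def by (rule conjunct1)
  show "positivity_preserving (H_ae G) H T" by (rule positivity[OF gen lat pos])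
  fix t :: real and f assume t: "0 \<le> t" and f: "f \<in> H"
  have Tf: "T t f \<in> H" using gen t f by (auto simp: generated_by_minus_def C0_semigroup_def)
  obtain \<Theta> where \<Theta>: "countable \<Theta>" "\<Theta> \<subseteq> K" "\<forall>\<theta>\<in>\<Theta>. cmod \<theta> = 1"
    "\<forall>z\<in>K. \<forall>c. (\<forall>\<theta>\<in>\<Theta>. Re (\<theta> * z) \<le> c) \<longrightarrow> cmod z \<le> c"
    using disc_from_half_planes[OF K] by (elim exE conjE)
  have contr: "H_ae G (\<lambda>i. cmod (T t f i) \<le> c)" if c: "0 \<le> c" and le: "H_ae G (\<lambda>i. cmod (f i) \<le> c)" for c
  proof -
    have clipX: "(\<lambda>i. complex_of_real (max (Re (x i) - c) 0)) \<in> X" if x: "x \<in> X" for x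
    proof (cases "c = 0")
      case True
      then show ?thesis using clip_X_0[OF lat pos x] by simp
    next
      case False
      then show ?thesis using stonean_clip[OF K st ReX[OF lat pos x], of c] c by simp
    qed
    have hp: "H_ae G (\<lambda>i. Re (T t g i) \<le> c)" if "g \<in> H" "H_ae G (\<lambda>i. Re (g i) \<le> c)" for g
      by (rule half_plane_invariance[OF gen c ReX[OF lat pos] clipX exp_real[OF lat pos] exp_le_const[OF lat sm c] t that])
    have "H_ae G (\<lambda>i. Re (\<theta> * T t f i) \<le> c)" if \<theta>: "\<theta> \<in> \<Theta>" for \<theta>
    proof (rule rotated_half_plane[OF gen hp t _ f])
      show "\<theta> \<in> K" using \<Theta>(2) \<theta> by blast
      have "Re (\<theta> * z) \<le> c" if "cmod z \<le> c" for z
        using complex_Re_le_cmod[of "\<theta> * z"] bspec[OF \<Theta>(3) \<theta>] that by (simp add: norm_mult)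
      then show "H_ae G (\<lambda>i. Re (\<theta> * f i) \<le> c)" by (rule H_ae_mono[OF le])
    qed
    then have "H_ae G (\<lambda>i. \<forall>\<theta>\<in>\<Theta>. Re (\<theta> * T t f i) \<le> c)" by (rule H_ae_ball_countable[OF \<Theta>(1)])
    from H_ae_conj[OF H_ae_K[OF Tf] this] show ?thesis
    proof (rule H_ae_mono)
      fix i assume "T t f i \<in> K \<and> (\<forall>\<theta>\<in>\<Theta>. Re (\<theta> * T t f i) \<le> c)"
      then show "cmod (T t f i) \<le> c" using \<Theta>(4) by simp
    qed
  qed
  show "sup_norm (H_ae G) (T t f) \<le> sup_norm (H_ae G) f"
    unfolding sup_norm_def
  proof (rule Inf_greatest)
    fix d assume "d \<in> {c. H_ae G (\<lambda>i. ennreal (cmod (f i)) \<le> c)}"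
    then have d: "H_ae G (\<lambda>i. ennreal (cmod (f i)) \<le> d)" by simp
    show "Inf {c. H_ae G (\<lambda>i. ennreal (cmod (T t f i)) \<le> c)} \<le> d"
    proof (cases d)
      case (real c)
      have "H_ae G (\<lambda>i. cmod (f i) \<le> c)" by (rule H_ae_mono[OF d]) (use real in simp)
      from contr[OF real(1) this] have "H_ae G (\<lambda>i. ennreal (cmod (T t f i)) \<le> d)"
        by (rule H_ae_mono) (use real in \<open>simp add: ennreal_leI\<close>)
      then show ?thesis by (intro Inf_lower) simp
    qed simp
  qed
qed

end

theorem theorem4p1:
  fixes K :: "complex set"
    and G :: "('v, 'e) measured_graph"
    and X :: "('v, 'e) tfun set"
    and L :: "('v, 'e) tfun \<Rightarrow> ('v, 'e) tfun"
    and T :: "real \<Rightarrow> ('v, 'e) gfun \<Rightarrow> ('v, 'e) gfun"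
  assumes "K = \<real> \<or> K = UNIV"
    and "wf_measured_graph G"
    and "K_subspace K (trace_index G) X"
    and "selfadjoint_in K X (trace_inner G) L"
    and "pr_V1 ` X = K_fun K (V1 G)"
    and "generated_by_minus K (H_space K G) (H_norm G) (H_op K G X L) T"
  shows "(sublattice K (trace_index G) X \<and>
            positivity_preserving (Ball (trace_index G)) X (exp_semigroup L) \<longrightarrow>
          positivity_preserving (H_ae G) (H_space K G) T) \<and>
         (stonean_sublattice K (trace_index G) X \<and>
            submarkovian (Ball (trace_index G)) X (exp_semigroup L) \<longrightarrow>
          submarkovian (H_ae G) (H_space K G) T)"
proof -
  interpret graph_form K G X L by (rule graph_form.intro[OF assms(1-4)])
  show ?thesis using positivity[OF assms(6)] submarkovian_property[OF assms(6)] by blast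
qed


end
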